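(* Assume that $T$ defines a linear order (i.e., some $\mathcal L$-formula defines a linear order on the universe of every model of $T$) and that $\alpha$ is irrational. Then $\mathbb{T}_\alpha$ is not strongly dependent.
   Context: Let $T$ be a complete theory in a countable first-order language $\mathcal{L}$, with no finite models, admitting quantifier elimination, and geometric: $T$ eliminates $\exists^{\infty}$ and in every model of $T$ the algebraic closure $\operatorname{acl}$ satisfies exchange. $\dim$ is the associated dimension. Sets $Y,Z$ are free over $X$ if $\dim(\bar a/X)=\dim(\bar a/XZ)$ for all finite tuples $\bar a$ from $Y$ and $Y\cap Z=X$. $T$ is indecomposable (no finite-dimensional algebraically closed set $X$ is a finite union of sets of dimension $<\dim(X)$) and has the free-amalgamation property (for $M_0,M_1,M_2\models T^{\forall}$ and embeddings $f_i:M_0\to M_i$ with $\operatorname{acl}(f_i(M_0))=f_i(M_0)$, there are $M\models T$ and embeddings $g_i:M_i\to M$ with $g_1f_1=g_2f_2$ and $g_1(M_1),g_2(M_2)$ free over $g_1f_1(M_0)$). $\mathcal{L}_p=\mathcal{L}\cup\{p\}$, $p$ a new unary predicate ("colored" elements); $\mathcal K$ is the class of $\mathcal L_p$-structures whose $\mathcal L$-reduct models $T^\forall$. Fix real $0<\alpha\le1$. $\delta(A)=\dim(A)-\alpha|p(A)|$, $\delta(A/X)=\dim(A/X)-\alpha|p(A/X)|$ ($p(A/X)$ the colored elements of $A\setminus X$). $\mathcal K_\alpha^+$: those $M\in\mathcal K$ with $\delta(A)\ge0$ for all finite $A$. $X\le Y$ means $X\subseteq Y$ and $\delta(A/X)\ge0$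 for all finite $A\subseteq Y$. For finite tuples $\bar a,\bar d$ in a structure of $\mathcal K_\alpha^+$ with $\bar a\le\bar a\bar d$, $\bar d$ is transcendental over $\bar a$ if $\dim(d/\bar a)=1$ for each entry $d$ of $\bar d$ not in $\bar a$. An $\mathcal L$-formula $\varphi(\bar x,\bar y)$ is strong w.r.t. tuples $\bar d,\bar a$ (with pairwise distinct entries) if $\varphi(\bar x,\bar a)$ is in the quantifier-free $\mathcal L$-type of $\bar d$ over $\bar a$ and in a sufficiently saturated model of $T$: (i) any $\bar d'\bar a'$ satisfying $\varphi$ has pairwise distinct entries; (ii) if $\varphi(\bar d',\bar a')$ and $\dim(\bar d'/\bar a')=\dim(\bar d/\bar a)$ then for every partition $(\bar x_1,\bar x_2)$ of $\bar x$ with corresponding splittings, $\dim(\bar d_2'/\bar d_1'\bar a')\le\dim(\bar d_2/\bar d_1\bar a)$. $d_{\varphi,k}(\bar y)$ is an $\mathcal L$-formula defining the set of $\bar b$ with $\max\{\dim(\bar e/\bar b):\varphi(\bar e,\bar b)\}=k$, and $D_{\varphi,k}(\bar y)$ one defining the set of $\bar b$ such that some $\bar e$ with $\varphi(\bar e,\bar b)$ has $\dim(\bar e/\bar b)\ge k$ and no entry in $\operatorname{acl}(\bar b)$. $\mathbb T_\alpha$ is the $\mathcal L_p$-theory whose models $\mathbb M$ satisfy: $\mathbb M\models T$; $\mathbb M\in\mathcal K_\alpha^+$; and for all $\bar a,\bar d=(d_1,\dots,d_n)$ in a structure of $\mathcal K_\alpha^+$ with $\bar a\le\bar a\bar d$,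 $\bar d$ transcendental over $\bar a$, $\dim(\bar d/\bar a)=k$, and every $\varphi$ strong w.r.t. $\bar d,\bar a$: $\mathbb M\models\forall\bar y[D_{\varphi,k}(\bar y)\wedge d_{\varphi,k}(\bar y)\to\exists\bar z(\varphi(\bar z,\bar y)\wedge\bigwedge_{p(d_i)}p(z_i)\wedge\bigwedge_{\neg p(d_i)}\neg p(z_i))]$. (This theory is complete.) Strong dependence: sequences $\{I_t:t\in X\}$ in a monster model are mutually indiscernible over $A$ if each $I_t$ is indiscernible over $A\cup\bigcup_{s\ne t}I_s$. For a partial type $\Sigma(\bar x)$ over $A$ and a cardinal $\kappa$, $\mathrm{dp\text{-}rk}(\Sigma,A)<\kappa$ means: for every family $\{I_t:t<\kappa\}$ of sequences mutually indiscernible over $A$ and every realization $\bar b$ of $\Sigma$, some $I_t$ is indiscernible over $A\bar b$. A dependent (NIP) theory is strongly dependent if $\mathrm{dp\text{-}rk}(\bar x=\bar x,\emptyset)<\aleph_0$ for tuples $\bar x$ of any length. *)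

theory Defs
  imports Complex_Main "HOL-Library.Countable_Set"
begin

text \<open>A symbol of a language is a name together with its arity; constants are function symbols of
  arity 0. A structure interprets every name of the ambient types, and only the symbols of the
  language under consideration matter. Hence a structure for a larger language is, without any
  change, also its own reduct to a smaller one, and formulas of the smaller language are
  formulas of the larger one.\<close>

record ('f, 'r) lang =
  funs :: "('f \<times> nat) set"
  rels :: "('r \<times> nat) set"

record ('f, 'r, 'u) fo_struct =
  dom :: "'u set"
  fint :: "'f \<Rightarrow> 'u list \<Rightarrow> 'u"
  rint :: "'r \<Rightarrow> 'u list \<Rightarrow> bool"

datatype 'f tm = Var nat | Fun 'f "'f tm list"

datatype ('f, 'r) fm =
    Bot
  | Eql "'f tm" "'f tm"
  | Rel 'r "'f tm list"
  | Neg "('f, 'r) fm"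
  | Con "('f, 'r) fm" "('f, 'r) fm"
  | Exi nat "('f, 'r) fm"

definition All :: "nat \<Rightarrow> ('f, 'r) fm \<Rightarrow> ('f, 'r) fm" where
  "All x \<phi> = Neg (Exi x (Neg \<phi>))"

primrec tm_vars :: "'f tm \<Rightarrow> nat set" where
  "tm_vars (Var x) = {x}"
| "tm_vars (Fun f ts) = \<Union> (set (map tm_vars ts))"

primrec wf_tm :: "('f, 'r) lang \<Rightarrow> 'f tm \<Rightarrow> bool" where
  "wf_tm L (Var x) \<longleftrightarrow> True"
| "wf_tm L (Fun f ts) \<longleftrightarrow> (f, length ts) \<in> funs L \<and> list_all id (map (wf_tm L) ts)"

primrec fv :: "('f, 'r) fm \<Rightarrow> nat set" where
  "fv Bot = {}"
| "fv (Eql s t) = tm_vars s \<union> tm_vars t"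
| "fv (Rel r ts) = (\<Union>t\<in>set ts. tm_vars t)"
| "fv (Neg \<phi>) = fv \<phi>"
| "fv (Con \<phi> \<psi>) = fv \<phi> \<union> fv \<psi>"
| "fv (Exi x \<phi>) = fv \<phi> - {x}"

primrec wf_fm :: "('f, 'r) lang \<Rightarrow> ('f, 'r) fm \<Rightarrow> bool" where
  "wf_fm L Bot \<longleftrightarrow> True"
| "wf_fm L (Eql s t) \<longleftrightarrow> wf_tm L s \<and> wf_tm L t"
| "wf_fm L (Rel r ts) \<longleftrightarrow> (r, length ts) \<in> rels L \<and> (\<forall>t\<in>set ts. wf_tm L t)"
| "wf_fm L (Neg \<phi>) \<longleftrightarrow> wf_fm L \<phi>"
| "wf_fm L (Con \<phi> \<psi>) \<longleftrightarrow> wf_fm L \<phi> \<and> wf_fm L \<psi>"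
| "wf_fm L (Exi x \<phi>) \<longleftrightarrow> wf_fm L \<phi>"

primrec qfree :: "('f, 'r) fm \<Rightarrow> bool" where
  "qfree Bot \<longleftrightarrow> True"
| "qfree (Eql s t) \<longleftrightarrow> True"
| "qfree (Rel r ts) \<longleftrightarrow> True"
| "qfree (Neg \<phi>) \<longleftrightarrow> qfree \<phi>"
| "qfree (Con \<phi> \<psi>) \<longleftrightarrow> qfree \<phi> \<and> qfree \<psi>"
| "qfree (Exi x \<phi>) \<longleftrightarrow> False"

inductive universal :: "('f, 'r) fm \<Rightarrow> bool" where
  "qfree \<phi> \<Longrightarrow> universal \<phi>"
| "universal \<phi> \<Longrightarrow> universal (All x \<phi>)"

primrec eval :: "('f, 'r, 'u) fo_struct \<Rightarrow> (nat \<Rightarrow> 'u) \<Rightarrow> 'f tm \<Rightarrow> 'u" where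
  "eval M v (Var x) = v x"
| "eval M v (Fun f ts) = fint M f (map (eval M v) ts)"

primrec sat :: "('f, 'r, 'u) fo_struct \<Rightarrow> (nat \<Rightarrow> 'u) \<Rightarrow> ('f, 'r) fm \<Rightarrow> bool" where
  "sat M v Bot \<longleftrightarrow> False"
| "sat M v (Eql s t) \<longleftrightarrow> eval M v s = eval M v t"
| "sat M v (Rel r ts) \<longleftrightarrow> rint M r (map (eval M v) ts)"
| "sat M v (Neg \<phi>) \<longleftrightarrow> \<not> sat M v \<phi>"
| "sat M v (Con \<phi> \<psi>) \<longleftrightarrow> sat M v \<phi> \<and> sat M v \<psi>"
| "sat M v (Exi x \<phi>) \<longleftrightarrow> (\<exists>a\<in>dom M. sat M (v(x := a)) \<phi>)"

text \<open>\<open>fmlas L n\<close> are the formulas with free variables among the first \<open>n\<close> variables, and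
  \<open>holds M \<phi> as\<close> evaluates such a formula at the tuple \<open>as\<close> of length \<open>n\<close>. The values \<open>as ! i\<close>
  with \<open>i \<ge> n\<close> are never looked at. A formula written \<open>\<phi>(x,y)\<close> with \<open>x\<close> of length \<open>n\<close> and \<open>y\<close> of
  length \<open>m\<close> is an element of \<open>fmlas L (n + m)\<close>, evaluated at concatenations \<open>d @ a\<close>.\<close>

definition fmlas :: "('f, 'r) lang \<Rightarrow> nat \<Rightarrow> ('f, 'r) fm set" where
  "fmlas L n = {\<phi>. wf_fm L \<phi> \<and> fv \<phi> \<subseteq> {..<n}}"

definition sentences :: "('f, 'r) lang \<Rightarrow> ('f, 'r) fm set" where
  "sentences L = {\<phi>. wf_fm L \<phi> \<and> fv \<phi> = {}}"

definition holds :: "('f, 'r, 'u) fo_struct \<Rightarrow> ('f, 'r) fm \<Rightarrow> 'u list \<Rightarrow> bool" where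
  "holds M \<phi> as \<longleftrightarrow> sat M (nth as) \<phi>"

definition tuples :: "('f, 'r, 'u) fo_struct \<Rightarrow> nat \<Rightarrow> 'u list set" where
  "tuples M n = {as. length as = n \<and> set as \<subseteq> dom M}"

definition is_struct :: "('f, 'r) lang \<Rightarrow> ('f, 'r, 'u) fo_struct \<Rightarrow> bool" where
  "is_struct L M \<longleftrightarrow> dom M \<noteq> {} \<and> (\<forall>(f, n) \<in> funs L. \<forall>as \<in> tuples M n. fint M f as \<in> dom M)"

definition models :: "('f, 'r) lang \<Rightarrow> ('f, 'r) fm set \<Rightarrow> ('f, 'r, 'u) fo_struct \<Rightarrow> bool" where
  "models L T M \<longleftrightarrow> is_struct L M \<and> (\<forall>\<sigma>\<in>T. holds M \<sigma> [])"

definition embedding ::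
  "('f, 'r) lang \<Rightarrow> ('f, 'r, 'u) fo_struct \<Rightarrow> ('f, 'r, 'u) fo_struct \<Rightarrow> ('u \<Rightarrow> 'u) \<Rightarrow> bool" where
  "embedding L M N h \<longleftrightarrow>
     inj_on h (dom M) \<and> h ` dom M \<subseteq> dom N \<and>
     (\<forall>(f, n) \<in> funs L. \<forall>as \<in> tuples M n. h (fint M f as) = fint N f (map h as)) \<and>
     (\<forall>(r, n) \<in> rels L. \<forall>as \<in> tuples M n. rint M r as \<longleftrightarrow> rint N r (map h as))"

definition countable_lang :: "('f, 'r) lang \<Rightarrow> bool" where
  "countable_lang L \<longleftrightarrow> countable (funs L) \<and> countable (rels L)"

text \<open>Notions that quantify over all models of a theory do so over the models whose universe
  is a subset of the type \<open>'u\<close>, which is passed as an argument. By the Loewenheim-Skolem theorem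
  this is no restriction for a countable language as soon as \<open>'u\<close> is infinite.\<close>

definition entails ::
  "'u itself \<Rightarrow> ('f, 'r) lang \<Rightarrow> ('f, 'r) fm set \<Rightarrow> ('f, 'r) fm \<Rightarrow> bool" where
  "entails U L T \<sigma> \<longleftrightarrow> (\<forall>M :: ('f, 'r, 'u) fo_struct. models L T M \<longrightarrow> holds M \<sigma> [])"

definition complete_theory :: "'u itself \<Rightarrow> ('f, 'r) lang \<Rightarrow> ('f, 'r) fm set \<Rightarrow> bool" where
  "complete_theory U L T \<longleftrightarrow>
     T \<subseteq> sentences L \<and>
     (\<exists>M :: ('f, 'r, 'u) fo_struct. models L T M) \<and>
     (\<forall>\<sigma>\<in>sentences L. entails U L T \<sigma> \<or> entails U L T (Neg \<sigma>))"

definition no_finite_models :: "'u itself \<Rightarrow> ('f, 'r) lang \<Rightarrow> ('f, 'r) fm set \<Rightarrow> bool" where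
  "no_finite_models U L T \<longleftrightarrow> (\<forall>M :: ('f, 'r, 'u) fo_struct. models L T M \<longrightarrow> infinite (dom M))"

definition quantifier_elimination :: "'u itself \<Rightarrow> ('f, 'r) lang \<Rightarrow> ('f, 'r) fm set \<Rightarrow> bool" where
  "quantifier_elimination U L T \<longleftrightarrow>
     (\<forall>n. \<forall>\<phi>\<in>fmlas L n. \<exists>\<psi>\<in>fmlas L n. qfree \<psi> \<and>
        (\<forall>M :: ('f, 'r, 'u) fo_struct. models L T M \<longrightarrow>
           (\<forall>as\<in>tuples M n. holds M \<phi> as \<longleftrightarrow> holds M \<psi> as)))"

definition universal_part ::
  "'u itself \<Rightarrow> ('f, 'r) lang \<Rightarrow> ('f, 'r) fm set \<Rightarrow> ('f, 'r) fm set" where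
  "universal_part U L T = {\<sigma>\<in>sentences L. universal \<sigma> \<and> entails U L T \<sigma>}"

definition defines_linear_order :: "'u itself \<Rightarrow> ('f, 'r) lang \<Rightarrow> ('f, 'r) fm set \<Rightarrow> bool" where
  "defines_linear_order U L T \<longleftrightarrow>
     (\<exists>\<phi>\<in>fmlas L 2. \<forall>M :: ('f, 'r, 'u) fo_struct. models L T M \<longrightarrow>
        linear_order_on (dom M) {(a, b). a \<in> dom M \<and> b \<in> dom M \<and> holds M \<phi> [a, b]})"

text \<open>A partial type in \<open>n\<close> variables over \<open>A\<close> is given by formulas with parameters, a formula
  \<open>\<phi>(x,c)\<close> being represented as the pair \<open>(\<phi>, c)\<close>.\<close>

definition formulas_over ::
  "('f, 'r) lang \<Rightarrow> 'u set \<Rightarrow> nat \<Rightarrow> (('f, 'r) fm \<times> 'u list) set" where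
  "formulas_over L A n = {(\<phi>, c). set c \<subseteq> A \<and> \<phi> \<in> fmlas L (n + length c)}"

definition realizes ::
  "('f, 'r, 'u) fo_struct \<Rightarrow> (('f, 'r) fm \<times> 'u list) set \<Rightarrow> 'u list \<Rightarrow> bool" where
  "realizes M \<Sigma> b \<longleftrightarrow> (\<forall>(\<phi>, c)\<in>\<Sigma>. holds M \<phi> (b @ c))"

definition aleph1_saturated :: "('f, 'r) lang \<Rightarrow> ('f, 'r, 'u) fo_struct \<Rightarrow> bool" where
  "aleph1_saturated L M \<longleftrightarrow>
     (\<forall>A n \<Sigma>. A \<subseteq> dom M \<and> countable A \<and> \<Sigma> \<subseteq> formulas_over L A n \<and>
        (\<forall>\<Sigma>'. \<Sigma>' \<subseteq> \<Sigma> \<and> finite \<Sigma>' \<longrightarrow> (\<exists>b\<in>tuples M n. realizes M \<Sigma>' b))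
        \<longrightarrow> (\<exists>b\<in>tuples M n. realizes M \<Sigma> b))"

text \<open>Only finite tuples and countable families of sequences are ever considered, over countable
  languages, so for both ``sufficiently saturated model'' and ``monster model'' the amount of
  saturation that is needed is the one for countable parameter sets.\<close>

definition monster_model ::
  "('f, 'r) lang \<Rightarrow> ('f, 'r) fm set \<Rightarrow> ('f, 'r, 'u) fo_struct \<Rightarrow> bool" where
  "monster_model L T M \<longleftrightarrow> models L T M \<and> aleph1_saturated L M"

definition acl :: "('f, 'r) lang \<Rightarrow> ('f, 'r, 'u) fo_struct \<Rightarrow> 'u set \<Rightarrow> 'u set" where
  "acl L M B = {a\<in>dom M. \<exists>(\<phi>, b) \<in> formulas_over L (B \<inter> dom M) 1.
     holds M \<phi> (a # b) \<and> finite {a'\<in>dom M. holds M \<phi> (a' # b)}}"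

text \<open>Algebraic closure inside a model \<open>M\<close> of the universal part of \<open>T\<close>: it is the trace on \<open>M\<close> of
  the algebraic closure in a model of \<open>T\<close> extending \<open>M\<close>. By quantifier elimination the choice of
  that model is immaterial, and for \<open>M\<close> a model of \<open>T\<close> this is \<open>acl L M\<close>.\<close>

definition acl_forall ::
  "('f, 'r) lang \<Rightarrow> ('f, 'r) fm set \<Rightarrow> ('f, 'r, 'u) fo_struct \<Rightarrow> 'u set \<Rightarrow> 'u set" where
  "acl_forall L T M B = {a\<in>dom M. \<exists>(N :: ('f, 'r, 'u) fo_struct) h.
     models L T N \<and> embedding L M N h \<and> h a \<in> acl L N (h ` (B \<inter> dom M))}"

text \<open>\<open>acl_dim cl A X\<close> is the dimension of \<open>A\<close> over \<open>X\<close> for a closure operator \<open>cl\<close> with exchange: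
  the size of a basis of \<open>A\<close> over \<open>X\<close>. It is meaningful for \<open>A\<close> of finite dimension over \<open>X\<close> only.
  The dimension of a tuple is the dimension of the set of its entries.\<close>

definition finite_dim :: "('u set \<Rightarrow> 'u set) \<Rightarrow> 'u set \<Rightarrow> 'u set \<Rightarrow> bool" where
  "finite_dim cl A X \<longleftrightarrow> (\<exists>B\<subseteq>A. finite B \<and> A \<subseteq> cl (X \<union> B))"

definition acl_dim :: "('u set \<Rightarrow> 'u set) \<Rightarrow> 'u set \<Rightarrow> 'u set \<Rightarrow> nat" where
  "acl_dim cl A X = (LEAST n. \<exists>B\<subseteq>A. finite B \<and> card B = n \<and> A \<subseteq> cl (X \<union> B))"

definition eliminates_exists_infinity ::
  "'u itself \<Rightarrow> ('f, 'r) lang \<Rightarrow> ('f, 'r) fm set \<Rightarrow> bool" where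
  "eliminates_exists_infinity U L T \<longleftrightarrow>
     (\<forall>m. \<forall>\<phi>\<in>fmlas L (1 + m). \<exists>\<psi>\<in>fmlas L m. \<forall>M :: ('f, 'r, 'u) fo_struct. models L T M \<longrightarrow>
        (\<forall>b\<in>tuples M m. holds M \<psi> b \<longleftrightarrow> infinite {a\<in>dom M. holds M \<phi> (a # b)}))"

definition geometric :: "'u itself \<Rightarrow> ('f, 'r) lang \<Rightarrow> ('f, 'r) fm set \<Rightarrow> bool" where
  "geometric U L T \<longleftrightarrow>
     eliminates_exists_infinity U L T \<and>
     (\<forall>M :: ('f, 'r, 'u) fo_struct. models L T M \<longrightarrow>
        (\<forall>A a b. A \<subseteq> dom M \<and> a \<in> dom M \<and> b \<in> dom M \<and>
           a \<in> acl L M (insert b A) - acl L M A \<longrightarrow> b \<in> acl L M (insert a A)))"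

text \<open>Nonempty families only: otherwise the closed set \<open>{}\<close>, which exists whenever nothing is
  algebraic over the empty set, would be decomposed by the empty family.\<close>

definition indecomposable :: "'u itself \<Rightarrow> ('f, 'r) lang \<Rightarrow> ('f, 'r) fm set \<Rightarrow> bool" where
  "indecomposable U L T \<longleftrightarrow>
     (\<forall>M :: ('f, 'r, 'u) fo_struct. models L T M \<longrightarrow>
        (\<forall>X. X \<subseteq> dom M \<and> acl L M X = X \<and> finite_dim (acl L M) X {} \<longrightarrow>
           \<not> (\<exists>\<Y>. finite \<Y> \<and> \<Y> \<noteq> {} \<and> \<Union>\<Y> = X \<and>
                (\<forall>Y\<in>\<Y>. acl_dim (acl L M) Y {} < acl_dim (acl L M) X {}))))"

definition free_over ::
  "('f, 'r) lang \<Rightarrow> ('f, 'r, 'u) fo_struct \<Rightarrow> 'u set \<Rightarrow> 'u set \<Rightarrow> 'u set \<Rightarrow> bool" where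
  "free_over L M Y Z X \<longleftrightarrow>
     (\<forall>a. set a \<subseteq> Y \<longrightarrow> acl_dim (acl L M) (set a) X = acl_dim (acl L M) (set a) (X \<union> Z)) \<and>
     Y \<inter> Z = X"

definition free_amalgamation :: "'u itself \<Rightarrow> ('f, 'r) lang \<Rightarrow> ('f, 'r) fm set \<Rightarrow> bool" where
  "free_amalgamation U L T \<longleftrightarrow>
     (\<forall>(M0 :: ('f, 'r, 'u) fo_struct) M1 M2 f1 f2.
        models L (universal_part U L T) M0 \<and>
        models L (universal_part U L T) M1 \<and>
        models L (universal_part U L T) M2 \<and>
        embedding L M0 M1 f1 \<and> embedding L M0 M2 f2 \<and>
        acl_forall L T M1 (f1 ` dom M0) = f1 ` dom M0 \<and>
        acl_forall L T M2 (f2 ` dom M0) = f2 ` dom M0 \<longrightarrow>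
        (\<exists>M g1 g2. models L T M \<and> embedding L M1 M g1 \<and> embedding L M2 M g2 \<and>
           (\<forall>x\<in>dom M0. g1 (f1 x) = g2 (f2 x)) \<and>
           free_over L M (g1 ` dom M1) (g2 ` dom M2) (g1 ` f1 ` dom M0)))"

definition add_pred :: "('f, 'r) lang \<Rightarrow> 'r \<Rightarrow> ('f, 'r) lang" where
  "add_pred L p = L\<lparr>rels := insert (p, 1) (rels L)\<rparr>"

definition class_K ::
  "('f, 'r) lang \<Rightarrow> ('f, 'r) fm set \<Rightarrow> 'r \<Rightarrow> ('f, 'r, 'u) fo_struct set" where
  "class_K L T p =
     {M. is_struct (add_pred L p) M \<and> models L (universal_part TYPE('u) L T) M}"

abbreviation dimK ::
  "('f, 'r) lang \<Rightarrow> ('f, 'r) fm set \<Rightarrow> ('f, 'r, 'u) fo_struct \<Rightarrow> 'u set \<Rightarrow> 'u set \<Rightarrow> nat" where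
  "dimK L T M \<equiv> acl_dim (acl_forall L T M)"

definition delta ::
  "('f, 'r) lang \<Rightarrow> ('f, 'r) fm set \<Rightarrow> 'r \<Rightarrow> real \<Rightarrow> ('f, 'r, 'u) fo_struct
     \<Rightarrow> 'u set \<Rightarrow> 'u set \<Rightarrow> real" where
  "delta L T p \<alpha> M A X = real (dimK L T M A X) - \<alpha> * real (card {a\<in>A - X. rint M p [a]})"

definition class_K_alpha ::
  "('f, 'r) lang \<Rightarrow> ('f, 'r) fm set \<Rightarrow> 'r \<Rightarrow> real \<Rightarrow> ('f, 'r, 'u) fo_struct set" where
  "class_K_alpha L T p \<alpha> =
     {M\<in>class_K L T p. \<forall>A. finite A \<and> A \<subseteq> dom M \<longrightarrow> delta L T p \<alpha> M A {} \<ge> 0}"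

definition closed_in ::
  "('f, 'r) lang \<Rightarrow> ('f, 'r) fm set \<Rightarrow> 'r \<Rightarrow> real \<Rightarrow> ('f, 'r, 'u) fo_struct
     \<Rightarrow> 'u set \<Rightarrow> 'u set \<Rightarrow> bool" where
  "closed_in L T p \<alpha> M X Y \<longleftrightarrow>
     X \<subseteq> Y \<and> (\<forall>A. finite A \<and> A \<subseteq> Y \<longrightarrow> delta L T p \<alpha> M A X \<ge> 0)"

definition transcendental ::
  "('f, 'r) lang \<Rightarrow> ('f, 'r) fm set \<Rightarrow> ('f, 'r, 'u) fo_struct \<Rightarrow> 'u list \<Rightarrow> 'u list \<Rightarrow> bool" where
  "transcendental L T M d a \<longleftrightarrow> (\<forall>x\<in>set d - set a. dimK L T M {x} (set a) = 1)"

text \<open>A partition of the tuple of variables is given by a set \<open>I\<close> of positions and its complement.\<close>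

definition strong ::
  "('f, 'r) lang \<Rightarrow> ('f, 'r) fm set \<Rightarrow> ('f, 'r, 'u) fo_struct \<Rightarrow> 'u list \<Rightarrow> 'u list
     \<Rightarrow> ('f, 'r) fm \<Rightarrow> bool" where
  "strong L T M d a \<phi> \<longleftrightarrow>
     distinct (d @ a) \<and>
     \<phi> \<in> fmlas L (length d + length a) \<and> qfree \<phi> \<and> holds M \<phi> (d @ a) \<and>
     (\<forall>N :: ('f, 'r, 'u) fo_struct. models L T N \<and> aleph1_saturated L N \<longrightarrow>
        (\<forall>d'\<in>tuples N (length d). \<forall>a'\<in>tuples N (length a). holds N \<phi> (d' @ a') \<longrightarrow>
           distinct (d' @ a') \<and>
           (acl_dim (acl L N) (set d') (set a') = dimK L T M (set d) (set a) \<longrightarrow>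
              (\<forall>I \<subseteq> {..<length d}.
                 acl_dim (acl L N) (set (nths d' (- I))) (set (nths d' I) \<union> set a')
                   \<le> dimK L T M (set (nths d (- I))) (set (nths d I) \<union> set a)))))"

text \<open>The sets defined by the formulas \<open>d_{\<phi>,k}\<close> and \<open>D_{\<phi>,k}\<close> have to be read in a sufficiently
  saturated model: in an arbitrary model \<open>\<phi>(x,b)\<close> need not have solutions of maximal dimension.
  By completeness of \<open>T\<close> any two formulas defining them are equivalent modulo \<open>T\<close>.\<close>

definition is_d_formula ::
  "'u itself \<Rightarrow> ('f, 'r) lang \<Rightarrow> ('f, 'r) fm set \<Rightarrow> nat \<Rightarrow> nat \<Rightarrow> ('f, 'r) fm \<Rightarrow> nat
     \<Rightarrow> ('f, 'r) fm \<Rightarrow> bool" where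
  "is_d_formula U L T n m \<phi> k \<theta> \<longleftrightarrow>
     \<theta> \<in> fmlas L m \<and>
     (\<forall>N :: ('f, 'r, 'u) fo_struct. models L T N \<and> aleph1_saturated L N \<longrightarrow>
        (\<forall>b\<in>tuples N m. holds N \<theta> b \<longleftrightarrow>
           (\<exists>e\<in>tuples N n. holds N \<phi> (e @ b) \<and> acl_dim (acl L N) (set e) (set b) = k) \<and>
           (\<forall>e\<in>tuples N n. holds N \<phi> (e @ b) \<longrightarrow> acl_dim (acl L N) (set e) (set b) \<le> k)))"

definition is_D_formula ::
  "'u itself \<Rightarrow> ('f, 'r) lang \<Rightarrow> ('f, 'r) fm set \<Rightarrow> nat \<Rightarrow> nat \<Rightarrow> ('f, 'r) fm \<Rightarrow> nat
     \<Rightarrow> ('f, 'r) fm \<Rightarrow> bool" where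
  "is_D_formula U L T n m \<phi> k \<theta> \<longleftrightarrow>
     \<theta> \<in> fmlas L m \<and>
     (\<forall>N :: ('f, 'r, 'u) fo_struct. models L T N \<and> aleph1_saturated L N \<longrightarrow>
        (\<forall>b\<in>tuples N m. holds N \<theta> b \<longleftrightarrow>
           (\<exists>e\<in>tuples N n. holds N \<phi> (e @ b) \<and> acl_dim (acl L N) (set e) (set b) \<ge> k \<and>
              set e \<inter> acl L N (set b) = {})))"

definition rich_model ::
  "('f, 'r) lang \<Rightarrow> ('f, 'r) fm set \<Rightarrow> 'r \<Rightarrow> real \<Rightarrow> ('f, 'r, 'u) fo_struct \<Rightarrow> bool" where
  "rich_model L T p \<alpha> M \<longleftrightarrow>
     models L T M \<and> M \<in> class_K_alpha L T p \<alpha> \<and>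
     (\<forall>(N :: ('f, 'r, 'u) fo_struct) a d k \<phi> \<theta>d \<theta>D.
        N \<in> class_K_alpha L T p \<alpha> \<and> set a \<subseteq> dom N \<and> set d \<subseteq> dom N \<and>
        closed_in L T p \<alpha> N (set a) (set a \<union> set d) \<and>
        transcendental L T N d a \<and> dimK L T N (set d) (set a) = k \<and>
        strong L T N d a \<phi> \<and>
        is_d_formula TYPE('u) L T (length d) (length a) \<phi> k \<theta>d \<and>
        is_D_formula TYPE('u) L T (length d) (length a) \<phi> k \<theta>D \<longrightarrow>
        (\<forall>b\<in>tuples M (length a). holds M \<theta>D b \<and> holds M \<theta>d b \<longrightarrow>
           (\<exists>e\<in>tuples M (length d). holds M \<phi> (e @ b) \<and>
              (\<forall>i<length d. rint M p [e ! i] \<longleftrightarrow> rint N p [d ! i]))))"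

text \<open>The conditions in \<open>rich_model\<close> are first-order, so they describe exactly the models of
  the following theory.\<close>

definition T_alpha ::
  "'u itself \<Rightarrow> ('f, 'r) lang \<Rightarrow> ('f, 'r) fm set \<Rightarrow> 'r \<Rightarrow> real \<Rightarrow> ('f, 'r) fm set" where
  "T_alpha U L T p \<alpha> =
     {\<sigma>\<in>sentences (add_pred L p).
        \<forall>M :: ('f, 'r, 'u) fo_struct. rich_model L T p \<alpha> M \<longrightarrow> holds M \<sigma> []}"

text \<open>A sequence is an \<open>\<omega>\<close>-sequence of finite tuples of a common length.\<close>

definition indiscernible ::
  "('f, 'r) lang \<Rightarrow> ('f, 'r, 'u) fo_struct \<Rightarrow> 'u set \<Rightarrow> (nat \<Rightarrow> 'u list) \<Rightarrow> bool" where
  "indiscernible L M A S \<longleftrightarrow>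
     (\<exists>l. \<forall>i. S i \<in> tuples M l) \<and>
     (\<forall>is js. sorted_wrt (<) is \<and> sorted_wrt (<) js \<and> length is = length js \<longrightarrow>
        (\<forall>(\<phi>, c) \<in> formulas_over L A (length (concat (map S is))).
           holds M \<phi> (concat (map S is) @ c) \<longleftrightarrow> holds M \<phi> (concat (map S js) @ c)))"

definition mutually_indiscernible ::
  "('f, 'r) lang \<Rightarrow> ('f, 'r, 'u) fo_struct \<Rightarrow> 'u set \<Rightarrow> 'k set \<Rightarrow> ('k \<Rightarrow> nat \<Rightarrow> 'u list) \<Rightarrow> bool" where
  "mutually_indiscernible L M A K S \<longleftrightarrow>
     (\<forall>t\<in>K. indiscernible L M (A \<union> (\<Union>s\<in>K - {t}. \<Union>i. set (S s i))) (S t))"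

text \<open>\<open>dp_rk_less L M n \<Sigma> A K\<close> says that the dp-rank over \<open>A\<close> of the partial type \<open>\<Sigma>\<close> in \<open>n\<close>
  variables, computed in the monster model \<open>M\<close>, is less than the cardinality of \<open>K\<close>.\<close>

definition dp_rk_less ::
  "('f, 'r) lang \<Rightarrow> ('f, 'r, 'u) fo_struct \<Rightarrow> nat \<Rightarrow> (('f, 'r) fm \<times> 'u list) set \<Rightarrow> 'u set
     \<Rightarrow> 'k set \<Rightarrow> bool" where
  "dp_rk_less L M n \<Sigma> A K \<longleftrightarrow>
     (\<forall>S. \<forall>b\<in>tuples M n. mutually_indiscernible L M A K S \<and> realizes M \<Sigma> b \<longrightarrow>
        (\<exists>t\<in>K. indiscernible L M (A \<union> set b) (S t)))"

definition trivial_type :: "nat \<Rightarrow> (('f, 'r) fm \<times> 'u list) set" where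
  "trivial_type n = (\<lambda>i. (Eql (Var i) (Var i), [])) ` {..<n}"

definition dependent :: "('f, 'r) lang \<Rightarrow> ('f, 'r, 'u) fo_struct \<Rightarrow> bool" where
  "dependent L M \<longleftrightarrow>
     (\<forall>n m. \<forall>\<phi>\<in>fmlas L (n + m). \<not> (\<exists>(a :: nat \<Rightarrow> 'u list) (b :: nat set \<Rightarrow> 'u list).
        (\<forall>i. a i \<in> tuples M n) \<and> (\<forall>W. b W \<in> tuples M m) \<and>
        (\<forall>i W. holds M \<phi> (a i @ b W) \<longleftrightarrow> i \<in> W)))"

text \<open>Strong dependence of a complete theory, evaluated in a monster model \<open>M\<close> of it; the rank is
  compared with \<open>\<aleph>\<^sub>0\<close>, the cardinality of \<open>UNIV :: nat set\<close>.\<close>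

definition strongly_dependent :: "('f, 'r) lang \<Rightarrow> ('f, 'r, 'u) fo_struct \<Rightarrow> bool" where
  "strongly_dependent L M \<longleftrightarrow>
     dependent L M \<and> (\<forall>n. dp_rk_less L M n (trivial_type n) {} (UNIV :: nat set))"

end

theory Submission
  imports Defs "HOL-Library.Ramsey" "HOL-Analysis.Kronecker_Approximation_Theorem"
begin

text \<open>We refute strong dependence by one element \<open>b\<close> that destroys the indiscernibility of each of
  infinitely many mutually indiscernible sequences. Cut one indiscernible sequence of order type
  \<open>\<omega>\<^sup>2\<close> into rows \<open>(c (t, i))\<close>. As \<open>\<alpha>\<close> is irrational, there are \<open>k t \<ge> 1\<close> and \<open>n t\<close> with
  \<open>k t < \<alpha> * n t < k t + 1 / 2 ^ Suc t\<close>. Indecomposability provides, in the reduct to \<open>L\<close>, an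
  element \<open>b\<close> and tuples \<open>z t\<close> of length \<open>n t\<close>, independent over \<open>b\<close>, such that \<open>b\<close> together with
  \<open>z t\<close> is a uniform matroid of rank \<open>k t + 1\<close> and the first entry of \<open>z t\<close> lies between \<open>c (t, 0)\<close>
  and \<open>c (t, 1)\<close>. Coloring the entries of finitely many \<open>z t\<close> costs in total at most \<open>1\<close>, the
  dimension of \<open>b\<close>, so the result lies in \<open>K\<^sub>\<alpha>\<^sup>+\<close>; by the extension axioms and saturation some \<open>b\<close>
  has such colored \<open>z t\<close> for all \<open>t\<close>. If row \<open>t\<close> were indiscernible over \<open>b\<close>, there would be such
  colored tuples in infinitely many disjoint intervals, but \<open>\<delta> \<ge> 0\<close> allows only finitely many,
  because every new tuple lowers \<open>\<delta>\<close> over \<open>b\<close> by a fixed amount.\<close>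

section \<open>Renaming and definable predicates\<close>

text \<open>Irrationality makes the losses \<open>\<alpha> * n t - k t\<close> positive and yet
  summable. For rational \<open>\<alpha>\<close> the positive values of
  \<open>\<alpha> * n - k\<close> have a least element, and one element of dimension 1 could pay for
  finitely many rows only. Uniformity is required because \<open>\<delta> \<ge> 0\<close> is a
  condition on all subsets: up to \<open>k t\<close> entries of a tuple are independent and pay for
  themselves, while more than \<open>k t\<close> entries bring \<open>b\<close> into the closure and
  so its dimension into the account. The linear order forces infinitely many different tuples:
  disjoint intervals of a row yield different first entries. The tuples may still overlap elsewhere,
  so the final count is made on their union. A further obstacle is that \<open>T_alpha\<close>
  consists of the sentences true in all rich models, while the monster model is not known to be
  rich. Each fact about rich models therefore has to be cast into a sentence before it can be used,
  which is why predicates are treated through definability in all models of \<open>T\<close> at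
  once.\<close>

lemma finite_tm_vars [simp]: "finite (tm_vars t)"
  by (induction t) auto

lemma finite_fv [simp]: "finite (fv \<phi>)"
  by (induction \<phi>) auto

lemma eval_cong: "(\<And>x. x \<in> tm_vars t \<Longrightarrow> v x = w x) \<Longrightarrow> eval M v t = eval M w t"
proof (induction t)
  case (Fun f ts)
  have "eval M v t = eval M w t" if "t \<in> set ts" for t
    by (rule Fun.IH[OF that]) (use Fun.prems that in auto)
  then have "map (eval M v) ts = map (eval M w) ts" by (simp only: map_eq_conv) blast
  then show ?case by (simp only: eval.simps)
qed auto

lemma sat_cong: "(\<And>x. x \<in> fv \<phi> \<Longrightarrow> v x = w x) \<Longrightarrow> sat M v \<phi> = sat M w \<phi>"
proof (induction \<phi> arbitrary: v w)
  case (Eql s t)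
  have "eval M v s = eval M w s" "eval M v t = eval M w t"
    by (rule eval_cong, use Eql in simp)+
  then show ?case by (simp only: sat.simps)
next
  case (Rel r ts)
  have "eval M v t = eval M w t" if "t \<in> set ts" for t
    by (rule eval_cong) (use Rel.prems that in auto)
  then have "map (eval M v) ts = map (eval M w) ts" by (simp only: map_eq_conv) blast
  then show ?case by (simp only: sat.simps)
next
  case (Neg \<phi>)
  have "sat M v \<phi> = sat M w \<phi>" by (rule Neg.IH) (use Neg.prems in simp)
  then show ?case by (simp only: sat.simps)
next
  case (Con \<phi> \<psi>)
  have "sat M v \<phi> = sat M w \<phi>" by (rule Con.IH(1)) (use Con.prems in simp)
  moreover have "sat M v \<psi> = sat M w \<psi>" by (rule Con.IH(2)) (use Con.prems in simp)
  ultimately show ?case by (simp only: sat.simps)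
next
  case (Exi x \<phi>)
  have "sat M (v(x := a)) \<phi> = sat M (w(x := a)) \<phi>" for a
    by (rule Exi.IH) (use Exi.prems in \<open>simp split: if_splits\<close>)
  then show ?case by (simp only: sat.simps)
qed simp

primrec ren_tm :: "(nat \<Rightarrow> nat) \<Rightarrow> 'f tm \<Rightarrow> 'f tm" where
  "ren_tm f (Var x) = Var (f x)"
| "ren_tm f (Fun g ts) = Fun g (map (ren_tm f) ts)"

text \<open>The bound variable moves to a name above the images of all free variables of the body.
  This excludes capture for every \<open>f\<close>, injective or not, so that variables may also be
  identified.\<close>

primrec ren :: "(nat \<Rightarrow> nat) \<Rightarrow> ('f, 'r) fm \<Rightarrow> ('f, 'r) fm" where
  "ren f Bot = Bot"
| "ren f (Eql s t) = Eql (ren_tm f s) (ren_tm f t)"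
| "ren f (Rel r ts) = Rel r (map (ren_tm f) ts)"
| "ren f (Neg \<phi>) = Neg (ren f \<phi>)"
| "ren f (Con \<phi> \<psi>) = Con (ren f \<phi>) (ren f \<psi>)"
| "ren f (Exi x \<phi>) = (let y = Suc (Max (insert 0 (f ` fv \<phi>))) in Exi y (ren (f(x := y)) \<phi>))"

lemma eval_ren_tm: "eval M v (ren_tm f t) = eval M (v \<circ> f) t"
  by (induction t) (auto intro!: arg_cong[where f = "fint M _"])

lemma tm_vars_ren_tm: "tm_vars (ren_tm f t) = f ` tm_vars t"
  by (induction t) auto

lemma wf_ren_tm: "wf_tm L (ren_tm f t) = wf_tm L t"
  by (induction t) (auto simp: list_all_iff)

lemma wf_ren: "wf_fm L (ren f \<phi>) = wf_fm L \<phi>"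
  by (induction \<phi> arbitrary: f) (auto simp: wf_ren_tm Let_def)

lemma fv_ren: "fv (ren f \<phi>) \<subseteq> f ` fv \<phi>"
proof (induction \<phi> arbitrary: f)
  case (Exi x \<phi>)
  then show ?case
    by (fastforce simp: Let_def split: if_splits)
qed (fastforce simp: tm_vars_ren_tm)+

lemma sat_ren: "sat M v (ren f \<phi>) = sat M (v \<circ> f) \<phi>"
proof (induction \<phi> arbitrary: f v)
  case (Rel r ts)
  have "map (eval M v) (map (ren_tm f) ts) = map (eval M (v \<circ> f)) ts"
    by (simp add: eval_ren_tm)
  then show ?case by (simp only: sat.simps ren.simps)
next
  case (Exi x \<phi>)
  define y where "y = Suc (Max (insert 0 (f ` fv \<phi>)))"
  have y: "f z \<noteq> y" if "z \<in> fv \<phi>" for z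
  proof -
    have "f z \<le> Max (insert 0 (f ` fv \<phi>))" using that by (intro Max_ge) auto
    then show ?thesis by (simp add: y_def)
  qed
  have "sat M (v(y := a) \<circ> f(x := y)) \<phi> = sat M ((v \<circ> f)(x := a)) \<phi>" for a
    by (rule sat_cong) (use y in auto)
  then have "sat M (v(y := a)) (ren (f(x := y)) \<phi>) = sat M ((v \<circ> f)(x := a)) \<phi>" for a
    by (simp only: Exi.IH)
  then show ?case
    by (simp only: ren.simps Let_def y_def[symmetric] sat.simps)
qed (simp_all add: eval_ren_tm)

text \<open>Most formulas below arise from closure rules for this notion instead of being written
  out. One formula has to work in all structures of \<open>C\<close>, since what is found in one
  model is later carried to others.\<close>

definition definable ::
  "('f, 'r) lang \<Rightarrow> ('f, 'r, 'u) fo_struct set \<Rightarrow> nat \<Rightarrow> (('f, 'r, 'u) fo_struct \<Rightarrow> 'u list \<Rightarrow> bool) \<Rightarrow> bool"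
  where "definable L C n P \<longleftrightarrow>
    (\<exists>\<phi>\<in>fmlas L n. \<forall>M\<in>C. \<forall>as\<in>tuples M n. holds M \<phi> as \<longleftrightarrow> P M as)"

lemma definableI:
  "\<phi> \<in> fmlas L n \<Longrightarrow> (\<And>M as. M \<in> C \<Longrightarrow> as \<in> tuples M n \<Longrightarrow> holds M \<phi> as \<longleftrightarrow> P M as) \<Longrightarrow> definable L C n P"
  unfolding definable_def by blast

lemma definableE:
  assumes "definable L C n P"
  obtains \<phi> where "\<phi> \<in> fmlas L n" "\<And>M as. M \<in> C \<Longrightarrow> as \<in> tuples M n \<Longrightarrow> holds M \<phi> as \<longleftrightarrow> P M as"
  using assms unfolding definable_def by blast

lemma definable_holds: "\<phi> \<in> fmlas L n \<Longrightarrow> definable L C n (\<lambda>M. holds M \<phi>)"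
  by (rule definableI) auto

lemma definable_cong:
  "(\<And>M as. M \<in> C \<Longrightarrow> as \<in> tuples M n \<Longrightarrow> P M as = Q M as) \<Longrightarrow> definable L C n P = definable L C n Q"
  unfolding definable_def by auto

lemma definable_False: "definable L C n (\<lambda>M as. False)"
  by (rule definableI[of Bot]) (auto simp: fmlas_def holds_def)

lemma definable_not: "definable L C n P \<Longrightarrow> definable L C n (\<lambda>M as. \<not> P M as)"
  by (erule definableE, rule definableI[of "Neg _"]) (auto simp: fmlas_def holds_def)

lemma definable_True: "definable L C n (\<lambda>M as. True)"
  using definable_not[OF definable_False] by simp

lemma definable_conj:
  assumes "definable L C n P" "definable L C n Q"
  shows "definable L C n (\<lambda>M as. P M as \<and> Q M as)"
proof -
  from assms obtain \<phi> \<psi> where "\<phi> \<in> fmlas L n" "\<psi> \<in> fmlas L n"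
    "\<And>M as. M \<in> C \<Longrightarrow> as \<in> tuples M n \<Longrightarrow> holds M \<phi> as \<longleftrightarrow> P M as"
    "\<And>M as. M \<in> C \<Longrightarrow> as \<in> tuples M n \<Longrightarrow> holds M \<psi> as \<longleftrightarrow> Q M as"
    by (metis definableE)
  then show ?thesis
    by (intro definableI[of "Con \<phi> \<psi>"]) (auto simp: fmlas_def holds_def)
qed

lemma definable_disj:
  assumes "definable L C n P" "definable L C n Q"
  shows "definable L C n (\<lambda>M as. P M as \<or> Q M as)"
proof -
  have "definable L C n (\<lambda>M as. \<not> (\<not> P M as \<and> \<not> Q M as))"
    by (rule definable_not, rule definable_conj; rule definable_not, rule assms)
  then show ?thesis by simp
qed

lemma definable_imp:
  assumes "definable L C n P" "definable L C n Q"
  shows "definable L C n (\<lambda>M as. P M as \<longrightarrow> Q M as)"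
  using definable_disj[OF definable_not[OF assms(1)] assms(2)] by (simp only: imp_conv_disj)

lemma definable_iff:
  assumes "definable L C n P" "definable L C n Q"
  shows "definable L C n (\<lambda>M as. P M as \<longleftrightarrow> Q M as)"
  using definable_conj[OF definable_imp[OF assms] definable_imp[OF assms(2,1)]]
  by (simp only: iff_conv_conj_imp[symmetric])

lemma definable_ball:
  assumes "finite I" "\<And>i. i \<in> I \<Longrightarrow> definable L C n (P i)"
  shows "definable L C n (\<lambda>M as. \<forall>i\<in>I. P i M as)"
  using assms
proof (induction I)
  case empty
  then show ?case by (simp add: definable_True)
next
  case (insert i I)
  then have "definable L C n (\<lambda>M as. P i M as \<and> (\<forall>i\<in>I. P i M as))"
    by (intro definable_conj) auto
  then show ?case by simp
qed

lemma fmlas_lang_mono: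
  assumes "funs L \<subseteq> funs L'" "rels L \<subseteq> rels L'"
  shows "fmlas L n \<subseteq> fmlas L' n"
proof -
  have tm: "wf_tm L t \<Longrightarrow> wf_tm L' t" for t
    by (induction t) (use assms in \<open>auto simp: list_all_iff\<close>)
  have "wf_fm L \<phi> \<Longrightarrow> wf_fm L' \<phi>" for \<phi>
    by (induction \<phi>) (use assms tm in auto)
  then show ?thesis by (auto simp: fmlas_def)
qed

lemma definable_lang_mono:
  assumes "definable L C n P" "funs L \<subseteq> funs L'" "rels L \<subseteq> rels L'"
  shows "definable L' C n P"
  using assms(1) fmlas_lang_mono[OF assms(2,3), of n] unfolding definable_def by blast

lemma definable_eq: "i < n \<Longrightarrow> j < n \<Longrightarrow> definable L C n (\<lambda>M as. as ! i = as ! j)"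
  by (rule definableI[of "Eql (Var i) (Var j)"]) (auto simp: fmlas_def holds_def)

text \<open>Positions in \<open>is\<close> may be permuted, repeated or omitted, so this single rule
  covers permutation, identification and weakening of variables.\<close>

lemma definable_subst:
  assumes "definable L C (length is) P" "set is \<subseteq> {..<m}"
  shows "definable L C m (\<lambda>M as. P M (map ((!) as) is))"
proof -
  obtain \<phi> where \<phi>: "\<phi> \<in> fmlas L (length is)"
    "\<And>M as. M \<in> C \<Longrightarrow> as \<in> tuples M (length is) \<Longrightarrow> holds M \<phi> as \<longleftrightarrow> P M as"
    using assms by (metis definableE)
  show ?thesis
  proof (rule definableI[of "ren ((!) is) \<phi>"])
    show "ren ((!) is) \<phi> \<in> fmlas L m"
      using \<phi>(1) fv_ren[of "(!) is" \<phi>] assms(2)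
      by (fastforce simp: fmlas_def wf_ren dest: nth_mem)
    fix M as assume M: "M \<in> C" "as \<in> tuples M m"
    have "holds M (ren ((!) is) \<phi>) as = sat M ((!) as \<circ> (!) is) \<phi>"
      by (simp add: holds_def sat_ren)
    also have "\<dots> = holds M \<phi> (map ((!) as) is)"
      unfolding holds_def by (rule sat_cong) (use \<phi>(1) in \<open>auto simp: fmlas_def\<close>)
    also have "\<dots> = P M (map ((!) as) is)"
      by (rule \<phi>(2)) (use M assms(2) in \<open>fastforce simp: tuples_def\<close>)+
    finally show "holds M (ren ((!) is) \<phi>) as = P M (map ((!) as) is)" .
  qed
qed

lemma map_nth_upt: "i + k \<le> length as \<Longrightarrow> map ((!) as) [i..<i + k] = take k (drop i as)"
  by (rule nth_equalityI) auto

lemma definable_ex_last: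
  assumes "definable L C (Suc n) P"
  shows "definable L C n (\<lambda>M as. \<exists>x\<in>dom M. P M (as @ [x]))"
proof -
  obtain \<phi> where \<phi>: "\<phi> \<in> fmlas L (Suc n)"
    "\<And>M as. M \<in> C \<Longrightarrow> as \<in> tuples M (Suc n) \<Longrightarrow> holds M \<phi> as \<longleftrightarrow> P M as"
    using assms by (metis definableE)
  show ?thesis
  proof (rule definableI[of "Exi n \<phi>"])
    show "Exi n \<phi> \<in> fmlas L n" using \<phi>(1) by (auto simp: fmlas_def less_Suc_eq)
    fix M as assume M: "M \<in> C" "as \<in> tuples M n"
    have "sat M (((!) as)(n := x)) \<phi> = P M (as @ [x])" if "x \<in> dom M" for x
    proof -
      have "sat M (((!) as)(n := x)) \<phi> = holds M \<phi> (as @ [x])"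
        unfolding holds_def
        by (rule sat_cong) (use \<phi>(1) M in \<open>auto simp: fmlas_def tuples_def nth_append less_Suc_eq\<close>)
      then show ?thesis using \<phi>(2) M that by (auto simp: tuples_def)
    qed
    then show "holds M (Exi n \<phi>) as = (\<exists>x\<in>dom M. P M (as @ [x]))"
      by (simp add: holds_def)
  qed
qed

lemma definable_ex:
  assumes "definable L C (Suc n) P"
  shows "definable L C n (\<lambda>M as. \<exists>x\<in>dom M. P M (x # as))"
proof -
  have "definable L C (Suc n) (\<lambda>M as. P M (map ((!) as) (n # [0..<n])))"
    using assms by (intro definable_subst) auto
  from definable_ex_last[OF this]
  have "definable L C n (\<lambda>M as. \<exists>x\<in>dom M. P M (map ((!) (as @ [x])) (n # [0..<n])))" .
  moreover have "map ((!) (as @ [x])) (n # [0..<n]) = x # as" if "as \<in> tuples M n"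
    for M :: "('a, 'b, 'c) fo_struct" and as x
    using that by (auto simp: tuples_def nth_append intro!: nth_equalityI)
  ultimately show ?thesis
    by (elim iffD1[OF definable_cong, rotated]) (simp only:)
qed

lemma definable_ex_tuple:
  "definable L C (l + n) P \<Longrightarrow> definable L C n (\<lambda>M as. \<exists>xs\<in>tuples M l. P M (xs @ as))"
proof (induction l arbitrary: P)
  case 0
  then show ?case by (auto simp: tuples_def)
next
  case (Suc l)
  from Suc.prems have "definable L C (Suc (l + n)) P" by simp
  from Suc.IH[OF definable_ex[OF this]]
  have "definable L C n (\<lambda>M as. \<exists>xs\<in>tuples M l. \<exists>x\<in>dom M. P M (x # xs @ as))" .
  moreover have "(\<exists>xs\<in>tuples M l. \<exists>x\<in>dom M. P M (x # xs @ as)) \<longleftrightarrow> (\<exists>xs\<in>tuples M (Suc l). P M (xs @ as))"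
    for M as
  proof
    assume "\<exists>xs\<in>tuples M l. \<exists>x\<in>dom M. P M (x # xs @ as)"
    then obtain xs x where "x # xs \<in> tuples M (Suc l)" "P M ((x # xs) @ as)"
      by (auto simp: tuples_def)
    then show "\<exists>xs\<in>tuples M (Suc l). P M (xs @ as)" by blast
  next
    assume "\<exists>xs\<in>tuples M (Suc l). P M (xs @ as)"
    then obtain ys where ys: "ys \<in> tuples M (Suc l)" "P M (ys @ as)" by blast
    then obtain x xs where "ys = x # xs" by (cases ys) (auto simp: tuples_def)
    with ys show "\<exists>xs\<in>tuples M l. \<exists>x\<in>dom M. P M (x # xs @ as)"
      by (intro bexI[of _ xs] bexI[of _ x]) (auto simp: tuples_def)
  qed
  ultimately show ?case by simp
qed

lemma definable_all_tuple:
  assumes "definable L C (l + n) P"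
  shows "definable L C n (\<lambda>M as. \<forall>xs\<in>tuples M l. P M (xs @ as))"
  using definable_not[OF definable_ex_tuple[OF definable_not[OF assms]]] by simp

lemma definable_take:
  assumes "definable L C n P"
  shows "definable L C (n + l) (\<lambda>M as. P M (take n as))"
proof -
  have "definable L C (n + l) (\<lambda>M as. P M (map ((!) as) [0..<n]))"
    by (rule definable_subst) (use assms in auto)
  then show ?thesis
    by (rule iffD1[OF definable_cong, rotated])
      (auto simp: tuples_def map_nth_upt[of 0 n, simplified])
qed

lemma definable_sentence:
  assumes "definable L C 0 P"
  obtains \<sigma> where "\<sigma> \<in> sentences L" "\<And>M. M \<in> C \<Longrightarrow> holds M \<sigma> [] \<longleftrightarrow> P M []"
  using assms by (rule definableE) (auto simp: fmlas_def sentences_def tuples_def)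

section \<open>Pregeometries\<close>

locale pregeometry =
  fixes D :: "'u set" and cl :: "'u set \<Rightarrow> 'u set"
  assumes cl_carrier: "cl A \<subseteq> D"
    and cl_ext: "A \<subseteq> D \<Longrightarrow> A \<subseteq> cl A"
    and cl_mono: "A \<subseteq> B \<Longrightarrow> cl A \<subseteq> cl B"
    and cl_idem: "cl (cl A) = cl A"
    and exchange: "\<lbrakk>A \<subseteq> D; a \<in> D; b \<in> D; a \<in> cl (insert b A); a \<notin> cl A\<rbrakk> \<Longrightarrow> b \<in> cl (insert a A)"
begin

definition indep :: "'u set \<Rightarrow> 'u set \<Rightarrow> bool" where
  "indep X B \<longleftrightarrow> (\<forall>x\<in>B. x \<notin> cl (X \<union> (B - {x})))"

lemma cl_least: "A \<subseteq> cl B \<Longrightarrow> cl A \<subseteq> cl B"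
  using cl_mono[of A "cl B"] cl_idem by simp

lemma cl_Un_least: "X \<subseteq> cl B \<Longrightarrow> A \<subseteq> cl B \<Longrightarrow> cl (X \<union> A) \<subseteq> cl B"
  by (rule cl_least) simp

lemma indep_empty [simp]: "indep X {}"
  by (simp add: indep_def)

lemma indep_subset: "indep X B \<Longrightarrow> A \<subseteq> B \<Longrightarrow> indep X A"
  unfolding indep_def using cl_mono by (meson Diff_mono Un_mono order_refl subsetD)

lemma indep_base_mono: "indep Y B \<Longrightarrow> X \<subseteq> Y \<Longrightarrow> indep X B"
  unfolding indep_def using cl_mono by (meson Un_mono order_refl subsetD)

lemma indep_not_cl: "indep X B \<Longrightarrow> x \<in> B \<Longrightarrow> x \<notin> cl X"
  unfolding indep_def using cl_mono by blast

lemma indep_insert: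
  assumes "indep X B" "x \<notin> cl (X \<union> B)" "X \<subseteq> D" "B \<subseteq> D" "x \<in> D"
  shows "indep X (insert x B)"
  unfolding indep_def
proof
  fix y assume y: "y \<in> insert x B"
  show "y \<notin> cl (X \<union> (insert x B - {y}))"
  proof (cases "y = x")
    case True
    then show ?thesis using assms(2) cl_mono[of "X \<union> (insert x B - {y})" "X \<union> B"] by auto
  next
    case False
    then have yB: "y \<in> B" using y by simp
    have ny: "y \<notin> cl (X \<union> (B - {y}))" using assms(1) yB by (simp add: indep_def)
    show ?thesis
    proof
      assume "y \<in> cl (X \<union> (insert x B - {y}))"
      also have "X \<union> (insert x B - {y}) = insert x (X \<union> (B - {y}))" using False by auto
      finally have "x \<in> cl (insert y (X \<union> (B - {y})))"
        using exchange[of "X \<union> (B - {y})" y x] ny assms yB by auto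
      also have "insert y (X \<union> (B - {y})) = X \<union> B" using yB by auto
      finally show False using assms(2) by simp
    qed
  qed
qed

lemma indep_insertD: "indep X (insert x B) \<Longrightarrow> x \<notin> B \<Longrightarrow> x \<notin> cl (X \<union> B)"
  by (auto simp: indep_def)

lemma indep_Un:
  assumes "finite B" "indep X A" "indep (X \<union> A) B" "X \<subseteq> D" "A \<subseteq> D" "B \<subseteq> D"
  shows "indep X (A \<union> B)"
  using assms
proof (induction B)
  case (insert b B)
  have "indep X (insert b (A \<union> B))"
  proof (rule indep_insert)
    show "indep X (A \<union> B)" using insert indep_subset[of "X \<union> A" "insert b B" B] by auto
    show "b \<notin> cl (X \<union> (A \<union> B))"
      using indep_insertD[of "X \<union> A" b B] insert by (simp add: Un_assoc)
  qed (use insert.prems in auto)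
  then show ?case by simp
qed simp

text \<open>Induction on the part of \<open>I\<close> outside \<open>B\<close>: an \<open>x\<close>
  in this part is exchanged for some \<open>y\<close> of \<open>B\<close> outside the span of
  \<open>I - {x}\<close>. Such a \<open>y\<close> exists, because otherwise that span would contain
  \<open>B\<close> and with it \<open>x\<close>.\<close>

lemma steinitz:
  assumes "finite B" "B \<subseteq> D" "X \<subseteq> D" "finite I" "indep X I" "I \<subseteq> cl (X \<union> B)"
  shows "card I \<le> card B"
  using assms(4-)
proof (induction "card (I - B)" arbitrary: I rule: less_induct)
  case less
  show ?case
  proof (cases "I \<subseteq> B")
    case True
    then show ?thesis using assms(1) by (simp add: card_mono)
  next
    case False
    then obtain x where x: "x \<in> I" "x \<notin> B" by blast
    have ID: "I \<subseteq> D" using less.prems cl_carrier by blast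
    have nx: "x \<notin> cl (X \<union> (I - {x}))" using less.prems x by (simp add: indep_def)
    have "\<exists>y\<in>B. y \<notin> cl (X \<union> (I - {x}))"
    proof (rule ccontr)
      assume "\<not> ?thesis"
      then have "cl (X \<union> B) \<subseteq> cl (X \<union> (I - {x}))"
        using cl_ext[of "X \<union> (I - {x})"] ID assms(3) by (intro cl_Un_least) auto
      then show False using nx less.prems x by auto
    qed
    then obtain y where y: "y \<in> B" "y \<notin> cl (X \<union> (I - {x}))" by blast
    have yI: "y \<notin> I - {x}" using y cl_ext[of "X \<union> (I - {x})"] ID assms(3) by auto
    let ?I = "insert y (I - {x})"
    have "?I - B \<subset> I - B" using x y by auto
    then have "card (?I - B) < card (I - B)" using less.prems(1) by (intro psubset_card_mono) auto
    moreover have "indep X ?I"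
      by (rule indep_insert) (use indep_subset[OF less.prems(2)] y ID assms in auto)
    moreover have "?I \<subseteq> cl (X \<union> B)"
      using less.prems y cl_ext[of "X \<union> B"] assms by auto
    ultimately have "card ?I \<le> card B" using less.hyps[of ?I] less.prems by auto
    moreover have "card ?I = card I"
      using yI x(1) less.prems(1) by (metis card_Suc_Diff1 card_insert_disjoint finite_Diff)
    ultimately show ?thesis by simp
  qed
qed

lemma basis_exists:
  assumes "finite A" "A \<subseteq> D" "X \<subseteq> D"
  obtains B where "B \<subseteq> A" "indep X B" "A \<subseteq> cl (X \<union> B)"
proof -
  have "\<exists>B\<subseteq>A. indep X B \<and> A \<subseteq> cl (X \<union> B)"
    using assms(1,2)
  proof (induction A)
    case (insert a A)
    then obtain B where B: "B \<subseteq> A" "indep X B" "A \<subseteq> cl (X \<union> B)" by auto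
    show ?case
    proof (cases "a \<in> cl (X \<union> B)")
      case True
      with B show ?thesis by (intro exI[of _ B]) auto
    next
      case False
      have "indep X (insert a B)"
        by (rule indep_insert) (use B False insert.prems assms(3) in auto)
      moreover have "insert a A \<subseteq> cl (X \<union> insert a B)"
        using B cl_mono[of "X \<union> B" "X \<union> insert a B"] cl_ext[of "X \<union> insert a B"] insert.prems assms(3)
        by blast
      ultimately show ?thesis using B by (intro exI[of _ "insert a B"]) auto
    qed
  qed auto
  then show ?thesis using that by blast
qed

text \<open>A basis of \<open>B\<close> spans as much as \<open>B\<close>, so by Steinitz it has at
  least \<open>card I\<close> elements. As \<open>B\<close> has no more than that, the basis is all
  of \<open>B\<close>.\<close>

lemma spanning_indep:
  assumes "finite B" "B \<subseteq> D" "X \<subseteq> D" "finite I" "indep X I" "I \<subseteq> cl (X \<union> B)" "card B \<le> card I"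
  shows "indep X B"
proof -
  obtain B' where B': "B' \<subseteq> B" "indep X B'" "B \<subseteq> cl (X \<union> B')"
    using basis_exists assms(1-3) by metis
  have "cl (X \<union> B) \<subseteq> cl (X \<union> B')"
    using B' cl_ext[of "X \<union> B'"] assms(2,3) by (intro cl_Un_least) auto
  then have "card I \<le> card B'"
    using assms B' by (intro steinitz[of B' X]) (auto intro: finite_subset)
  then have "B' = B" using B' assms by (meson card_seteq le_trans)
  with B' show ?thesis by simp
qed

text \<open>A point of \<open>B\<close> outside the closure of \<open>I\<close> would enlarge
  \<open>I\<close> to an independent subset of \<open>cl (X \<union> B)\<close> with more than
  \<open>card B\<close> elements.\<close>

lemma indep_spans:
  assumes "finite B" "B \<subseteq> D" "X \<subseteq> D" "finite I" "indep X I" "I \<subseteq> cl (X \<union> B)" "card B \<le> card I"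
  shows "B \<subseteq> cl (X \<union> I)"
proof
  fix b assume b: "b \<in> B"
  have ID: "I \<subseteq> D" using assms(6) cl_carrier by blast
  show "b \<in> cl (X \<union> I)"
  proof (rule ccontr)
    assume nb: "b \<notin> cl (X \<union> I)"
    then have "indep X (insert b I)" using assms ID b by (intro indep_insert) auto
    moreover have "b \<in> cl (X \<union> B)" using cl_ext[of "X \<union> B"] assms b by auto
    moreover have "b \<notin> I" using nb cl_ext[of "X \<union> I"] assms ID by auto
    ultimately show False using steinitz[of B X "insert b I"] assms by auto
  qed
qed

section \<open>Dimension over a base\<close>

lemma dim_le: "B \<subseteq> A \<Longrightarrow> finite B \<Longrightarrow> A \<subseteq> cl (X \<union> B) \<Longrightarrow> acl_dim cl A X \<le> card B"
  unfolding acl_dim_def by (rule Least_le) blast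

lemma dim_obtain:
  assumes "finite_dim cl A X"
  obtains B where "B \<subseteq> A" "finite B" "card B = acl_dim cl A X" "A \<subseteq> cl (X \<union> B)"
proof -
  have "\<exists>B\<subseteq>A. finite B \<and> card B = acl_dim cl A X \<and> A \<subseteq> cl (X \<union> B)"
    unfolding acl_dim_def
    by (rule LeastI_ex) (use assms in \<open>auto simp: finite_dim_def\<close>)
  then show ?thesis using that by blast
qed

lemma finite_dim_finite: "finite A \<Longrightarrow> A \<subseteq> D \<Longrightarrow> X \<subseteq> D \<Longrightarrow> finite_dim cl A X"
  unfolding finite_dim_def using cl_ext[of "X \<union> A"] by blast

lemma dim_ge:
  assumes "finite_dim cl A X" "A \<subseteq> D" "X \<subseteq> D" "finite I" "indep X I" "I \<subseteq> cl (X \<union> A)"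
  shows "card I \<le> acl_dim cl A X"
proof -
  obtain B where B: "B \<subseteq> A" "finite B" "card B = acl_dim cl A X" "A \<subseteq> cl (X \<union> B)"
    using dim_obtain assms(1) by blast
  have "cl (X \<union> A) \<subseteq> cl (X \<union> B)"
    using B cl_ext[of "X \<union> B"] assms by (intro cl_Un_least) auto
  then show ?thesis using steinitz[of B X I] B assms by auto
qed

lemma dim_eq_card:
  assumes "finite B" "indep X B" "B \<subseteq> A" "A \<subseteq> cl (X \<union> B)" "X \<subseteq> D"
  shows "acl_dim cl A X = card B"
proof (rule antisym)
  show "acl_dim cl A X \<le> card B" using assms by (intro dim_le)
  have AD: "A \<subseteq> D" using assms cl_carrier by blast
  show "card B \<le> acl_dim cl A X"
  proof (rule dim_ge)
    show "finite_dim cl A X" using assms by (auto simp: finite_dim_def)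
    show "B \<subseteq> cl (X \<union> A)" using cl_ext[of "X \<union> A"] AD assms by auto
  qed (use assms AD in auto)
qed

text \<open>Indecomposability provides, inside the closure of a basis, a further point outside the
  finitely many hyperplanes spanned by the points that are already there.\<close>

lemma uniform_extension:
  assumes indec: "\<And>X. X \<subseteq> D \<Longrightarrow> cl X = X \<Longrightarrow> finite_dim cl X {} \<Longrightarrow>
      \<not> (\<exists>\<Y>. finite \<Y> \<and> \<Y> \<noteq> {} \<and> \<Union>\<Y> = X \<and> (\<forall>Y\<in>\<Y>. acl_dim cl Y {} < acl_dim cl X {}))"
    and U: "finite U" "U \<subseteq> D" "indep {} U" "card U = Suc k" and k: "k \<ge> 1" and n: "Suc k \<le> n"
  shows "\<exists>E. U \<subseteq> E \<and> E \<subseteq> cl U \<and> finite E \<and> card E = n \<and> (\<forall>J\<subseteq>E. card J = Suc k \<longrightarrow> U \<subseteq> cl J)"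
  using n
proof (induction n rule: dec_induct)
  case base
  have "J = U" if "J \<subseteq> U" "card J = Suc k" for J
    using that U by (simp add: card_subset_eq)
  then show ?case using U cl_ext[of U] by (intro exI[of _ U]) auto
next
  case (step n)
  then obtain E where E: "U \<subseteq> E" "E \<subseteq> cl U" "finite E" "card E = n"
    "\<And>J. J \<subseteq> E \<Longrightarrow> card J = Suc k \<Longrightarrow> U \<subseteq> cl J" by blast
  have ED: "E \<subseteq> D" using E cl_carrier by blast
  let ?X = "cl U" and ?Y = "cl ` {J. J \<subseteq> E \<and> card J = k}"
  have dimX: "acl_dim cl ?X {} = Suc k"
    using dim_eq_card[of U "{}" ?X] U cl_ext[of U] by simp
  have sub: "cl J \<subseteq> ?X" if "J \<subseteq> E" for J using that E by (intro cl_least) auto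
  have "\<exists>w\<in>?X. w \<notin> \<Union>?Y"
  proof (rule ccontr)
    assume "\<not> ?thesis"
    then have "\<Union>?Y = ?X" using sub by blast
    moreover have "finite ?Y" using E(3) by simp
    moreover have "?Y \<noteq> {}"
    proof -
      have "k \<le> card E" using E(4) step.hyps by simp
      then obtain J where "J \<subseteq> E" "card J = k" by (rule obtain_subset_with_card_n)
      then show ?thesis by auto
    qed
    moreover have "acl_dim cl Y {} < acl_dim cl ?X {}" if "Y \<in> ?Y" for Y
    proof -
      obtain J where J: "Y = cl J" "J \<subseteq> E" "card J = k" using \<open>Y \<in> ?Y\<close> by blast
      then have "acl_dim cl Y {} \<le> card J"
        using E(3) ED cl_ext[of J] by (intro dim_le) (auto intro: finite_subset)
      then show ?thesis using dimX J by simp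
    qed
    moreover have "finite_dim cl ?X {}"
      unfolding finite_dim_def using U cl_ext[of U] by (intro exI[of _ U]) auto
    ultimately show False using indec[of ?X] cl_idem cl_carrier by blast
  qed
  then obtain w where w: "w \<in> ?X" "\<And>J. J \<subseteq> E \<Longrightarrow> card J = k \<Longrightarrow> w \<notin> cl J" by blast
  \<comment> \<open>Since \<open>k \<ge> 1\<close>, each point of \<open>E\<close> lies in some
    subset of \<open>k\<close> points, so avoiding the closures of these subsets also avoids
    \<open>E\<close>.\<close>
  have wE: "w \<notin> E"
  proof
    assume "w \<in> E"
    then have "\<exists>J. {w} \<subseteq> J \<and> J \<subseteq> E \<and> card J = k"
      by (intro exists_subset_between) (use E(3,4) step.hyps k in auto)
    then obtain J where J: "{w} \<subseteq> J" "J \<subseteq> E" "card J = k" by blast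
    then have "w \<in> cl J" using cl_ext[of J] ED by auto
    with w J show False by blast
  qed
  have "U \<subseteq> cl J" if J: "J \<subseteq> insert w E" "card J = Suc k" for J
  proof (cases "w \<in> J")
    case False
    then show ?thesis using J E(5) by blast
  next
    case True
    let ?J = "J - {w}"
    have J': "?J \<subseteq> E" "card ?J = k" using J True by auto
    have finJ: "finite ?J" using J' E(3) finite_subset by blast
    \<comment> \<open>\<open>J2\<close> completes \<open>?J\<close> to \<open>Suc k\<close> points
      of \<open>E\<close>. It spans \<open>U\<close> with as many points as \<open>U\<close> has,
      hence is independent, and so is its part \<open>?J\<close>.\<close>
    have "\<exists>J2. ?J \<subseteq> J2 \<and> J2 \<subseteq> E \<and> card J2 = Suc k"
      by (intro exists_subset_between) (use J' E(3,4) step.hyps in auto)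
    then obtain J2 where J2: "?J \<subseteq> J2" "J2 \<subseteq> E" "card J2 = Suc k" by blast
    have "indep {} J2"
      using U E(5)[OF J2(2,3)] J2 ED E(3) by (intro spanning_indep[of J2 "{}" U]) (auto intro: finite_subset)
    then have "indep {} ?J" using J2 indep_subset by blast
    then have "indep {} (insert w ?J)"
      using w(2)[OF J'] ED J' w(1) cl_carrier by (intro indep_insert) auto
    then have iJ: "indep {} J" using True by (simp add: insert_absorb)
    have finJ: "finite J" using finJ True by (metis finite_Diff2 finite.emptyI finite_insert)
    have "U \<subseteq> cl ({} \<union> J)"
      using U J iJ finJ E(2) w(1) by (intro indep_spans[of U "{}" J]) auto
    then show ?thesis by simp
  qed
  then show ?case
    using E w wE by (intro exI[of _ "insert w E"]) auto
qed

end

section \<open>Algebraic closure in models of a geometric theory\<close>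

text \<open>A separate constant, so that \<open>map_nth_block\<close> can turn the selection of
  consecutive positions into \<open>take\<close> and \<open>drop\<close>.\<close>

definition block :: "nat \<Rightarrow> nat \<Rightarrow> nat list" where
  "block i k = [i..<i + k]"

lemma length_block [simp]: "length (block i k) = k"
  by (simp add: block_def)

lemma set_block [simp]: "set (block i k) = {i..<i + k}"
  by (simp add: block_def)

lemma map_nth_block [simp]: "i + k \<le> length as \<Longrightarrow> map ((!) as) (block i k) = take k (drop i as)"
  by (simp add: block_def map_nth_upt)

text \<open>Substitution with the new argument tuple described by list operations; the list of
  positions is only supplied as a witness.\<close>

lemma definable_map:
  assumes "definable L C n P" "length is = n" "set is \<subseteq> {..<m}"
    "\<And>as :: 'u list. length as = m \<Longrightarrow> map ((!) as) is = g as"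
  shows "definable L C m (\<lambda>M as :: 'u list. P M (g as))"
proof -
  have "definable L C m (\<lambda>M as. P M (map ((!) as) is))"
    using assms(1-3) by (intro definable_subst) auto
  then show ?thesis
    by (rule iffD1[OF definable_cong, rotated]) (simp add: tuples_def assms(4))
qed

lemma tuples_Cons: "x # xs \<in> tuples M (Suc n) \<longleftrightarrow> x \<in> dom M \<and> xs \<in> tuples M n"
  by (auto simp: tuples_def)

section \<open>Absoluteness of quantifier-free formulas under embeddings\<close>

lemma eval_embedding:
  assumes "is_struct L M" "embedding L M N h" "wf_tm L t" "\<And>x. x \<in> tm_vars t \<Longrightarrow> v x \<in> dom M"
  shows "eval M v t \<in> dom M \<and> h (eval M v t) = eval N (h \<circ> v) t"
  using assms(3,4)
proof (induction t)
  case (Fun f ts)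
  have IH: "eval M v t \<in> dom M \<and> h (eval M v t) = eval N (h \<circ> v) t" if "t \<in> set ts" for t
    by (rule Fun.IH[OF that]) (use Fun.prems that in \<open>auto simp: list_all_iff\<close>)
  have f: "(f, length ts) \<in> funs L" using Fun.prems by simp
  have ts: "map (eval M v) ts \<in> tuples M (length ts)" using IH by (auto simp: tuples_def)
  have "map h (map (eval M v) ts) = map (eval N (h \<circ> v)) ts" using IH by (simp only: map_map map_eq_conv) simp
  moreover have "h (fint M f (map (eval M v) ts)) = fint N f (map h (map (eval M v) ts))"
    using assms(2) f ts unfolding embedding_def by blast
  moreover have "fint M f (map (eval M v) ts) \<in> dom M"
    using assms(1) f ts unfolding is_struct_def by blast
  ultimately show ?case by (simp only: eval.simps)
qed simp

lemma sat_embedding: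
  assumes "is_struct L M" "embedding L M N h" "qfree \<phi>" "wf_fm L \<phi>" "\<And>x. x \<in> fv \<phi> \<Longrightarrow> v x \<in> dom M"
  shows "sat M v \<phi> \<longleftrightarrow> sat N (h \<circ> v) \<phi>"
  using assms(3-5)
proof (induction \<phi>)
  case (Eql s t)
  have "eval M v s \<in> dom M \<and> h (eval M v s) = eval N (h \<circ> v) s"
    "eval M v t \<in> dom M \<and> h (eval M v t) = eval N (h \<circ> v) t"
    by (rule eval_embedding[OF assms(1,2)]; use Eql.prems in simp)+
  moreover have "inj_on h (dom M)" using assms(2) by (simp add: embedding_def)
  ultimately show ?case by (metis inj_on_def sat.simps(2))
next
  case (Rel r ts)
  have IH: "eval M v t \<in> dom M \<and> h (eval M v t) = eval N (h \<circ> v) t" if "t \<in> set ts" for t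
    by (rule eval_embedding[OF assms(1,2)]) (use Rel.prems that in auto)
  have "map h (map (eval M v) ts) = map (eval N (h \<circ> v)) ts" using IH by (simp only: map_map map_eq_conv) simp
  moreover have "map (eval M v) ts \<in> tuples M (length ts)" using IH by (auto simp: tuples_def)
  moreover have "(r, length ts) \<in> rels L" using Rel.prems by simp
  moreover have "rint M r as = rint N r (map h as)" if "(r, n) \<in> rels L" "as \<in> tuples M n" for n as
    using assms(2) that unfolding embedding_def by blast
  ultimately have "rint M r (map (eval M v) ts) = rint N r (map (eval N (h \<circ> v)) ts)"
    by (metis (no_types))
  then show ?case by (simp only: sat.simps)
qed auto

locale geometric_theory =
  fixes L :: "('f, 'r) lang" and T :: "('f, 'r) fm set" and C :: "('f, 'r, 'u) fo_struct set"
  assumes C_eq: "C = {M. models L T M}"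
    and geom: "geometric TYPE('u) L T"
    and qe: "quantifier_elimination TYPE('u) L T"
begin

lemma definable_infinite:
  assumes "definable L C (Suc n) P"
  shows "definable L C n (\<lambda>M as. infinite {x\<in>dom M. P M (x # as)})"
proof -
  obtain \<phi> where \<phi>: "\<phi> \<in> fmlas L (Suc n)"
    "\<And>M as. M \<in> C \<Longrightarrow> as \<in> tuples M (Suc n) \<Longrightarrow> holds M \<phi> as \<longleftrightarrow> P M as"
    using assms by (metis definableE)
  have \<phi>1: "\<phi> \<in> fmlas L (1 + n)" using \<phi>(1) by simp
  have "\<forall>m. \<forall>\<phi>\<in>fmlas L (1 + m). \<exists>\<psi>\<in>fmlas L m. \<forall>M :: ('f, 'r, 'u) fo_struct. models L T M \<longrightarrow>
        (\<forall>b\<in>tuples M m. holds M \<psi> b \<longleftrightarrow> infinite {a\<in>dom M. holds M \<phi> (a # b)})"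
    using geom unfolding geometric_def eliminates_exists_infinity_def by (rule conjunct1)
  from this[THEN spec, of n, THEN bspec, OF \<phi>1] obtain \<psi> where \<psi>: "\<psi> \<in> fmlas L n"
    "\<forall>M :: ('f, 'r, 'u) fo_struct. models L T M \<longrightarrow> (\<forall>b\<in>tuples M n. holds M \<psi> b \<longleftrightarrow> infinite {a\<in>dom M. holds M \<phi> (a # b)})"
    by (rule bexE) (rule that)
  show ?thesis
  proof (rule definableI[OF \<psi>(1)])
    fix M as assume M: "M \<in> C" "as \<in> tuples M n"
    have "{a\<in>dom M. holds M \<phi> (a # as)} = {x\<in>dom M. P M (x # as)}"
      using \<phi>(2)[OF M(1)] M(2) by (auto simp: tuples_Cons)
    then show "holds M \<psi> as = infinite {x\<in>dom M. P M (x # as)}" using \<psi>(2) M by (simp add: C_eq)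
  qed
qed

lemma definable_finite:
  "definable L C (Suc n) P \<Longrightarrow> definable L C n (\<lambda>M as. finite {x\<in>dom M. P M (x # as)})"
  using definable_not[OF definable_infinite] by simp

lemma definable_qfree:
  assumes "definable L C n P"
  obtains \<phi> where "\<phi> \<in> fmlas L n" "qfree \<phi>"
    "\<And>M as. M \<in> C \<Longrightarrow> as \<in> tuples M n \<Longrightarrow> holds M \<phi> as \<longleftrightarrow> P M as"
proof -
  obtain \<psi> where \<psi>: "\<psi> \<in> fmlas L n"
    "\<And>M as. M \<in> C \<Longrightarrow> as \<in> tuples M n \<Longrightarrow> holds M \<psi> as \<longleftrightarrow> P M as"
    using assms by (metis definableE)
  have "\<forall>n. \<forall>\<phi>\<in>fmlas L n. \<exists>\<psi>\<in>fmlas L n. qfree \<psi> \<and>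
        (\<forall>M :: ('f, 'r, 'u) fo_struct. models L T M \<longrightarrow> (\<forall>as\<in>tuples M n. holds M \<phi> as \<longleftrightarrow> holds M \<psi> as))"
    using qe unfolding quantifier_elimination_def .
  from this[THEN spec, of n, THEN bspec, OF \<psi>(1)] obtain \<phi> where \<phi>: "\<phi> \<in> fmlas L n" "qfree \<phi>"
    "\<forall>M :: ('f, 'r, 'u) fo_struct. models L T M \<longrightarrow> (\<forall>as\<in>tuples M n. holds M \<psi> as \<longleftrightarrow> holds M \<phi> as)"
    by (elim bexE conjE) (rule that)
  have "holds M \<phi> as \<longleftrightarrow> P M as" if "M \<in> C" "as \<in> tuples M n" for M as
    using \<phi>(3) \<psi>(2)[OF that] that by (simp add: C_eq)
  with \<phi>(1,2) show ?thesis by (rule that)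
qed

text \<open>By quantifier elimination a definable predicate has a quantifier-free definition, and
  embeddings preserve and reflect quantifier-free formulas.\<close>

lemma definable_embedding:
  assumes "definable L C n P" "M \<in> C" "N \<in> C" "embedding L M N h" "as \<in> tuples M n"
  shows "P M as \<longleftrightarrow> P N (map h as)"
proof -
  obtain \<phi> where \<phi>: "\<phi> \<in> fmlas L n" "qfree \<phi>"
    "\<And>M as. M \<in> C \<Longrightarrow> as \<in> tuples M n \<Longrightarrow> holds M \<phi> as \<longleftrightarrow> P M as"
    using assms(1) by (rule definable_qfree) blast
  have "is_struct L M" using assms(2) by (simp add: C_eq models_def)
  then have "sat M (nth as) \<phi> \<longleftrightarrow> sat N (h \<circ> nth as) \<phi>"
    using assms(4,5) \<phi>(1,2) by (intro sat_embedding[where L = L]) (auto simp: fmlas_def tuples_def subset_iff)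
  also have "\<dots> \<longleftrightarrow> holds N \<phi> (map h as)"
    unfolding holds_def by (rule sat_cong) (use \<phi>(1) assms(5) in \<open>auto simp: fmlas_def tuples_def\<close>)
  finally have "holds M \<phi> as \<longleftrightarrow> holds N \<phi> (map h as)" by (simp add: holds_def)
  moreover have "map h as \<in> tuples N n" using assms(4,5) by (auto simp: tuples_def embedding_def)
  ultimately show ?thesis using \<phi>(3) assms by blast
qed

lemma acl_iff:
  assumes "M \<in> C"
  shows "a \<in> acl L M B \<longleftrightarrow> a \<in> dom M \<and> (\<exists>P b. set b \<subseteq> B \<inter> dom M \<and> definable L C (Suc (length b)) P \<and>
    P M (a # b) \<and> finite {x\<in>dom M. P M (x # b)})" (is "_ \<longleftrightarrow> _ \<and> ?R")
proof
  assume "a \<in> acl L M B"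
  then obtain \<phi> b where "a \<in> dom M" "set b \<subseteq> B \<inter> dom M" "\<phi> \<in> fmlas L (1 + length b)"
    "holds M \<phi> (a # b)" "finite {x\<in>dom M. holds M \<phi> (x # b)}"
    unfolding acl_def formulas_over_def by blast
  then show "a \<in> dom M \<and> ?R"
    using definable_holds[of \<phi> L "Suc (length b)" C] by auto
next
  assume R: "a \<in> dom M \<and> ?R"
  then obtain P b where P: "set b \<subseteq> B \<inter> dom M" "definable L C (Suc (length b)) P"
    "P M (a # b)" "finite {x\<in>dom M. P M (x # b)}" by blast
  obtain \<phi> where \<phi>: "\<phi> \<in> fmlas L (Suc (length b))"
    "\<And>M as. M \<in> C \<Longrightarrow> as \<in> tuples M (Suc (length b)) \<Longrightarrow> holds M \<phi> as \<longleftrightarrow> P M as"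
    using P(2) by (metis definableE)
  have "holds M \<phi> (x # b) = P M (x # b)" if "x \<in> dom M" for x
    using \<phi>(2) assms P(1) that by (auto simp: tuples_def)
  then have "holds M \<phi> (a # b) \<and> finite {x\<in>dom M. holds M \<phi> (x # b)}"
    using P(3,4) R by (auto cong: conj_cong)
  moreover have "(\<phi>, b) \<in> formulas_over L (B \<inter> dom M) 1"
    using P(1) \<phi>(1) by (simp add: formulas_over_def)
  ultimately show "a \<in> acl L M B"
    using R unfolding acl_def by blast
qed

lemma aclI:
  assumes "M \<in> C" "a \<in> dom M" "set b \<subseteq> B" "set b \<subseteq> dom M" "definable L C (Suc (length b)) P"
    "P M (a # b)" "finite {x\<in>dom M. P M (x # b)}"
  shows "a \<in> acl L M B"
  using assms by (subst acl_iff) auto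

lemma acl_dom: "acl L M B \<subseteq> dom M"
  by (auto simp: acl_def)

lemma acl_mono: "A \<subseteq> B \<Longrightarrow> acl L M A \<subseteq> acl L M B"
  unfolding acl_def formulas_over_def by blast

lemma acl_ext:
  assumes "M \<in> C" "B \<subseteq> dom M"
  shows "B \<subseteq> acl L M B"
proof
  fix b assume b: "b \<in> B"
  show "b \<in> acl L M B"
    by (rule aclI[of _ _ "[b]" _ "\<lambda>M as. as ! 0 = as ! 1"])
      (use assms b in \<open>auto intro!: definable_eq simp del: One_nat_def\<close>)
qed

text \<open>The predicates that witness algebraicity of the entries are conjoined and their
  parameters concatenated; the solutions then lie in a product of finite sets.\<close>

lemma algebraic_tuple:
  assumes M: "M \<in> C" and cs: "set cs \<subseteq> acl L M B"
  shows "\<exists>P b. set b \<subseteq> B \<inter> dom M \<and> definable L C (length cs + length b) P \<and> P M (cs @ b) \<and>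
    finite {xs\<in>tuples M (length cs). P M (xs @ b)}"
  using cs
proof (induction cs)
  case Nil
  have "{xs \<in> tuples M 0. True} = {[]}" by (auto simp: tuples_def)
  then show ?case
    by (intro exI[of _ "\<lambda>M as. True"] exI[of _ "[]"]) (auto simp: definable_True)
next
  case (Cons c cs)
  then obtain P b where P: "set b \<subseteq> B \<inter> dom M" "definable L C (length cs + length b) P" "P M (cs @ b)"
    "finite {xs\<in>tuples M (length cs). P M (xs @ b)}" by auto
  have "c \<in> acl L M B" using Cons.prems by simp
  then have "\<exists>P b. set b \<subseteq> B \<inter> dom M \<and> definable L C (Suc (length b)) P \<and>
    P M (c # b) \<and> finite {x\<in>dom M. P M (x # b)}"
    unfolding acl_iff[OF M] ..
  then obtain P1 b1 where P1: "set b1 \<subseteq> B \<inter> dom M" "definable L C (Suc (length b1)) P1" "P1 M (c # b1)"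
    "finite {x\<in>dom M. P1 M (x # b1)}"
    by (elim exE conjE) (rule that)
  let ?l = "length cs" and ?m = "length b1" and ?n = "length b"
  let ?Q = "\<lambda>M as. P1 M (as ! 0 # take ?m (drop (Suc ?l) as)) \<and>
    P M (take ?l (drop 1 as) @ drop (Suc (?l + ?m)) as)"
  have "definable L C (length (c # cs) + length (b1 @ b)) ?Q"
  proof (rule definable_conj)
    show "definable L C (length (c # cs) + length (b1 @ b)) (\<lambda>M as. P1 M (as ! 0 # take ?m (drop (Suc ?l) as)))"
      by (rule definable_map[OF P1(2), of "0 # block (Suc ?l) ?m"])
        auto
    show "definable L C (length (c # cs) + length (b1 @ b))
        (\<lambda>M as. P M (take ?l (drop 1 as) @ drop (Suc (?l + ?m)) as))"
      by (rule definable_map[OF P(2), of "block 1 ?l @ block (Suc (?l + ?m)) ?n"])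
        auto
  qed
  moreover have "?Q M ((c # cs) @ b1 @ b)" using P1(3) P(3) by simp
  moreover have "finite {xs \<in> tuples M (length (c # cs)). ?Q M (xs @ b1 @ b)}"
  proof (rule finite_subset)
    show "{xs \<in> tuples M (length (c # cs)). ?Q M (xs @ b1 @ b)} \<subseteq>
      (\<lambda>(x, xs). x # xs) ` ({x\<in>dom M. P1 M (x # b1)} \<times> {xs\<in>tuples M (length cs). P M (xs @ b)})"
    proof
      fix ys assume ys: "ys \<in> {xs \<in> tuples M (length (c # cs)). ?Q M (xs @ b1 @ b)}"
      then obtain x xs where "ys = x # xs" by (cases ys) (auto simp: tuples_def)
      with ys show "ys \<in> (\<lambda>(x, xs). x # xs) ` ({x\<in>dom M. P1 M (x # b1)} \<times> {xs\<in>tuples M (length cs). P M (xs @ b)})"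
        by (auto simp: tuples_def intro!: image_eqI[of _ _ "(x, xs)"])
    qed
    show "finite ((\<lambda>(x, xs). x # xs) ` ({x\<in>dom M. P1 M (x # b1)} \<times> {xs\<in>tuples M (length cs). P M (xs @ b)}))"
      using P1(4) P(4) by simp
  qed
  moreover have "set (b1 @ b) \<subseteq> B \<inter> dom M" using P(1) P1(1) by simp
  ultimately show ?case by (intro exI[of _ ?Q] exI[of _ "b1 @ b"]) blast
qed

lemma acl_acl:
  assumes M: "M \<in> C"
  shows "acl L M (acl L M B) = acl L M B"
proof
  show "acl L M B \<subseteq> acl L M (acl L M B)" by (rule acl_ext[OF M acl_dom])
  show "acl L M (acl L M B) \<subseteq> acl L M B"
  proof
    fix a assume "a \<in> acl L M (acl L M B)"
    then obtain P cs where P: "a \<in> dom M" "set cs \<subseteq> acl L M B" "set cs \<subseteq> dom M"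
      "definable L C (Suc (length cs)) P" "P M (a # cs)" "finite {x\<in>dom M. P M (x # cs)}"
      unfolding acl_iff[OF M] by blast
    obtain Q b where Q: "set b \<subseteq> B \<inter> dom M" "definable L C (length cs + length b) Q" "Q M (cs @ b)"
      "finite {xs\<in>tuples M (length cs). Q M (xs @ b)}"
      using algebraic_tuple[OF M P(2)] by blast
    let ?l = "length cs" and ?n = "length b"
    \<comment> \<open>The last conjunct discards those \<open>zs\<close> other than
      \<open>cs\<close> whose fiber is infinite. It is definable because \<open>T\<close> eliminates
      \<open>\<exists>\<close> with infinitely many witnesses, and it leaves a finite union of
      finite sets.\<close>
    let ?S = "\<lambda>M as. Q M (take ?l as @ drop (Suc ?l) as) \<and> P M (as ! ?l # take ?l as) \<and>
      finite {y\<in>dom M. P M (y # take ?l as)}"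
    let ?R = "\<lambda>M as. \<exists>zs\<in>tuples M ?l. ?S M (zs @ as)"
    have "definable L C (?l + Suc ?n) ?S"
    proof (intro definable_conj)
      show "definable L C (?l + Suc ?n) (\<lambda>M as. Q M (take ?l as @ drop (Suc ?l) as))"
        by (rule definable_map[OF Q(2), of "block 0 ?l @ block (Suc ?l) ?n"])
          auto
      show "definable L C (?l + Suc ?n) (\<lambda>M as. P M (as ! ?l # take ?l as))"
        by (rule definable_map[OF P(4), of "?l # block 0 ?l"])
          auto
      show "definable L C (?l + Suc ?n) (\<lambda>M as. finite {y\<in>dom M. P M (y # take ?l as)})"
        by (rule definable_take[OF definable_finite[OF P(4)]])
    qed
    then have "definable L C (Suc ?n) ?R" by (rule definable_ex_tuple[where P = ?S])
    moreover have "?R M (a # b)"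
      by (rule bexI[of _ cs]) (use P Q in \<open>auto simp: tuples_def\<close>)
    moreover have "finite {x\<in>dom M. ?R M (x # b)}"
    proof (rule finite_subset)
      show "{x\<in>dom M. ?R M (x # b)} \<subseteq>
        (\<Union>zs\<in>{zs\<in>tuples M ?l. Q M (zs @ b)}. {x\<in>dom M. P M (x # zs) \<and> finite {y\<in>dom M. P M (y # zs)}})"
        by (auto simp: tuples_def nth_append)
      show "finite (\<Union>zs\<in>{zs\<in>tuples M ?l. Q M (zs @ b)}. {x\<in>dom M. P M (x # zs) \<and> finite {y\<in>dom M. P M (y # zs)}})"
        using Q(4)
      proof (rule finite_UN_I)
        show "finite {x\<in>dom M. P M (x # zs) \<and> finite {y\<in>dom M. P M (y # zs)}}" for zs
          by (cases "finite {y\<in>dom M. P M (y # zs)}") simp_all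
      qed
    qed
    ultimately show "a \<in> acl L M B" using P(1) Q(1) by (intro aclI[OF M, of a b _ ?R]) auto
  qed
qed

lemma acl_pregeometry:
  assumes M: "M \<in> C"
  shows "pregeometry (dom M) (acl L M)"
proof
  show "acl L M A \<subseteq> dom M" for A by (rule acl_dom)
  show "A \<subseteq> acl L M A" if "A \<subseteq> dom M" for A using acl_ext[OF M that] .
  show "acl L M A \<subseteq> acl L M B" if "A \<subseteq> B" for A B using acl_mono[OF that] .
  show "acl L M (acl L M A) = acl L M A" for A by (rule acl_acl[OF M])
  show "b \<in> acl L M (insert a A)"
    if "A \<subseteq> dom M" "a \<in> dom M" "b \<in> dom M" "a \<in> acl L M (insert b A)" "a \<notin> acl L M A" for A a b
    using geom M that unfolding geometric_def C_eq by blast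
qed

text \<open>Finiteness of the solution set is itself a definable predicate. Both it and the
  algebraic predicate therefore pass back along an embedding, and algebraicity in the larger model
  is already witnessed in \<open>M\<close>.\<close>

lemma acl_forall_eq:
  assumes M: "M \<in> C"
  shows "acl_forall L T M = acl L M"
proof (rule ext, rule antisym)
  fix B
  show "acl_forall L T M B \<subseteq> acl L M B"
  proof
    fix a assume "a \<in> acl_forall L T M B"
    then obtain N h where N: "a \<in> dom M" "N \<in> C" "embedding L M N h" "h a \<in> acl L N (h ` (B \<inter> dom M))"
      unfolding acl_forall_def C_eq by blast
    then obtain P b' where P: "set b' \<subseteq> h ` (B \<inter> dom M)" "definable L C (Suc (length b')) P"
      "P N (h a # b')" "finite {x\<in>dom N. P N (x # b')}"
      unfolding acl_iff[OF N(2)] by blast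
    have "b' \<in> map h ` lists (B \<inter> dom M)"
      unfolding lists_image[symmetric] using P(1) by blast
    then obtain b where b: "set b \<subseteq> B \<inter> dom M" "b' = map h b" by blast
    have ab: "a # b \<in> tuples M (Suc (length b'))" using b N(1) by (auto simp: tuples_def)
    let ?Q = "\<lambda>M as. finite {x\<in>dom M. P M (x # as)}"
    have "P M (a # b)"
      using definable_embedding[OF P(2) M N(2,3) ab] P(3) b by simp
    moreover have "?Q M b"
      using definable_embedding[OF definable_finite[OF P(2)] M N(2,3), of b] P(4) b ab by (simp add: tuples_Cons)
    ultimately show "a \<in> acl L M B" using N(1) b P(2) by (intro aclI[OF M, of a b B P]) auto
  qed
  show "acl L M B \<subseteq> acl_forall L T M B"
  proof
    fix a assume a: "a \<in> acl L M B"
    have "acl L M (id ` (B \<inter> dom M)) = acl L M B" by (auto simp: acl_def)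
    moreover have "embedding L M M id" by (auto simp: embedding_def)
    ultimately show "a \<in> acl_forall L T M B"
      using a M acl_dom unfolding acl_forall_def C_eq by fastforce
  qed
qed

end

section \<open>Structures with the same reduct\<close>

lemma eval_agree:
  assumes "fint M = fint N"
  shows "eval M v t = eval N v t"
proof (induction t)
  case (Fun f ts)
  then have "map (eval M v) ts = map (eval N v) ts" by simp
  then show ?case by (simp only: eval.simps assms)
qed simp

lemma sat_agree:
  assumes "dom M = dom N" "fint M = fint N" "\<And>r as. (r, length as) \<in> rels L \<Longrightarrow> rint M r as = rint N r as"
    and "wf_fm L \<phi>"
  shows "sat M v \<phi> = sat N v \<phi>"
  using assms(4)
proof (induction \<phi> arbitrary: v)
  case (Rel r ts)
  have "map (eval M v) ts = map (eval N v) ts" using eval_agree[OF assms(2)] by simp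
  then show ?case using assms(3)[of r "map (eval N v) ts"] Rel.prems by (simp only: sat.simps wf_fm.simps length_map)
qed (simp_all add: eval_agree[OF assms(2)] assms(1))

text \<open>Relations are compared only at the arities listed in \<open>L\<close>, because the name
  of the color predicate may belong to \<open>L\<close> with another arity.\<close>

lemma agree_reduct:
  assumes "dom M = dom N" "fint M = fint N" "\<And>r as. (r, length as) \<in> rels L \<Longrightarrow> rint M r as = rint N r as"
  shows "\<phi> \<in> fmlas L n \<Longrightarrow> holds M \<phi> as = holds N \<phi> as" "acl L M = acl L N"
    "T \<subseteq> sentences L \<Longrightarrow> models L T M = models L T N"
proof -
  show *: "\<phi> \<in> fmlas L n \<Longrightarrow> holds M \<phi> as = holds N \<phi> as" for \<phi> n as
    unfolding holds_def fmlas_def using sat_agree[OF assms] by blast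
  show "acl L M = acl L N"
  proof (rule ext)
    fix B
    have "holds M \<phi> (a # b) \<and> finite {a'\<in>dom M. holds M \<phi> (a' # b)} \<longleftrightarrow>
        holds N \<phi> (a # b) \<and> finite {a'\<in>dom N. holds N \<phi> (a' # b)}"
      if "(\<phi>, b) \<in> formulas_over L (B \<inter> dom N) 1" for \<phi> b a
      using that * assms(1) by (auto simp: formulas_over_def)
    then show "acl L M B = acl L N B"
      unfolding acl_def assms(1) by blast
  qed
  have "\<sigma> \<in> T \<Longrightarrow> T \<subseteq> sentences L \<Longrightarrow> holds M \<sigma> [] = holds N \<sigma> []" for \<sigma>
    using *[of \<sigma> 0 "[]"] by (auto simp: sentences_def fmlas_def)
  then show "T \<subseteq> sentences L \<Longrightarrow> models L T M = models L T N"
    unfolding models_def is_struct_def assms(1,2) tuples_def by blast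
qed

section \<open>Saturation and strong formulas\<close>

lemma set_nths': "set (nths xs I) = (!) xs ` {i. i < length xs \<and> i \<in> I}"
  by (auto simp: set_nths)

text \<open>The head is tested over the tail, in the order in which \<open>definable_indep\<close>
  removes variables.\<close>

primrec indep_list :: "('u set \<Rightarrow> 'u set) \<Rightarrow> 'u set \<Rightarrow> 'u list \<Rightarrow> bool" where
  "indep_list cl X [] \<longleftrightarrow> True"
| "indep_list cl X (u # us) \<longleftrightarrow> u \<notin> cl (set us \<union> X) \<and> indep_list cl X us"

lemma (in pregeometry) indep_list_iff:
  assumes "X \<subseteq> D" "set us \<subseteq> D"
  shows "indep_list cl X us \<longleftrightarrow> distinct us \<and> indep X (set us)"
  using assms(2)
proof (induction us)
  case (Cons u us)
  have "u \<notin> cl (set us \<union> X) \<and> indep X (set us) \<longleftrightarrow> u \<notin> set us \<and> indep X (insert u (set us))"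
  proof
    assume u: "u \<notin> cl (set us \<union> X) \<and> indep X (set us)"
    have "set us \<union> X \<subseteq> cl (set us \<union> X)" using assms(1) Cons.prems by (intro cl_ext) auto
    with u have "u \<notin> set us" by blast
    moreover have "indep X (insert u (set us))"
      using u assms(1) Cons.prems by (intro indep_insert) (auto simp: Un_commute)
    ultimately show "u \<notin> set us \<and> indep X (insert u (set us))" ..
  next
    assume u: "u \<notin> set us \<and> indep X (insert u (set us))"
    then have "u \<notin> cl (X \<union> set us)" using indep_insertD by blast
    moreover have "indep X (set us)" using u indep_subset[of X "insert u (set us)" "set us"] by blast
    ultimately show "u \<notin> cl (set us \<union> X) \<and> indep X (set us)" by (simp add: Un_commute)
  qed
  with Cons show ?case by auto
qed simp

lemma definable_distinct: "definable L C n (\<lambda>M as. distinct as)"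
proof -
  have "definable L C n (\<lambda>M as. \<forall>ij\<in>{(i, j). i < n \<and> j < n \<and> i \<noteq> j}. as ! fst ij \<noteq> as ! snd ij)"
    by (rule definable_ball)
      (auto intro!: definable_not definable_eq intro: finite_subset[of _ "{..<n} \<times> {..<n}"])
  then show ?thesis
    by (rule iffD1[OF definable_cong, rotated]) (auto simp: tuples_def distinct_conv_nth)
qed

section \<open>Independent solutions in saturated models and persistence of dependences\<close>

context geometric_theory
begin

text \<open>The type to be realized consists of \<open>P\<close> and the negations of all formulas
  over \<open>A\<close> with finitely many solutions. It is finitely satisfiable, because finitely
  many finite sets do not exhaust an infinite one.\<close>

lemma saturated_nonalgebraic:
  assumes N: "N \<in> C" "aleph1_saturated L N" and b: "set b \<subseteq> dom N"
    and P: "definable L C (Suc (length b)) P" "infinite {x\<in>dom N. P N (x # b)}"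
    and A: "A \<subseteq> dom N" "countable A"
  shows "\<exists>x\<in>dom N. P N (x # b) \<and> x \<notin> acl L N A"
proof -
  obtain \<phi> where \<phi>: "\<phi> \<in> fmlas L (Suc (length b))"
    "\<And>M as. M \<in> C \<Longrightarrow> as \<in> tuples M (Suc (length b)) \<Longrightarrow> holds M \<phi> as \<longleftrightarrow> P M as"
    using P(1) by (metis definableE)
  have \<phi>P: "holds N \<phi> (x # b) \<longleftrightarrow> P N (x # b)" if "x \<in> dom N" for x
    using \<phi>(2)[OF N(1)] b that by (simp add: tuples_def)
  define \<Sigma>0 where "\<Sigma>0 = (\<lambda>(\<xi>, c). (Neg \<xi>, c)) `
    {(\<xi>, c). (\<xi>, c) \<in> formulas_over L A 1 \<and> finite {x\<in>dom N. holds N \<xi> (x # c)}}"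
  let ?\<Sigma> = "insert (\<phi>, b) \<Sigma>0"
  have neg: "holds N (Neg \<xi>) as \<longleftrightarrow> \<not> holds N \<xi> as" for \<xi> as by (simp add: holds_def)
  have "\<exists>xs\<in>tuples N 1. realizes N ?\<Sigma> xs"
  proof (rule assms(2)[unfolded aleph1_saturated_def, rule_format, of "A \<union> set b"], intro conjI allI impI)
    show "A \<union> set b \<subseteq> dom N" "countable (A \<union> set b)" using A b by (auto simp: uncountable_def countable_finite)
    show "?\<Sigma> \<subseteq> formulas_over L (A \<union> set b) 1"
      using \<phi>(1) by (auto simp: formulas_over_def \<Sigma>0_def fmlas_def)
    fix \<Sigma>' assume \<Sigma>': "\<Sigma>' \<subseteq> ?\<Sigma> \<and> finite \<Sigma>'"
    let ?F = "\<Union>(\<psi>, c)\<in>\<Sigma>' - {(\<phi>, b)}. {x\<in>dom N. \<not> holds N \<psi> (x # c)}"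
    have "finite {x\<in>dom N. \<not> holds N \<psi> (x # c)}" if "(\<psi>, c) \<in> \<Sigma>0" for \<psi> c
      using that by (auto simp: \<Sigma>0_def neg)
    then have "finite ?F" using \<Sigma>' by (intro finite_UN_I) auto
    then have "infinite ({x\<in>dom N. P N (x # b)} - ?F)" using P(2) by (rule Diff_infinite_finite)
    then have "{x\<in>dom N. P N (x # b)} - ?F \<noteq> {}" using infinite_imp_nonempty by blast
    then obtain x where x: "x \<in> dom N" "P N (x # b)" "x \<notin> ?F" by blast
    then have "realizes N \<Sigma>' [x]"
      unfolding realizes_def using \<phi>P by auto
    then show "\<exists>xs\<in>tuples N 1. realizes N \<Sigma>' xs"
      using x by (intro bexI[of _ "[x]"]) (auto simp: tuples_def)
  qed
  then obtain x where x: "x \<in> dom N" "realizes N ?\<Sigma> [x]"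
    by (auto simp: tuples_def length_Suc_conv)
  have "x \<notin> acl L N A"
  proof
    assume "x \<in> acl L N A"
    then obtain \<xi> c where \<xi>: "(\<xi>, c) \<in> formulas_over L (A \<inter> dom N) 1" "holds N \<xi> (x # c)"
      "finite {x\<in>dom N. holds N \<xi> (x # c)}" unfolding acl_def by blast
    then have "(Neg \<xi>, c) \<in> ?\<Sigma>"
      using A unfolding \<Sigma>0_def by (auto simp: formulas_over_def intro!: image_eqI[of _ _ "(\<xi>, c)"])
    then have "holds N (Neg \<xi>) ([x] @ c)" using x(2) unfolding realizes_def by blast
    with \<xi>(2) show False by (simp add: neg)
  qed
  moreover have "P N (x # b)" using x \<phi>P by (auto simp: realizes_def)
  ultimately show ?thesis using x by blast
qed

lemma infinite_iff_nonalgebraic: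
  assumes N: "N \<in> C" "aleph1_saturated L N" and b: "set b \<subseteq> dom N"
    and P: "definable L C (Suc (length b)) P"
  shows "infinite {x\<in>dom N. P N (x # b)} \<longleftrightarrow> (\<exists>x\<in>dom N. P N (x # b) \<and> x \<notin> acl L N (set b))"
proof
  assume "infinite {x\<in>dom N. P N (x # b)}"
  then show "\<exists>x\<in>dom N. P N (x # b) \<and> x \<notin> acl L N (set b)"
    using saturated_nonalgebraic[OF N b P _ b] by (simp add: countable_finite)
next
  assume "\<exists>x\<in>dom N. P N (x # b) \<and> x \<notin> acl L N (set b)"
  then show "infinite {x\<in>dom N. P N (x # b)}"
    using aclI[OF N(1) _ order_refl b P] by blast
qed

text \<open>In a saturated model, infinitely many solutions amount to a solution outside the closure
  of the parameters. Nesting this definable quantifier therefore chooses the entries one after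
  another, each outside the closure of the earlier ones. \<open>\<Theta>\<close> is a predicate on
  all models of \<open>T\<close>; its meaning is read off in the saturated ones.\<close>

lemma definable_indep:
  assumes "definable L C (j + m) P"
  shows "\<exists>\<Theta>. definable L C m \<Theta> \<and> (\<forall>N\<in>C. aleph1_saturated L N \<longrightarrow> (\<forall>b\<in>tuples N m. \<Theta> N b \<longleftrightarrow>
    (\<exists>us\<in>tuples N j. P N (us @ b) \<and> indep_list (acl L N) (set b) us)))"
  using assms
proof (induction j arbitrary: P)
  case 0
  then show ?case by (intro exI[of _ P]) (auto simp: tuples_def)
next
  case (Suc j)
  let ?P = "\<lambda>M as. infinite {x\<in>dom M. P M (x # as)}"
  have P: "definable L C (Suc (j + m)) P" using Suc.prems by simp
  obtain \<Theta> where \<Theta>: "definable L C m \<Theta>" "\<And>N b. N \<in> C \<Longrightarrow> aleph1_saturated L N \<Longrightarrow> b \<in> tuples N m \<Longrightarrow>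
      \<Theta> N b \<longleftrightarrow> (\<exists>us\<in>tuples N j. ?P N (us @ b) \<and> indep_list (acl L N) (set b) us)"
    using Suc.IH[OF definable_infinite[OF P]] by blast
  have "\<Theta> N b \<longleftrightarrow> (\<exists>us\<in>tuples N (Suc j). P N (us @ b) \<and> indep_list (acl L N) (set b) us)"
    if N: "N \<in> C" "aleph1_saturated L N" and b: "b \<in> tuples N m" for N b
  proof -
    have inf: "?P N (us @ b) \<longleftrightarrow> (\<exists>x\<in>dom N. P N (x # us @ b) \<and> x \<notin> acl L N (set us \<union> set b))"
      if "us \<in> tuples N j" for us
      using infinite_iff_nonalgebraic[OF N, of "us @ b" P] that b P by (simp add: tuples_def)
    show ?thesis
    proof
      assume "\<Theta> N b"
      then obtain us x where "us \<in> tuples N j" "x \<in> dom N" "P N (x # us @ b)"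
        "x \<notin> acl L N (set us \<union> set b)" "indep_list (acl L N) (set b) us"
        using \<Theta>(2)[OF N b] inf by blast
      then show "\<exists>us\<in>tuples N (Suc j). P N (us @ b) \<and> indep_list (acl L N) (set b) us"
        by (intro bexI[of _ "x # us"]) (auto simp: tuples_Cons)
    next
      assume "\<exists>us\<in>tuples N (Suc j). P N (us @ b) \<and> indep_list (acl L N) (set b) us"
      then obtain vs where vs: "vs \<in> tuples N (Suc j)" "P N (vs @ b)" "indep_list (acl L N) (set b) vs"
        by blast
      then obtain x us where "vs = x # us" by (cases vs) (auto simp: tuples_def)
      with vs have "us \<in> tuples N j" "x \<in> dom N" "P N (x # us @ b)"
        "x \<notin> acl L N (set us \<union> set b)" "indep_list (acl L N) (set b) us"
        by (auto simp: tuples_Cons)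
      then show "\<Theta> N b" using \<Theta>(2)[OF N b] inf by blast
    qed
  qed
  with \<Theta>(1) show ?case by blast
qed

text \<open>The witness of algebraicity is joined with the finiteness of its solution set, so that
  any tuple satisfying both inherits the dependence. Its parameters are recorded as positions in
  \<open>d @ a\<close>, which makes them meaningful for other tuples.\<close>

lemma algebraicity_definable:
  assumes M: "M \<in> C" and d: "set d \<subseteq> dom M" "set a \<subseteq> dom M" "i < length d"
    and i: "d ! i \<in> acl L M (set (nths d I) \<union> set a)"
  shows "\<exists>P. definable L C (length d + length a) P \<and> P M (d @ a) \<and>
    (\<forall>N\<in>C. \<forall>d'\<in>tuples N (length d). \<forall>a'\<in>tuples N (length a). P N (d' @ a') \<longrightarrow>
      d' ! i \<in> acl L N (set (nths d' I) \<union> set a'))"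
proof -
  obtain P b where P: "set b \<subseteq> (set (nths d I) \<union> set a) \<inter> dom M" "definable L C (Suc (length b)) P"
    "P M (d ! i # b)" "finite {x\<in>dom M. P M (x # b)}"
    using i unfolding acl_iff[OF M] by (elim exE conjE) (rule that)
  let ?S = "{j. j < length d \<and> j \<in> I} \<union> {length d..<length d + length a}"
  have "set (nths d I) \<union> set a \<subseteq> (!) (d @ a) ` ?S"
    by (force simp: set_nths' nth_append in_set_conv_nth intro: image_eqI[of _ _ "length d + _"])
  then have "b \<in> map ((!) (d @ a)) ` lists ?S"
    unfolding lists_image[symmetric] using P(1) by blast
  then obtain fs where fs: "set fs \<subseteq> ?S" "b = map ((!) (d @ a)) fs" by blast
  let ?Q = "\<lambda>M as. P M (as ! i # map ((!) as) fs) \<and> finite {x\<in>dom M. P M (x # map ((!) as) fs)}"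
  have "definable L C (length d + length a) ?Q"
  proof (rule definable_conj)
    show "definable L C (length d + length a) (\<lambda>M as. P M (as ! i # map ((!) as) fs))"
      by (rule definable_map[OF P(2), of "i # fs"]) (use fs d(3) in auto)
    show "definable L C (length d + length a) (\<lambda>M as. finite {x\<in>dom M. P M (x # map ((!) as) fs)})"
      by (rule definable_map[OF definable_finite[OF P(2)], of fs]) (use fs in auto)
  qed
  moreover have "?Q M (d @ a)" using P(3,4) fs(2) d(3) by (simp add: nth_append)
  moreover have "d' ! i \<in> acl L N (set (nths d' I) \<union> set a')"
    if N: "N \<in> C" "d' \<in> tuples N (length d)" "a' \<in> tuples N (length a)" "?Q N (d' @ a')" for N d' a'
  proof (rule aclI[OF N(1)])
    let ?b = "map ((!) (d' @ a')) fs"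
    show "d' ! i \<in> dom N" using N(2) d(3) by (auto simp: tuples_def)
    show *: "set ?b \<subseteq> set (nths d' I) \<union> set a'"
    proof
      fix x assume "x \<in> set ?b"
      then obtain j where j: "x = (d' @ a') ! j" "j \<in> ?S" using fs(1) by auto
      then show "x \<in> set (nths d' I) \<union> set a'"
        using N(2,3) by (auto simp: set_nths' tuples_def nth_append)
    qed
    then show "set ?b \<subseteq> dom N" using N(2,3) set_nths_subset[of d' I] by (auto simp: tuples_def)
    show "definable L C (Suc (length ?b)) P" using P(2) fs(2) by simp
    show "P N (d' ! i # ?b)" using N d(3) by (simp add: tuples_def nth_append)
    show "finite {x\<in>dom N. P N (x # ?b)}" using N(4) by simp
  qed
  ultimately show ?thesis by (intro exI[of _ ?Q]) blast
qed

text \<open>All dependences among the entries of \<open>d\<close> over \<open>a\<close> persist,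
  while new ones may appear. This is as much of the type of \<open>d\<close> over \<open>a\<close>
  as one formula can carry here, and it suffices for the upper bounds on dimension in
  \<open>strong\<close>.\<close>

definition alg_transfer ::
  "('f, 'r, 'u) fo_struct \<Rightarrow> 'u list \<Rightarrow> 'u list \<Rightarrow> ('f, 'r, 'u) fo_struct \<Rightarrow> 'u list \<Rightarrow> 'u list \<Rightarrow> bool" where
  "alg_transfer M d a N d' a' \<longleftrightarrow> (\<forall>I i. i < length d \<longrightarrow>
     d ! i \<in> acl L M (set (nths d I) \<union> set a) \<longrightarrow> d' ! i \<in> acl L N (set (nths d' I) \<union> set a'))"

lemma alg_transfer_definable:
  assumes M: "M \<in> C" and d: "set d \<subseteq> dom M" "set a \<subseteq> dom M" "distinct (d @ a)"
    and P: "definable L C (length d + length a) P" "P M (d @ a)"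
  shows "\<exists>Q. definable L C (length d + length a) Q \<and> Q M (d @ a) \<and>
    (\<forall>N\<in>C. \<forall>d'\<in>tuples N (length d). \<forall>a'\<in>tuples N (length a). Q N (d' @ a') \<longrightarrow>
      P N (d' @ a') \<and> distinct (d' @ a') \<and> alg_transfer M d a N d' a')"
proof -
  let ?S = "{(I, i). I \<subseteq> {..<length d} \<and> i < length d \<and> d ! i \<in> acl L M (set (nths d I) \<union> set a)}"
  have "\<forall>s\<in>?S. \<exists>P. definable L C (length d + length a) P \<and> P M (d @ a) \<and>
    (\<forall>N\<in>C. \<forall>d'\<in>tuples N (length d). \<forall>a'\<in>tuples N (length a). P N (d' @ a') \<longrightarrow>
      d' ! snd s \<in> acl L N (set (nths d' (fst s)) \<union> set a'))"
    using algebraicity_definable[OF M d(1,2)] by auto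
  from bchoice[OF this] obtain R where R0: "\<forall>s\<in>?S. definable L C (length d + length a) (R s) \<and> R s M (d @ a) \<and>
    (\<forall>N\<in>C. \<forall>d'\<in>tuples N (length d). \<forall>a'\<in>tuples N (length a). R s N (d' @ a') \<longrightarrow>
      d' ! snd s \<in> acl L N (set (nths d' (fst s)) \<union> set a'))" ..
  then have R: "s \<in> ?S \<Longrightarrow> definable L C (length d + length a) (R s)" "s \<in> ?S \<Longrightarrow> R s M (d @ a)" for s
    by blast+
  let ?Q = "\<lambda>M as. P M as \<and> distinct as \<and> (\<forall>s\<in>?S. R s M as)"
  have "finite ?S" by (rule finite_subset[of _ "Pow {..<length d} \<times> {..<length d}"]) auto
  then have "definable L C (length d + length a) ?Q"
    using R(1) by (intro definable_conj P(1) definable_distinct definable_ball) auto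
  moreover have "?Q M (d @ a)" using P(2) d(3) R(2) by blast
  moreover have "alg_transfer M d a N d' a'"
    if N: "N \<in> C" "d' \<in> tuples N (length d)" "a' \<in> tuples N (length a)" "\<forall>s\<in>?S. R s N (d' @ a')" for N d' a'
    unfolding alg_transfer_def
  proof (intro allI impI)
    fix I i assume i: "i < length d" "d ! i \<in> acl L M (set (nths d I) \<union> set a)"
    \<comment> \<open>\<open>nths\<close> looks only at positions below the length, so the finitely
      many sets of positions in \<open>?S\<close> represent all \<open>I\<close>.\<close>
    let ?I = "I \<inter> {..<length d}"
    have eq: "set (nths xs ?I) = set (nths xs I)" if "length xs = length d" for xs :: "'u list"
      using that by (auto simp: set_nths')
    have "(?I, i) \<in> ?S" using i eq[of d] by simp
    with R0 N have "d' ! snd (?I, i) \<in> acl L N (set (nths d' (fst (?I, i))) \<union> set a')" by blast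
    then have "d' ! i \<in> acl L N (set (nths d' ?I) \<union> set a')" by simp
    then show "d' ! i \<in> acl L N (set (nths d' I) \<union> set a')"
      using eq[of d'] N(2) by (simp add: tuples_def)
  qed
  ultimately show ?thesis by (intro exI[of _ ?Q]) blast
qed

text \<open>A spanning subset of least size occupies certain positions \<open>J\<close> of
  \<open>d\<close>. As dependences persist, the entries of \<open>d'\<close> at the same positions
  still span.\<close>

lemma alg_transfer_dim:
  assumes M: "M \<in> C" "set d \<subseteq> dom M" "set a \<subseteq> dom M" "distinct d"
    and N: "N \<in> C" "d' \<in> tuples N (length d)" "a' \<in> tuples N (length a)"
    and t: "alg_transfer M d a N d' a'"
  shows "acl_dim (acl L N) (set (nths d' (- I))) (set (nths d' I) \<union> set a')
    \<le> acl_dim (acl L M) (set (nths d (- I))) (set (nths d I) \<union> set a)"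
proof -
  interpret M: pregeometry "dom M" "acl L M" by (rule acl_pregeometry[OF M(1)])
  interpret N: pregeometry "dom N" "acl L N" by (rule acl_pregeometry[OF N(1)])
  have len: "length d' = length d" using N(2) by (simp add: tuples_def)
  have sub: "set (nths d J) \<subseteq> dom M" for J using set_nths_subset[of d J] M(2) by blast
  have "finite_dim (acl L M) (set (nths d (- I))) (set (nths d I) \<union> set a)"
    using sub M(3) by (intro M.finite_dim_finite) auto
  then obtain B where B: "B \<subseteq> set (nths d (- I))" "finite B"
    "card B = acl_dim (acl L M) (set (nths d (- I))) (set (nths d I) \<union> set a)"
    "set (nths d (- I)) \<subseteq> acl L M (set (nths d I) \<union> set a \<union> B)"
    using M.dim_obtain by blast
  define J where "J = {i. i < length d \<and> d ! i \<in> B}"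
  have JI: "J \<inter> I = {}"
    using B(1) M(4) by (auto simp: J_def set_nths' nth_eq_iff_index_eq)
  have BJ: "B = (!) d ` J" using B(1) by (auto simp: J_def set_nths')
  have "inj_on ((!) d) J" using M(4) by (auto simp: inj_on_def J_def nth_eq_iff_index_eq)
  then have cJ: "card J = card B" by (simp add: BJ card_image)
  have finJ: "finite J" by (simp add: J_def)
  have B'J: "set (nths d' J) = (!) d' ` J" using len by (auto simp: set_nths' J_def)
  have un: "set (nths xs (I \<union> J)) = set (nths xs I) \<union> set (nths xs J)" for xs :: "'u list"
    by (auto simp: set_nths')
  have BJ': "set (nths d J) = B" unfolding BJ by (auto simp: set_nths' J_def)
  have "acl_dim (acl L N) (set (nths d' (- I))) (set (nths d' I) \<union> set a') \<le> card (set (nths d' J))"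
  proof (rule N.dim_le)
    show "set (nths d' J) \<subseteq> set (nths d' (- I))" using JI by (auto simp: set_nths')
    show "set (nths d' (- I)) \<subseteq> acl L N (set (nths d' I) \<union> set a' \<union> set (nths d' J))"
    proof
      fix x assume "x \<in> set (nths d' (- I))"
      then obtain i where i: "x = d' ! i" "i < length d" "i \<notin> I" using len by (auto simp: set_nths')
      have "d ! i \<in> set (nths d (- I))" using i by (auto simp: set_nths')
      then have "d ! i \<in> acl L M (set (nths d I) \<union> set a \<union> B)" using B(4) by blast
      also have "set (nths d I) \<union> set a \<union> B = set (nths d (I \<union> J)) \<union> set a"
        using BJ' un[of d] by blast
      finally have "d' ! i \<in> acl L N (set (nths d' (I \<union> J)) \<union> set a')"
        using t i unfolding alg_transfer_def by blast
      then show "x \<in> acl L N (set (nths d' I) \<union> set a' \<union> set (nths d' J))"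
        using i un[of d'] by (simp add: Un_ac)
    qed
  qed simp
  also have "card (set (nths d' J)) \<le> card B" unfolding B'J using finJ cJ card_image_le by metis
  finally show ?thesis using B(3) by simp
qed

end

section \<open>Uniform configurations\<close>

lemma irrational_approximation:
  fixes \<alpha> \<epsilon> :: real
  assumes "\<alpha> \<notin> \<rat>" "0 < \<alpha>" "0 < \<epsilon>"
  shows "\<exists>k n :: nat. 1 \<le> k \<and> real k < \<alpha> * n \<and> \<alpha> * n < k + \<epsilon>"
proof -
  \<comment> \<open>\<open>\<eta> \<le> \<alpha>\<close> excludes \<open>k = 0\<close>, as
    \<open>\<alpha> * n \<ge> \<alpha>\<close>. Approximating \<open>\<eta> / 2\<close> with error
    below \<open>\<eta> / 2\<close> puts the fractional part strictly between 0 and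
    \<open>\<eta>\<close>, so \<open>k\<close> is approached from above.\<close>
  define \<eta> where "\<eta> = min (min \<epsilon> \<alpha>) 1"
  have \<eta>: "0 < \<eta>" "\<eta> \<le> \<epsilon>" "\<eta> \<le> \<alpha>" "\<eta> \<le> 1" using assms by (auto simp: \<eta>_def)
  then have "0 \<le> \<eta> / 2" "\<eta> / 2 \<le> 1" "0 < \<eta> / 2" by auto
  from Kronecker_approx_1_explicit[OF assms(1) this]
  obtain n where n: "n > 0" "\<bar>frac (real n * \<alpha>) - \<eta> / 2\<bar> < \<eta> / 2" .
  define k where "k = nat \<lfloor>real n * \<alpha>\<rfloor>"
  have fl: "\<lfloor>real n * \<alpha>\<rfloor> \<ge> 0" using assms by simp
  have k: "real n * \<alpha> = real k + frac (real n * \<alpha>)"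
    using fl by (simp add: k_def frac_def)
  have f: "0 < frac (real n * \<alpha>)" "frac (real n * \<alpha>) < \<eta>" using n(2) by (auto simp: abs_less_iff field_simps)
  have "k \<noteq> 0"
  proof
    assume "k = 0"
    then have "real k = 0" by simp
    then have "real n * \<alpha> < \<alpha>" using k f(2) \<eta>(3) by linarith
    moreover have "1 * \<alpha> \<le> real n * \<alpha>" using n(1) assms(2) by (intro mult_right_mono) auto
    ultimately show False by linarith
  qed
  then have "1 \<le> k" by simp
  moreover have "real k < real n * \<alpha>" "real n * \<alpha> < real k + \<epsilon>" using k f \<eta>(2) by linarith+
  ultimately show ?thesis by (auto simp: mult.commute[of \<alpha>])
qed

context pregeometry
begin

text \<open>Independence is demanded from the earlier tuples only, which fits a recursive choice of
  the \<open>z t\<close>; \<open>configuration_indep\<close> recovers the joint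
  independence.\<close>

definition configuration ::
  "'u set \<Rightarrow> 'u \<Rightarrow> (nat \<Rightarrow> nat) \<Rightarrow> (nat \<Rightarrow> 'u list) \<Rightarrow> bool" where
  "configuration X b k z \<longleftrightarrow> X \<subseteq> D \<and> b \<in> D \<and> b \<notin> cl X \<and> (\<forall>t. distinct (z t) \<and> set (z t) \<subseteq> D \<and>
     (\<forall>J\<subseteq>set (z t). card J = k t \<longrightarrow> set (z t) \<subseteq> cl (insert b J)) \<and>
     (\<forall>J\<subseteq>set (z t). card J = Suc (k t) \<longrightarrow> b \<in> cl J) \<and>
     (\<forall>J\<subseteq>set (z t). card J \<le> k t \<longrightarrow> indep (insert b X \<union> (\<Union>s<t. set (z s))) J))"

lemma configurationD:
  assumes "configuration X b k z"
  shows "X \<subseteq> D" "b \<in> D" "b \<notin> cl X" "distinct (z t)" "set (z t) \<subseteq> D"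
    "J \<subseteq> set (z t) \<Longrightarrow> card J = k t \<Longrightarrow> set (z t) \<subseteq> cl (insert b J)"
    "J \<subseteq> set (z t) \<Longrightarrow> card J = Suc (k t) \<Longrightarrow> b \<in> cl J"
    "J \<subseteq> set (z t) \<Longrightarrow> card J \<le> k t \<Longrightarrow> indep (insert b X \<union> (\<Union>s<t. set (z s))) J"
  using assms unfolding configuration_def by blast+

lemma configuration_notin:
  assumes c: "configuration X b k z" and k: "1 \<le> k t" and x: "x \<in> set (z t)"
  shows "x \<notin> cl (insert b X \<union> (\<Union>s<t. set (z s)))"
  using configurationD(8)[OF c, of "{x}" t] indep_not_cl[of _ "{x}" x] k x by auto

lemma configuration_disjoint:
  assumes c: "configuration X b k z" and k: "\<And>t. 1 \<le> k t" and st: "s \<noteq> t"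
  shows "set (z s) \<inter> set (z t) = {}"
proof -
  have "set (z s) \<inter> set (z t) = {}" if "s < t" for s t
  proof -
    have "set (z s) \<subseteq> insert b X \<union> (\<Union>s<t. set (z s))" using that by blast
    also have "\<dots> \<subseteq> cl \<dots>" using configurationD(1,2,5)[OF c] by (intro cl_ext) auto
    finally show ?thesis using configuration_notin[OF c k] by blast
  qed
  then show ?thesis using st by (metis inf_commute linorder_neqE_nat)
qed

lemma configuration_notin_base:
  assumes c: "configuration X b k z" and k: "1 \<le> k t" and x: "x \<in> set (z t)"
  shows "x \<notin> cl (insert b X)"
  using configuration_notin[OF assms] cl_mono[of "insert b X" "insert b X \<union> (\<Union>s<t. set (z s))"] by auto

lemma configuration_indep:
  assumes c: "configuration X b k z" and J: "\<And>t. J t \<subseteq> set (z t)" "\<And>t. card (J t) \<le> k t"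
  shows "indep X (insert b (\<Union>s<t. J s))"
proof -
  note C = configurationD[OF c]
  have JD: "J t \<subseteq> D" for t using J C by blast
  have "indep (insert b X) (\<Union>s<t. J s)"
  proof (induction t)
    case (Suc t)
    have "indep (insert b X \<union> (\<Union>s<t. J s)) (J t)"
      by (rule indep_base_mono[OF C(8)]) (use J in blast)+
    moreover have "finite (J t)" using J(1) by (rule finite_subset) simp
    moreover have "(\<Union>s<t. J s) \<subseteq> D" using JD by blast
    moreover have "insert b X \<subseteq> D" using C(1,2) by blast
    ultimately have "indep (insert b X) ((\<Union>s<t. J s) \<union> J t)"
      using Suc JD by (intro indep_Un)
    then show ?case by (simp add: lessThan_Suc Un_commute)
  qed simp
  moreover have "finite (J t)" for t using J(1) by (rule finite_subset) simp
  then have "finite (\<Union>s<t. J s)" by blast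
  moreover have "(\<Union>s<t. J s) \<subseteq> D" using JD by blast
  ultimately have "indep X ({b} \<union> (\<Union>s<t. J s))"
    using C(1-3) by (intro indep_Un) (auto simp: indep_def)
  then show ?thesis by simp
qed

text \<open>This is \<open>\<delta> \<ge> 0\<close> for the intended coloring, over any base inside
  \<open>X\<close>. If \<open>S\<close> has at most \<open>k t\<close> points in each tuple, it is
  independent and \<open>\<alpha> \<le> 1\<close> suffices. Otherwise \<open>b\<close> lies in the
  closure, and its dimension 1 pays for the excess \<open>\<epsilon> t\<close> of all tuples
  together.\<close>

lemma configuration_dim:
  fixes \<alpha> :: real and \<epsilon> :: "nat \<Rightarrow> real"
  assumes c: "configuration X b k z" and k: "\<And>t. 1 \<le> k t"
    and \<alpha>: "\<alpha> \<le> 1" "\<And>t. \<alpha> * real (length (z t)) \<le> k t + \<epsilon> t" "(\<Sum>t<m. \<epsilon> t) \<le> 1" "\<And>t. 0 \<le> \<epsilon> t" "0 < \<alpha>"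
    and S: "S \<subseteq> (\<Union>t<m. set (z t))" and Y: "Y \<subseteq> X"
    and A: "finite A" "S \<subseteq> A" "A \<subseteq> D"
  shows "\<alpha> * real (card S) \<le> real (acl_dim cl A Y)"
proof -
  note C = configurationD[OF c]
  define S' where "S' t = S \<inter> set (z t)" for t
  have fin: "finite (S' t)" for t by (simp add: S'_def)
  \<comment> \<open>Up to \<open>k t\<close> points of a tuple are independent, so
    \<open>J t\<close> is taken as large as this guarantee allows.\<close>
  have "\<forall>t. \<exists>J\<subseteq>S' t. card J = min (card (S' t)) (k t)"
    by (metis min.cobounded1 obtain_subset_with_card_n)
  then obtain J where J: "\<And>t. J t \<subseteq> S' t" "\<And>t. card (J t) = min (card (S' t)) (k t)" by metis
  have SU: "S = (\<Union>t<m. S' t)" using S by (auto simp: S'_def)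
  have dis: "S' s \<inter> S' t = {}" if "s \<noteq> t" for s t
    using configuration_disjoint[OF c k that] by (auto simp: S'_def)
  have cardS: "card S = (\<Sum>t<m. card (S' t))"
    unfolding SU using fin dis by (intro card_UN_disjoint) auto
  have finJ: "finite (J t)" for t using J(1) fin finite_subset by blast
  have cardJ: "card (\<Union>t<m. J t) = (\<Sum>t<m. card (J t))"
    using finJ J(1) dis by (intro card_UN_disjoint) (auto, blast)
  have "indep X (insert b (\<Union>t<m. J t))"
    by (rule configuration_indep[OF c]) (use J in \<open>auto simp: S'_def\<close>)
  then have indep: "indep Y (insert b (\<Union>t<m. J t))" using Y by (rule indep_base_mono)
  have YD: "Y \<subseteq> D" using Y C by blast
  have YA: "Y \<union> A \<subseteq> cl (Y \<union> A)" using YD A by (intro cl_ext) auto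
  have fd: "finite_dim cl A Y" using A YD by (intro finite_dim_finite)
  have JA: "(\<Union>t<m. J t) \<subseteq> A" using J(1) A(2) SU by blast
  have bJ: "b \<notin> (\<Union>t<m. J t)"
  proof
    assume "b \<in> (\<Union>t<m. J t)"
    then obtain t where "b \<in> set (z t)" using J(1) by (auto simp: S'_def)
    then have "b \<notin> cl (insert b X)" using configuration_notin_base[OF c k] by blast
    then show False using cl_ext[of "insert b X"] C by blast
  qed
  show ?thesis
  proof (cases "\<forall>t<m. card (S' t) \<le> k t")
    case True
    then have "card S = card (\<Union>t<m. J t)"
      unfolding cardS cardJ J(2) by (intro sum.cong) auto
    also have "\<dots> \<le> acl_dim cl A Y"
      using fd A YD finJ indep JA YA by (intro dim_ge) (auto intro: indep_subset)
    finally have "real (card S) \<le> acl_dim cl A Y" by simp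
    moreover have "\<alpha> * real (card S) \<le> 1 * real (card S)" using \<alpha>(1) by (intro mult_right_mono) auto
    ultimately show ?thesis by simp
  next
    case False
    then obtain t where t: "t < m" "Suc (k t) \<le> card (S' t)" by fastforce
    then obtain K where K: "K \<subseteq> S' t" "card K = Suc (k t)" by (meson obtain_subset_with_card_n)
    have "b \<in> cl K" using C(7)[of K t] K by (auto simp: S'_def)
    moreover have "K \<subseteq> Y \<union> A" using K t A(2) SU by blast
    ultimately have "b \<in> cl (Y \<union> A)" using cl_mono by blast
    then have "card (insert b (\<Union>t<m. J t)) \<le> acl_dim cl A Y"
      using fd A YD finJ indep JA YA by (intro dim_ge) auto
    then have dim: "1 + (\<Sum>t<m. card (J t)) \<le> acl_dim cl A Y"
      using bJ finJ cardJ by simp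
    have "\<alpha> * real (card (S' t)) \<le> card (J t) + \<epsilon> t" for t
    proof (cases "card (S' t) \<le> k t")
      case True
      have "\<alpha> * real (card (S' t)) \<le> 1 * real (card (S' t))" using \<alpha>(1) by (intro mult_right_mono) auto
      then show ?thesis using True J(2)[of t] \<alpha>(4)[of t] by simp
    next
      case False
      have "card (S' t) \<le> length (z t)"
        unfolding S'_def by (metis card_length card_mono List.finite_set inf_le2 le_trans)
      then have "\<alpha> * real (card (S' t)) \<le> \<alpha> * real (length (z t))"
        using \<alpha>(5) by (intro mult_left_mono) auto
      then show ?thesis using False J(2)[of t] \<alpha>(2)[of t] by simp
    qed
    then have "\<alpha> * real (card S) \<le> (\<Sum>t<m. card (J t) + \<epsilon> t)"
      unfolding cardS of_nat_sum sum_distrib_left by (intro sum_mono) auto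
    also have "\<dots> \<le> real (1 + (\<Sum>t<m. card (J t)))" using \<alpha>(3) by (simp add: sum.distrib)
    also have "\<dots> \<le> acl_dim cl A Y" using dim by linarith
    finally show ?thesis .
  qed
qed

end

context geometric_theory
begin

text \<open>A basis consisting of \<open>b\<close> and \<open>k\<close> generic points is enlarged
  to a uniform set of \<open>Suc n\<close> points. One of them is \<open>b\<close>, the other
  \<open>n\<close> form the tuple, and the generic solution \<open>x0\<close> of \<open>P\<close> is
  part of the basis so that it can be put in front.\<close>

lemma uniform_tuple_exists:
  assumes M: "M \<in> C" "aleph1_saturated L M" "infinite (dom M)" and ind: "indecomposable TYPE('u) L T"
    and Y: "Y \<subseteq> dom M" "countable Y" and b: "b \<in> Y" "b \<notin> acl L M {}"
    and P: "definable L C (Suc (length c)) P" "set c \<subseteq> dom M" "infinite {x\<in>dom M. P M (x # c)}"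
    and k: "1 \<le> k" "k \<le> n"
  shows "\<exists>z. length z = n \<and> distinct z \<and> set z \<subseteq> dom M \<and> P M (z ! 0 # c) \<and>
    (\<forall>J\<subseteq>set z. card J = k \<longrightarrow> set z \<subseteq> acl L M (insert b J)) \<and>
    (\<forall>J\<subseteq>set z. card J = Suc k \<longrightarrow> b \<in> acl L M J) \<and>
    (\<forall>J\<subseteq>set z. card J \<le> k \<longrightarrow> pregeometry.indep (acl L M) Y J)"
proof -
  interpret pregeometry "dom M" "acl L M" by (rule acl_pregeometry[OF M(1)])
  obtain x0 where x0: "x0 \<in> dom M" "P M (x0 # c)" "x0 \<notin> acl L M Y"
    using saturated_nonalgebraic[OF M(1,2) P(2,1,3) Y] by blast
  have "\<exists>U. finite U \<and> x0 \<in> U \<and> card U = k \<and> indep Y U \<and> U \<subseteq> dom M"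
    using k(1)
  proof (induction k rule: dec_induct)
    case base
    have "indep Y {x0}" using x0 by (simp add: indep_def)
    then show ?case using x0 by (intro exI[of _ "{x0}"]) auto
  next
    case (step j)
    then obtain U where U: "finite U" "x0 \<in> U" "card U = j" "indep Y U" "U \<subseteq> dom M" by blast
    have "\<exists>x\<in>dom M. True \<and> x \<notin> acl L M (Y \<union> U)"
      by (rule saturated_nonalgebraic[OF M(1,2), of "[]" "\<lambda>M as. True"])
        (use M(3) U Y in \<open>auto simp: definable_True countable_finite\<close>)
    then obtain x where x: "x \<in> dom M" "x \<notin> acl L M (Y \<union> U)" by blast
    then have "x \<notin> U" using cl_ext[of "Y \<union> U"] U Y by blast
    then show ?case
      using x U Y indep_insert[OF U(4), of x] by (intro exI[of _ "insert x U"]) auto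
  qed
  then obtain U where U: "finite U" "x0 \<in> U" "card U = k" "indep Y U" "U \<subseteq> dom M" by blast
  have YY: "Y \<subseteq> acl L M Y" using Y by (intro cl_ext)
  have bU: "b \<notin> U" using indep_not_cl[OF U(4)] b YY by blast
  have bD: "b \<in> dom M" using b Y by blast
  have "indep {} ({b} \<union> U)"
    using b U bD indep_base_mono[OF U(4), of "{b}"] by (intro indep_Un) (auto simp: indep_def)
  then have ibU: "indep {} (insert b U)" by simp
  have "\<exists>E. insert b U \<subseteq> E \<and> E \<subseteq> acl L M (insert b U) \<and> finite E \<and> card E = Suc n \<and>
      (\<forall>J\<subseteq>E. card J = Suc k \<longrightarrow> insert b U \<subseteq> acl L M J)"
  proof (rule uniform_extension)
    show "\<not> (\<exists>\<Y>. finite \<Y> \<and> \<Y> \<noteq> {} \<and> \<Union>\<Y> = X \<and> (\<forall>Y\<in>\<Y>. acl_dim (acl L M) Y {} < acl_dim (acl L M) X {}))"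
      if "X \<subseteq> dom M" "acl L M X = X" "finite_dim (acl L M) X {}" for X
      using ind M(1) that unfolding indecomposable_def C_eq by blast
  qed (use U bU bD ibU k in auto)
  then obtain E where E: "insert b U \<subseteq> E" "E \<subseteq> acl L M (insert b U)" "finite E" "card E = Suc n"
    "\<And>J. J \<subseteq> E \<Longrightarrow> card J = Suc k \<Longrightarrow> insert b U \<subseteq> acl L M J" by blast
  obtain zs where zs: "set zs = E - {b, x0}" "distinct zs"
    using finite_distinct_list[of "E - {b, x0}"] E(3) by auto
  have x0b: "x0 \<noteq> b" using bU U(2) by blast
  have zE: "set (x0 # zs) = E - {b}" using zs(1) x0b E(1) U(2) by auto
  have ED: "E \<subseteq> dom M" by (rule order_trans[OF E(2) acl_dom])
  have d: "distinct (x0 # zs)" using zs(1,2) by simp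
  have finJ: "finite J" if "J \<subseteq> E - {b}" for J using that E(3) finite_subset by blast
  have R1: "E \<subseteq> acl L M (insert b J)" if J: "J \<subseteq> E - {b}" "card J = k" for J
  proof -
    have "card (insert b J) = Suc k" using J finJ[OF J(1)] by (subst card_insert_disjoint) auto
    then have "insert b U \<subseteq> acl L M (insert b J)" using E(1) J by (intro E(5)) auto
    then have "acl L M (insert b U) \<subseteq> acl L M (insert b J)" by (rule cl_least)
    then show ?thesis using E(2) by blast
  qed
  \<comment> \<open>Together with \<open>b\<close>, which lies in \<open>Y\<close>, any
    \<open>k\<close> of the new points span \<open>U\<close>. As \<open>U\<close> is independent
    over \<open>Y\<close> and equally large, genericity over \<open>Y\<close> passes from
    \<open>U\<close> to these points.\<close>
  have R3: "indep Y J" if J: "J \<subseteq> E - {b}" "card J \<le> k" for J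
  proof -
    have "\<exists>J'. J \<subseteq> J' \<and> J' \<subseteq> E - {b} \<and> card J' = k"
      by (rule exists_subset_between) (use J E k in auto)
    then obtain J' where J': "J \<subseteq> J'" "J' \<subseteq> E - {b}" "card J' = k" by blast
    have "insert b J' \<subseteq> Y \<union> J'" using b by blast
    then have "U \<subseteq> acl L M (Y \<union> J')"
      using R1[OF J'(2,3)] E(1) cl_mono by blast
    then have "indep Y J'"
      using U J' Y ED finJ[OF J'(2)] by (intro spanning_indep[of J' Y U]) auto
    then show ?thesis using J'(1) indep_subset by blast
  qed
  show ?thesis
  proof (intro exI[of _ "x0 # zs"] conjI allI impI)
    have "length (x0 # zs) = card (E - {b})" using distinct_card[OF d] zE by simp
    also have "\<dots> = n" using E by simp
    finally show "length (x0 # zs) = n" .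
    show "set (x0 # zs) \<subseteq> acl L M (insert b J)" if "J \<subseteq> set (x0 # zs)" "card J = k" for J
      using R1[of J] that unfolding zE by blast
    show "b \<in> acl L M J" if "J \<subseteq> set (x0 # zs)" "card J = Suc k" for J
      using E(5)[of J] that unfolding zE by blast
    show "indep Y J" if "J \<subseteq> set (x0 # zs)" "card J \<le> k" for J
      using R3[of J] that unfolding zE by blast
  qed (use d zE ED x0 in auto)
qed

lemma configuration_exists:
  assumes M: "M \<in> C" "aleph1_saturated L M" "infinite (dom M)" and ind: "indecomposable TYPE('u) L T"
    and X: "X \<subseteq> dom M" "countable X"
    and P: "\<And>t. definable L C (Suc (length (c t))) (P t)" "\<And>t. set (c t) \<subseteq> dom M"
      "\<And>t. infinite {x\<in>dom M. P t M (x # c t)}"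
    and k: "\<And>t. 1 \<le> k t" "\<And>t. k t \<le> n t"
  shows "\<exists>b z. pregeometry.configuration (dom M) (acl L M) X b k z \<and>
    (\<forall>t. length (z t) = n t \<and> P t M (z t ! 0 # c t))"
proof -
  interpret pregeometry "dom M" "acl L M" by (rule acl_pregeometry[OF M(1)])
  have "\<exists>x\<in>dom M. True \<and> x \<notin> acl L M X"
    by (rule saturated_nonalgebraic[OF M(1,2), of "[]" "\<lambda>M as. True"])
      (use M(3) X in \<open>auto simp: definable_True\<close>)
  then obtain b where b: "b \<in> dom M" "b \<notin> acl L M X" by blast
  then have b0: "b \<notin> acl L M {}" using cl_mono[of "{}" X] by blast
  let ?Y = "\<lambda>t z. insert b X \<union> (\<Union>s<t. set (z s))"
  let ?Q = "\<lambda>z t zt. length zt = n t \<and> distinct zt \<and> set zt \<subseteq> dom M \<and> P t M (zt ! 0 # c t) \<and>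
    (\<forall>J\<subseteq>set zt. card J = k t \<longrightarrow> set zt \<subseteq> acl L M (insert b J)) \<and>
    (\<forall>J\<subseteq>set zt. card J = Suc (k t) \<longrightarrow> b \<in> acl L M J) \<and>
    (\<forall>J\<subseteq>set zt. card J \<le> k t \<longrightarrow> indep (?Y t z) J)"
  have "\<exists>z. \<forall>t. ?Q z t (z t)"
  proof (rule dependent_wellorder_choice)
    fix r and f g :: "nat \<Rightarrow> 'u list" and t :: nat
    assume "\<And>s. s < t \<Longrightarrow> f s = g s"
    then have "?Y t f = ?Y t g" by auto
    then show "?Q f t r = ?Q g t r" by simp
  next
    fix t :: nat and f :: "nat \<Rightarrow> 'u list"
    assume f: "\<And>s. s < t \<Longrightarrow> ?Q f s (f s)"
    show "\<exists>r. ?Q f t r"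
    proof (rule uniform_tuple_exists[OF M ind _ _ _ b0 P k])
      have "(\<Union>s<t. set (f s)) \<subseteq> dom M" using f by blast
      then show "?Y t f \<subseteq> dom M" using b X by blast
      show "countable (?Y t f)" using X by (auto intro!: countable_UN countable_finite)
    qed simp
  qed
  then obtain z where z: "\<And>t. ?Q z t (z t)" by blast
  then have "configuration X b k z" unfolding configuration_def using X b by blast
  then show ?thesis using z by blast
qed

end

section \<open>Extension axioms in rich models\<close>

text \<open>Only the unary reading of the name \<open>p\<close> changes, as the same name may be a
  symbol of \<open>L\<close> with another arity. If \<open>(p, 1)\<close> is not in
  \<open>rels L\<close>, closure and dimension stay those of \<open>M\<close>.\<close>

definition recolor :: "'r \<Rightarrow> 'u set \<Rightarrow> ('f, 'r, 'u) fo_struct \<Rightarrow> ('f, 'r, 'u) fo_struct" where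
  "recolor p Z M = M\<lparr>rint := \<lambda>r as. if r = p \<and> length as = 1 then as ! 0 \<in> Z else rint M r as\<rparr>"

lemma recolor_simps [simp]:
  "dom (recolor p Z M) = dom M" "fint (recolor p Z M) = fint M" "rint (recolor p Z M) p [x] \<longleftrightarrow> x \<in> Z"
  by (auto simp: recolor_def)

lemma recolor_agree:
  assumes "(p, 1) \<notin> rels L" "(r, length as) \<in> rels L"
  shows "rint M r as = rint (recolor p Z M) r as"
  using assms by (auto simp: recolor_def)

context geometric_theory
begin

lemma recolor_reduct:
  assumes "(p, 1) \<notin> rels L" "T \<subseteq> sentences L" "M \<in> C"
  shows "recolor p Z M \<in> C" "acl_forall L T (recolor p Z M) = acl L M"
    "\<phi> \<in> fmlas L n \<Longrightarrow> holds (recolor p Z M) \<phi> as = holds M \<phi> as"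
proof -
  note agree = agree_reduct[of M "recolor p Z M" L, OF _ _ recolor_agree[OF assms(1)], simplified]
  show C: "recolor p Z M \<in> C" using agree(3)[OF assms(2)] assms(3) by (simp add: C_eq)
  show "acl_forall L T (recolor p Z M) = acl L M" using acl_forall_eq[OF C] agree(2) by simp
  show "\<phi> \<in> fmlas L n \<Longrightarrow> holds (recolor p Z M) \<phi> as = holds M \<phi> as" using agree(1) by simp
qed

lemma recolor_in_class:
  assumes "(p, 1) \<notin> rels L" "T \<subseteq> sentences L" "M \<in> C"
    and "\<And>A. finite A \<Longrightarrow> A \<subseteq> dom M \<Longrightarrow> \<alpha> * real (card (A \<inter> Z)) \<le> real (acl_dim (acl L M) A {})"
  shows "recolor p Z M \<in> class_K_alpha L T p \<alpha>"
proof -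
  note R = recolor_reduct[OF assms(1-3), where Z = Z]
  have m: "models L T (recolor p Z M)" using R(1) by (simp add: C_eq)
  then have "models L (universal_part TYPE('u) L T) (recolor p Z M)"
    unfolding models_def universal_part_def entails_def by blast
  moreover have "is_struct (add_pred L p) (recolor p Z M)"
    using m unfolding models_def is_struct_def add_pred_def tuples_def by simp
  moreover have "{a \<in> A - {}. rint (recolor p Z M) p [a]} = A \<inter> Z" for A by auto
  ultimately show ?thesis
    unfolding class_K_alpha_def class_K_def delta_def using assms(4) by (simp add: R(2))
qed

text \<open>\<open>M\<close> supplies the pattern and need not be rich. The tuple is split into a
  basis \<open>us\<close> over \<open>a\<close> and the rest \<open>ws\<close>: solutions of maximal
  dimension are then those with independent first part, which \<open>definable_indep\<close>
  expresses. The same formula serves as \<open>is_d_formula\<close> and as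
  \<open>is_D_formula\<close>, because a solution of maximal dimension has no entry algebraic over
  the parameters. The conclusion speaks about all rich models, as \<open>T_alpha_transfer\<close>
  requires.\<close>

lemma rich_extension_formula:
  assumes M: "M \<in> C" "T \<subseteq> sentences L" "(p, 1) \<notin> rels L" "0 < \<alpha>"
    and dist: "distinct ((us @ ws) @ a)" and sub: "set (us @ ws) \<subseteq> dom M" "set a \<subseteq> dom M"
    and basis: "pregeometry.indep (acl L M) (set a) (set us)" "set (us @ ws) \<subseteq> acl L M (set a \<union> set us)"
    and trans: "\<And>x. x \<in> set (us @ ws) \<Longrightarrow> x \<notin> acl L M (set a)"
    and Z: "\<And>A Y. finite A \<Longrightarrow> A \<subseteq> dom M \<Longrightarrow> Y \<subseteq> set a \<Longrightarrow>
      \<alpha> * real (card (A \<inter> Z)) \<le> real (acl_dim (acl L M) A Y)"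
    and P: "definable L C (length (us @ ws) + length a) P" "P M ((us @ ws) @ a)"
    and sat: "aleph1_saturated L M"
  shows "\<exists>\<Theta>. definable L C (length a) \<Theta> \<and> \<Theta> M a \<and>
    (\<forall>R. rich_model L T p \<alpha> R \<longrightarrow> (\<forall>b\<in>tuples R (length a). \<Theta> R b \<longrightarrow>
      (\<exists>e\<in>tuples R (length (us @ ws)). P R (e @ b) \<and>
        (\<forall>i<length (us @ ws). rint R p [e ! i] \<longleftrightarrow> (us @ ws) ! i \<in> Z))))"
proof -
  interpret M: pregeometry "dom M" "acl L M" by (rule acl_pregeometry[OF M(1)])
  define d where "d = us @ ws"
  let ?dim = "\<lambda>N e b. acl_dim (acl L N) (set e) (set b)"
  let ?K = "length us" and ?w = "length ws" and ?m = "length a"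
  let ?N = "recolor p Z M"
  note R = recolor_reduct[OF M(3,2,1), where Z = Z]
  have ld: "length d = ?K + ?w" by (simp add: d_def)
  have sd: "set d \<subseteq> dom M" using sub by (simp add: d_def)
  have dd: "distinct d" "distinct (d @ a)" using dist by (auto simp: d_def)
  have trd: "x \<notin> acl L M (set a)" if "x \<in> set d" for x using trans that by (simp add: d_def)
  have Pd: "definable L C (length d + ?m) P" "P M (d @ a)" using P by (simp_all add: d_def)
  obtain Q where Q: "definable L C (length d + ?m) Q" "Q M (d @ a)"
    "\<forall>N\<in>C. \<forall>d'\<in>tuples N (length d). \<forall>a'\<in>tuples N ?m. Q N (d' @ a') \<longrightarrow>
      P N (d' @ a') \<and> distinct (d' @ a') \<and> alg_transfer M d a N d' a'"
    using alg_transfer_definable[OF M(1) sd sub(2) dd(2) Pd] by (elim exE conjE) (rule that)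
  then have QD: "P N (d' @ a')" "distinct (d' @ a')" "alg_transfer M d a N d' a'"
    if "N \<in> C" "d' \<in> tuples N (length d)" "a' \<in> tuples N ?m" "Q N (d' @ a')" for N d' a'
    using that by blast+
  obtain \<phi> where \<phi>: "\<phi> \<in> fmlas L (length d + ?m)" "qfree \<phi>"
    "\<And>N as. N \<in> C \<Longrightarrow> as \<in> tuples N (length d + ?m) \<Longrightarrow> holds N \<phi> as \<longleftrightarrow> Q N as"
    using Q(1) by (rule definable_qfree) (rule that)
  have \<phi>Q: "holds N \<phi> (d' @ a') \<longleftrightarrow> Q N (d' @ a')"
    if "N \<in> C" "d' \<in> tuples N (length d)" "a' \<in> tuples N ?m" for N d' a'
    by (rule \<phi>(3)) (use that in \<open>auto simp: tuples_def\<close>)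
  have dT: "d \<in> tuples M (length d)" "a \<in> tuples M ?m" using sd sub by (auto simp: tuples_def)
  have dimd: "acl_dim (acl L M) (set d) (set a) = ?K"
  proof -
    have "acl_dim (acl L M) (set d) (set a) = card (set us)"
      by (rule M.dim_eq_card) (use basis sub in \<open>auto simp: d_def\<close>)
    then show ?thesis using dist by (simp add: distinct_card)
  qed
  have strong: "strong L T ?N d a \<phi>"
    unfolding strong_def R(2)
  proof (intro conjI allI impI ballI)
    show "distinct (d @ a)" by (rule dd)
    show "\<phi> \<in> fmlas L (length d + length a)" "qfree \<phi>" by (rule \<phi>)+
    show "holds ?N \<phi> (d @ a)"
      using R(3)[OF \<phi>(1)] \<phi>Q[OF M(1) dT] Q(2) by simp
    fix N :: "('f, 'r, 'u) fo_struct" and d' a' I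
    assume N: "models L T N \<and> aleph1_saturated L N" "d' \<in> tuples N (length d)" "a' \<in> tuples N (length a)"
      "holds N \<phi> (d' @ a')"
    have NC: "N \<in> C" using N(1) by (simp add: C_eq)
    have q: "Q N (d' @ a')" using \<phi>Q[OF NC N(2,3)] N(4) by simp
    show "distinct (d' @ a')" using QD[OF NC N(2,3) q] by blast
    show "acl_dim (acl L N) (set (nths d' (- I))) (set (nths d' I) \<union> set a')
      \<le> acl_dim (acl L M) (set (nths d (- I))) (set (nths d I) \<union> set a)"
      by (rule alg_transfer_dim[OF M(1) sd sub(2) dd(1) NC N(2,3) QD(3)[OF NC N(2,3) q]])
  qed
  \<comment> \<open>\<open>definable_ex_tuple\<close> binds the leading block, so \<open>ws\<close>
    comes first; after its removal \<open>us\<close> leads, as \<open>definable_indep\<close>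
    expects.\<close>
  let ?S = "\<lambda>N as. Q N (take ?K (drop ?w as) @ take ?w as @ drop (?w + ?K) as)"
  have "definable L C (?w + (?K + ?m)) ?S"
    by (rule definable_map[OF Q(1), of "block ?w ?K @ block 0 ?w @ block (?w + ?K) ?m"]) (auto simp: ld)
  from definable_indep[OF definable_ex_tuple[OF this]]
  obtain \<Theta> where \<Theta>: "definable L C ?m \<Theta>"
    "\<forall>N\<in>C. aleph1_saturated L N \<longrightarrow> (\<forall>b\<in>tuples N ?m. \<Theta> N b \<longleftrightarrow>
      (\<exists>us\<in>tuples N ?K. (\<exists>ws\<in>tuples N ?w. ?S N (ws @ us @ b)) \<and> indep_list (acl L N) (set b) us))"
    by (elim exE conjE) (rule that)
  have \<Theta>': "\<Theta> N b \<longleftrightarrow> (\<exists>us\<in>tuples N ?K. \<exists>ws\<in>tuples N ?w. Q N ((us @ ws) @ b) \<and> indep_list (acl L N) (set b) us)"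
    if "N \<in> C" "aleph1_saturated L N" "b \<in> tuples N ?m" for N b
  proof -
    have "?S N (ws @ us @ b) \<longleftrightarrow> Q N ((us @ ws) @ b)" if "us \<in> tuples N ?K" "ws \<in> tuples N ?w" for us ws
      using that by (simp add: tuples_def)
    then show ?thesis using \<Theta>(2) that by blast
  qed
  obtain \<theta> where \<theta>: "\<theta> \<in> fmlas L ?m"
    "\<And>N b. N \<in> C \<Longrightarrow> b \<in> tuples N ?m \<Longrightarrow> holds N \<theta> b \<longleftrightarrow> \<Theta> N b"
    using \<Theta>(1) by (rule definableE) (rule that)
  have spans: "set (us' @ ws') \<subseteq> acl L N (set b \<union> set us')"
    if N: "N \<in> C" "us' \<in> tuples N ?K" "ws' \<in> tuples N ?w" "b \<in> tuples N ?m" "Q N ((us' @ ws') @ b)"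
    for N us' ws' b
  proof
    interpret N: pregeometry "dom N" "acl L N" by (rule acl_pregeometry[OF N(1)])
    have e: "us' @ ws' \<in> tuples N (length d)" using N(2,3) by (auto simp: tuples_def ld)
    have len: "length us' = ?K" "length ws' = ?w" using N by (auto simp: tuples_def)
    have nu: "nths (us' @ ws') {..<?K} = us'" "nths d {..<?K} = us"
      using len by (simp_all add: nths_upt_eq_take d_def)
    fix x assume "x \<in> set (us' @ ws')"
    then obtain i where i: "x = (us' @ ws') ! i" "i < length d"
      using len ld by (metis in_set_conv_nth length_append)
    have "d ! i \<in> acl L M (set (nths d {..<?K}) \<union> set a)"
      using basis(2) i(2) nth_mem[of i d] by (auto simp: nu d_def Un_commute)
    then have "(us' @ ws') ! i \<in> acl L N (set (nths (us' @ ws') {..<?K}) \<union> set b)"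
      using QD(3)[OF N(1) e N(4,5)] i(2) unfolding alg_transfer_def by blast
    then show "x \<in> acl L N (set b \<union> set us')" using i(1) len(1) by (simp add: Un_commute)
  qed
  \<comment> \<open>Persistence of dependences makes \<open>us'\<close> span the whole tuple over
    \<open>b\<close>, so the dimension reaches \<open>?K\<close> exactly when \<open>us'\<close> is
    independent.\<close>
  have dim_iff: "?dim N (us' @ ws') b \<le> ?K \<and>
      (?dim N (us' @ ws') b = ?K \<longleftrightarrow> indep_list (acl L N) (set b) us')"
    if N: "N \<in> C" "us' \<in> tuples N ?K" "ws' \<in> tuples N ?w" "b \<in> tuples N ?m" "Q N ((us' @ ws') @ b)"
    for N us' ws' b
  proof -
    interpret N: pregeometry "dom N" "acl L N" by (rule acl_pregeometry[OF N(1)])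
    have e: "us' @ ws' \<in> tuples N (length d)" using N(2,3) by (auto simp: tuples_def ld)
    have du: "distinct us'" using QD(2)[OF N(1) e N(4,5)] by simp
    have cu: "card (set us') = ?K" using du N(2) by (simp add: distinct_card tuples_def)
    have bD: "set b \<subseteq> dom N" "set us' \<subseteq> dom N" using N by (auto simp: tuples_def)
    have il: "indep_list (acl L N) (set b) us' \<longleftrightarrow> N.indep (set b) (set us')"
      using N.indep_list_iff[OF bD] du by simp
    note sp = spans[OF N]
    have le: "?dim N (us' @ ws') b \<le> card (set us')"
      using sp by (intro N.dim_le) auto
    have "N.indep (set b) (set us')" if eq: "?dim N (us' @ ws') b = ?K"
    proof -
      obtain B where B: "B \<subseteq> set us'" "N.indep (set b) B" "set us' \<subseteq> acl L N (set b \<union> B)"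
        using N.basis_exists[of "set us'" "set b"] bD by auto
      have "set b \<subseteq> acl L N (set b \<union> B)" using N.cl_ext[of "set b \<union> B"] bD B(1) by blast
      then have "acl L N (set b \<union> set us') \<subseteq> acl L N (set b \<union> B)" using B(3) by (intro N.cl_Un_least)
      then have "?dim N (us' @ ws') b \<le> card B"
        using sp B(1) by (intro N.dim_le) (auto intro: finite_subset)
      then have "B = set us'" using eq cu B(1) by (intro card_seteq) auto
      then show ?thesis using B(2) by simp
    qed
    moreover have "?dim N (us' @ ws') b = card (set us')" if "N.indep (set b) (set us')"
      using that sp bD by (intro N.dim_eq_card) auto
    ultimately show ?thesis using le cu il by auto
  qed
  have split: "\<exists>us' ws'. us' \<in> tuples N ?K \<and> ws' \<in> tuples N ?w \<and> e = us' @ ws'"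
    if "e \<in> tuples N (length d)" for N :: "('f, 'r, 'u) fo_struct" and e
    using that set_take_subset[of ?K e] set_drop_subset[of ?K e]
    by (intro exI[of _ "take ?K e"] exI[of _ "drop ?K e"]) (auto simp: tuples_def ld)
  have join: "us' @ ws' \<in> tuples N (length d)" if "us' \<in> tuples N ?K" "ws' \<in> tuples N ?w"
    for N :: "('f, 'r, 'u) fo_struct" and us' ws'
    using that by (auto simp: tuples_def ld)
  have d_formula: "is_d_formula TYPE('u) L T (length d) ?m \<phi> ?K \<theta>"
    unfolding is_d_formula_def
  proof (intro conjI allI impI ballI)
    show "\<theta> \<in> fmlas L ?m" by (rule \<theta>)
    fix N :: "('f, 'r, 'u) fo_struct" and b
    assume "models L T N \<and> aleph1_saturated L N" and b: "b \<in> tuples N ?m"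
    then have N: "N \<in> C" "aleph1_saturated L N" by (simp_all add: C_eq)
    let ?d = "\<exists>e\<in>tuples N (length d). holds N \<phi> (e @ b) \<and> ?dim N e b = ?K"
    have all: "\<forall>e\<in>tuples N (length d). holds N \<phi> (e @ b) \<longrightarrow> ?dim N e b \<le> ?K"
    proof (intro ballI impI)
      fix e assume e: "e \<in> tuples N (length d)" "holds N \<phi> (e @ b)"
      then obtain us' ws' where "us' \<in> tuples N ?K" "ws' \<in> tuples N ?w" "e = us' @ ws'" using split by blast
      then show "?dim N e b \<le> ?K"
        using dim_iff[OF N(1) _ _ b, of us' ws'] \<phi>Q[OF N(1) e(1) b] e(2) by blast
    qed
    have "?d \<longleftrightarrow> \<Theta> N b"
    proof
      assume ?d
      then obtain e where e: "e \<in> tuples N (length d)" "holds N \<phi> (e @ b)"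
        "?dim N e b = ?K" by blast
      then obtain us' ws' where u: "us' \<in> tuples N ?K" "ws' \<in> tuples N ?w" "e = us' @ ws'" using split by blast
      then have "Q N ((us' @ ws') @ b)" using \<phi>Q[OF N(1) e(1) b] e(2) by blast
      then show "\<Theta> N b" unfolding \<Theta>'[OF N b] using u dim_iff[OF N(1) u(1,2) b] e(3) by blast
    next
      assume "\<Theta> N b"
      then obtain us' ws' where u: "us' \<in> tuples N ?K" "ws' \<in> tuples N ?w" "Q N ((us' @ ws') @ b)"
        "indep_list (acl L N) (set b) us'" unfolding \<Theta>'[OF N b] by blast
      have "holds N \<phi> ((us' @ ws') @ b)" using \<phi>Q[OF N(1) join[OF u(1,2)] b] u(3) by blast
      then show ?d
        using join[OF u(1,2)] dim_iff[OF N(1) u(1,2) b u(3)] u(4) by blast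
    qed
    then show "holds N \<theta> b \<longleftrightarrow>
        ?d \<and>
        (\<forall>e\<in>tuples N (length d). holds N \<phi> (e @ b) \<longrightarrow> ?dim N e b \<le> ?K)"
      using all \<theta>(2)[OF N(1) b] by simp
  qed
  \<comment> \<open>A non-algebraic entry belongs to some basis, so over it the other entries have
    dimension below \<open>?K\<close>. This bound persists in every solution, and an entry algebraic
    over \<open>b\<close> would therefore push the whole dimension below \<open>?K\<close>.\<close>
  have hyper: "Suc (acl_dim (acl L M) (set (nths d (- {i}))) (set (nths d {i}) \<union> set a)) \<le> ?K"
    if i: "i < length d" for i
  proof -
    have ni: "set (nths d {i}) = {d ! i}" using i by (auto simp: set_nths')
    have sD: "set (nths d (- {i})) \<subseteq> dom M" using set_nths_subset[of d "- {i}"] sd by blast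
    have di: "d ! i \<in> dom M" using sd i by auto
    have "set (nths d {i}) \<union> set a \<subseteq> dom M" using di sub(2) ni by simp
    then obtain B where B: "B \<subseteq> set (nths d (- {i}))" "M.indep (set (nths d {i}) \<union> set a) B"
      "set (nths d (- {i})) \<subseteq> acl L M (set (nths d {i}) \<union> set a \<union> B)"
      using M.basis_exists[of "set (nths d (- {i}))" "set (nths d {i}) \<union> set a"] sD by auto
    have fB: "finite B" using B(1) finite_subset by blast
    have BD: "B \<subseteq> dom M" using B(1) sD by blast
    have "M.indep (set a) ({d ! i} \<union> B)"
      using trd[of "d ! i"] i B(2) ni di sub(2) BD fB
      by (intro M.indep_Un) (auto simp: M.indep_def[of _ "{d ! i}"] Un_commute)
    moreover have "d ! i \<notin> B" using B(1) dd(1) i by (auto simp: set_nths' nth_eq_iff_index_eq)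
    moreover have "{d ! i} \<union> B \<subseteq> acl L M (set a \<union> set d)"
      using M.cl_ext[of "set a \<union> set d"] sub(2) sd B(1) i set_nths_subset[of d "- {i}"] nth_mem[OF i] by blast
    ultimately have "Suc (card B) \<le> ?K"
      using M.dim_ge[OF M.finite_dim_finite[of "set d" "set a"] sd sub(2), of "{d ! i} \<union> B"] dimd fB sd sub(2) by simp
    moreover have "acl_dim (acl L M) (set (nths d (- {i}))) (set (nths d {i}) \<union> set a) \<le> card B"
      using B fB by (intro M.dim_le)
    ultimately show ?thesis by simp
  qed
  have D_formula: "is_D_formula TYPE('u) L T (length d) ?m \<phi> ?K \<theta>"
    unfolding is_D_formula_def
  proof (intro conjI allI impI ballI)
    show "\<theta> \<in> fmlas L ?m" by (rule \<theta>)
    fix N :: "('f, 'r, 'u) fo_struct" and b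
    assume "models L T N \<and> aleph1_saturated L N" and b: "b \<in> tuples N ?m"
    then have N: "N \<in> C" "aleph1_saturated L N" by (simp_all add: C_eq)
    interpret N: pregeometry "dom N" "acl L N" by (rule acl_pregeometry[OF N(1)])
    let ?D = "\<exists>e\<in>tuples N (length d). holds N \<phi> (e @ b) \<and> ?dim N e b \<ge> ?K \<and>
        set e \<inter> acl L N (set b) = {}"
    have bD: "set b \<subseteq> dom N" using b by (simp add: tuples_def)
    have "?D \<longleftrightarrow> \<Theta> N b"
    proof
      assume ?D
      then obtain e where e: "e \<in> tuples N (length d)" "holds N \<phi> (e @ b)"
        "?dim N e b \<ge> ?K" by blast
      then obtain us' ws' where u: "us' \<in> tuples N ?K" "ws' \<in> tuples N ?w" "e = us' @ ws'" using split by blast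
      then have q: "Q N ((us' @ ws') @ b)" using \<phi>Q[OF N(1) e(1) b] e(2) by blast
      then show "\<Theta> N b" unfolding \<Theta>'[OF N b] using u dim_iff[OF N(1) u(1,2) b] e(3) antisym by metis
    next
      assume "\<Theta> N b"
      then obtain us' ws' where u: "us' \<in> tuples N ?K" "ws' \<in> tuples N ?w" "Q N ((us' @ ws') @ b)"
        "indep_list (acl L N) (set b) us'" unfolding \<Theta>'[OF N b] by blast
      define e where "e = us' @ ws'"
      have e: "e \<in> tuples N (length d)" "Q N (e @ b)" using join[OF u(1,2)] u(3) by (auto simp: e_def)
      have dim: "?dim N e b = ?K"
        using dim_iff[OF N(1) u(1,2) b u(3)] u(4) by (simp add: e_def)
      have eD: "set e \<subseteq> dom N" "length e = length d" using e(1) by (auto simp: tuples_def)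
      have "x \<notin> acl L N (set b)" if "x \<in> set e" for x
      proof
        assume x: "x \<in> acl L N (set b)"
        from \<open>x \<in> set e\<close> obtain i where i: "i < length d" "x = e ! i"
          using eD by (metis in_set_conv_nth)
        have ni: "set (nths e {i}) = {x}" using i eD by (auto simp: set_nths')
        have sD: "set (nths e (- {i})) \<subseteq> dom N" using set_nths_subset[of e "- {i}"] eD by blast
        have "finite_dim (acl L N) (set (nths e (- {i}))) (set (nths e {i}) \<union> set b)"
          using sD bD subsetD[OF acl_dom x] ni by (intro N.finite_dim_finite) auto
        then obtain B where B: "B \<subseteq> set (nths e (- {i}))" "finite B"
          "card B = acl_dim (acl L N) (set (nths e (- {i}))) (set (nths e {i}) \<union> set b)"
          "set (nths e (- {i})) \<subseteq> acl L N (set (nths e {i}) \<union> set b \<union> B)"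
          by (rule N.dim_obtain)
        have bB: "set b \<union> B \<subseteq> acl L N (set b \<union> B)" using bD B(1) sD by (intro N.cl_ext) blast
        have xB: "x \<in> acl L N (set b \<union> B)" using x N.cl_mono[of "set b" "set b \<union> B"] by blast
        have "acl L N (set (nths e {i}) \<union> set b \<union> B) \<subseteq> acl L N (set b \<union> B)"
          using bB xB ni by (intro N.cl_least) auto
        then have "set (nths e (- {i})) \<union> {x} \<subseteq> acl L N (set b \<union> B)" using B(4) xB by blast
        moreover have "set e \<subseteq> set (nths e (- {i})) \<union> {x}" using i eD(2) by (auto simp: set_nths' in_set_conv_nth)
        ultimately have "?dim N e b \<le> card B"
          using B(1,2) set_nths_subset[of e "- {i}"] by (intro N.dim_le) blast+
        also have "\<dots> \<le> acl_dim (acl L M) (set (nths d (- {i}))) (set (nths d {i}) \<union> set a)"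
          unfolding B(3) by (rule alg_transfer_dim[OF M(1) sd sub(2) dd(1) N(1) e(1) b QD(3)[OF N(1) e(1) b e(2)]])
        finally show False using hyper[OF i(1)] dim by simp
      qed
      moreover have "holds N \<phi> (e @ b)" using \<phi>Q[OF N(1) e(1) b] e(2) by blast
      ultimately show ?D using e dim by (intro bexI[of _ e]) auto
    qed
    then show "holds N \<theta> b \<longleftrightarrow> ?D"
      using \<theta>(2)[OF N(1) b] by simp
  qed
  \<comment> \<open>The dimension inequality for \<open>Z\<close> is used twice: the empty base puts
    \<open>?N\<close> into the class, and the base \<open>set a\<close> makes \<open>a\<close>
    closed in \<open>a\<close> with \<open>d\<close>.\<close>
  have in_class: "?N \<in> class_K_alpha L T p \<alpha>"
    by (rule recolor_in_class[OF M(3,2,1)]) (use Z in blast)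
  have closed: "closed_in L T p \<alpha> ?N (set a) (set a \<union> set d)"
    unfolding closed_in_def
  proof (intro conjI allI impI)
    fix A assume A: "finite A \<and> A \<subseteq> set a \<union> set d"
    have "A \<subseteq> dom M" using A sub(2) sd by blast
    then have *: "\<alpha> * real (card (A \<inter> Z)) \<le> real (acl_dim (acl L M) A (set a))" using Z A by blast
    have "card {x\<in>A - set a. rint ?N p [x]} \<le> card (A \<inter> Z)" using A by (intro card_mono) auto
    then have "\<alpha> * real (card {x\<in>A - set a. rint ?N p [x]}) \<le> \<alpha> * real (card (A \<inter> Z))"
      using M(4) by (intro mult_left_mono) auto
    with * show "delta L T p \<alpha> ?N A (set a) \<ge> 0" unfolding delta_def R(2) by simp
  qed simp
  have transc: "transcendental L T ?N d a"
    unfolding transcendental_def R(2)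
  proof
    fix x assume "x \<in> set d - set a"
    then have x: "x \<in> set d" by blast
    have "acl_dim (acl L M) {x} (set a) = card {x}"
    proof (rule M.dim_eq_card)
      show "M.indep (set a) {x}" using trd[OF x] by (simp add: M.indep_def)
      show "{x} \<subseteq> acl L M (set a \<union> {x})" using x sd sub(2) by (intro order_trans[OF _ M.cl_ext]) auto
    qed (use sub in auto)
    then show "acl_dim (acl L M) {x} (set a) = 1" by simp
  qed
  have \<Theta>a: "\<Theta> M a"
  proof -
    have "indep_list (acl L M) (set a) us"
      using M.indep_list_iff[of "set a" us] sub basis(1) dist by simp
    moreover have "us \<in> tuples M ?K" "ws \<in> tuples M ?w" using sub by (auto simp: tuples_def)
    moreover have "Q M ((us @ ws) @ a)" using Q(2) by (simp add: d_def)
    ultimately show ?thesis using \<Theta>'[OF M(1) sat dT(2)] by blast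
  qed
  show ?thesis
    unfolding d_def[symmetric]
  proof (intro exI[of _ \<Theta>] conjI allI impI ballI)
    fix S :: "('f, 'r, 'u) fo_struct" and b
    assume S: "rich_model L T p \<alpha> S" and b: "b \<in> tuples S ?m" and t: "\<Theta> S b"
    have SC: "S \<in> C" using S by (simp add: rich_model_def C_eq)
    have hyp: "?N \<in> class_K_alpha L T p \<alpha> \<and> set a \<subseteq> dom ?N \<and> set d \<subseteq> dom ?N \<and>
        closed_in L T p \<alpha> ?N (set a) (set a \<union> set d) \<and>
        transcendental L T ?N d a \<and> dimK L T ?N (set d) (set a) = ?K \<and>
        strong L T ?N d a \<phi> \<and>
        is_d_formula TYPE('u) L T (length d) (length a) \<phi> ?K \<theta> \<and>
        is_D_formula TYPE('u) L T (length d) (length a) \<phi> ?K \<theta>"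
      using in_class closed transc strong d_formula D_formula sub(2) sd dimd by (simp add: R(2))
    have "\<forall>b\<in>tuples S (length a). holds S \<theta> b \<and> holds S \<theta> b \<longrightarrow>
           (\<exists>e\<in>tuples S (length d). holds S \<phi> (e @ b) \<and>
              (\<forall>i<length d. rint S p [e ! i] \<longleftrightarrow> rint ?N p [d ! i]))"
      using S hyp unfolding rich_model_def by blast
    moreover have "holds S \<theta> b" using \<theta>(2)[OF SC b] t by simp
    ultimately obtain e where e: "e \<in> tuples S (length d)" "holds S \<phi> (e @ b)"
      "\<forall>i<length d. rint S p [e ! i] \<longleftrightarrow> d ! i \<in> Z" using b by (auto simp: recolor_simps)
    have "P S (e @ b)" using QD(1)[OF SC e(1) b] \<phi>Q[OF SC e(1) b] e(2) by blast
    then show "\<exists>e\<in>tuples S (length d). P S (e @ b) \<and> (\<forall>i<length d. rint S p [e ! i] \<longleftrightarrow> d ! i \<in> Z)"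
      using e by blast
  qed (use \<Theta>(1) \<Theta>a in auto)
qed

end

section \<open>Indiscernible arrays\<close>

definition homogeneous :: "nat set \<Rightarrow> nat \<times> (nat set \<Rightarrow> bool) \<Rightarrow> bool" where
  "homogeneous H q \<longleftrightarrow> (\<forall>X Y. X \<subseteq> H \<and> finite X \<and> card X = fst q \<and>
    Y \<subseteq> H \<and> finite Y \<and> card Y = fst q \<longrightarrow> snd q X = snd q Y)"

lemma homogeneous_subset: "homogeneous H q \<Longrightarrow> H' \<subseteq> H \<Longrightarrow> homogeneous H' q"
  unfolding homogeneous_def by (meson order_trans)

lemma ramsey_family:
  assumes "finite \<Q>"
  shows "\<exists>H. infinite H \<and> (\<forall>q\<in>\<Q>. homogeneous H q)"
  using assms
proof (induction \<Q>)
  case empty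
  then show ?case using infinite_UNIV_nat by blast
next
  case (insert q \<Q>)
  from insert.IH obtain H where H: "infinite H" "\<forall>q\<in>\<Q>. homogeneous H q" by blast
  have "\<exists>Y t. Y \<subseteq> H \<and> infinite Y \<and> t < 2 \<and>
      (\<forall>X. X \<subseteq> Y \<and> finite X \<and> card X = fst q \<longrightarrow> (if snd q X then 1 else 0 :: nat) = t)"
    by (rule Ramsey[OF H(1)]) simp
  then obtain Y t where Y: "Y \<subseteq> H" "infinite Y"
    "\<forall>X. X \<subseteq> Y \<and> finite X \<and> card X = fst q \<longrightarrow> (if snd q X then 1 else 0 :: nat) = t"
    by (elim exE conjE) (rule that)
  have "homogeneous Y q"
    unfolding homogeneous_def
  proof (intro allI impI)
    fix X1 X2
    assume "X1 \<subseteq> Y \<and> finite X1 \<and> card X1 = fst q \<and> X2 \<subseteq> Y \<and> finite X2 \<and> card X2 = fst q"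
    then have "(if snd q X1 then 1 else 0 :: nat) = (if snd q X2 then 1 else 0)"
      using Y(3)[rule_format, of X1] Y(3)[rule_format, of X2] by simp
    then show "snd q X1 = snd q X2" by (simp split: if_splits)
  qed
  moreover have "\<forall>q\<in>\<Q>. homogeneous Y q" using H(2) Y(1) homogeneous_subset by blast
  ultimately show ?case using Y(2) by blast
qed

definition order_equivalent :: "('a \<Rightarrow> 'a \<Rightarrow> bool) \<Rightarrow> 'a list \<Rightarrow> 'a list \<Rightarrow> bool" where
  "order_equivalent r xs ys \<longleftrightarrow> length xs = length ys \<and>
    (\<forall>i<length xs. \<forall>j<length xs. r (xs ! i) (xs ! j) \<longleftrightarrow> r (ys ! i) (ys ! j))"

text \<open>Equal entries are those of which neither is less than the other, so repetitions occur at
  the same positions in both lists and \<open>h\<close> is well defined.\<close>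

lemma order_equivalent_map:
  fixes us vs :: "nat list"
  assumes "order_equivalent (<) us vs"
  obtains h where "vs = map h us" "strict_mono_on (set us) h"
proof -
  have len: "length us = length vs"
    and lt: "\<And>i j. i < length us \<Longrightarrow> j < length us \<Longrightarrow> us ! i < us ! j \<longleftrightarrow> vs ! i < vs ! j"
    using assms by (auto simp: order_equivalent_def)
  define h where "h x = vs ! (SOME j. j < length us \<and> us ! j = x)" for x
  have h: "h (us ! i) = vs ! i" if "i < length us" for i
  proof -
    define j where "j = (SOME j. j < length us \<and> us ! j = us ! i)"
    have j: "j < length us \<and> us ! j = us ! i" unfolding j_def by (rule someI[of _ i]) (use that in simp)
    then have "\<not> vs ! i < vs ! j" "\<not> vs ! j < vs ! i" using lt[of i j] lt[of j i] that by auto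
    then have "vs ! j = vs ! i" by simp
    then show ?thesis by (simp add: h_def j_def)
  qed
  show ?thesis
  proof (rule that)
    show "vs = map h us" using len h by (intro nth_equalityI) auto
    show "strict_mono_on (set us) h"
      by (rule strict_mono_onI) (metis h in_set_conv_nth lt)
  qed
qed

text \<open>Ramsey's theorem colors sets, so a list is split into the increasing enumeration of its
  entries and a pattern \<open>f\<close> of positions. Each length has finitely many patterns, and
  the resulting finitely many colorings are made homogeneous together.\<close>

lemma ramsey_lists:
  fixes \<F> :: "(nat \<times> (nat list \<Rightarrow> bool)) set"
  assumes "finite \<F>"
  shows "\<exists>H. infinite H \<and> (\<forall>(r, Q)\<in>\<F>. \<forall>us vs. length us = r \<and> set us \<subseteq> H \<and> set vs \<subseteq> H \<and>
    order_equivalent (<) us vs \<longrightarrow> Q us = Q vs)"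
proof -
  let ?Q = "\<lambda>Q f X. Q (map ((!) (sorted_list_of_set X)) f)"
  define \<Q> where "\<Q> = (\<Union>(r, Q)\<in>\<F>. \<Union>s\<le>r. (\<lambda>f. (s, ?Q Q f)) ` {f. set f \<subseteq> {..<s} \<and> length f = r})"
  have "finite \<Q>" unfolding \<Q>_def using assms by (auto intro!: finite_UN_I finite_lists_length_eq)
  then obtain H where H: "infinite H" "\<forall>q\<in>\<Q>. homogeneous H q"
    using ramsey_family by blast
  have "Q us = Q vs" if rQ: "(r, Q) \<in> \<F>" "length us = r" "set us \<subseteq> H" "set vs \<subseteq> H" and
    oe: "order_equivalent (<) us vs" for r Q us vs
  proof -
    obtain h where h: "vs = map h us" "strict_mono_on (set us) h" using order_equivalent_map[OF oe] .
    let ?X = "sorted_list_of_set (set us)" and ?s = "card (set us)"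
    have lX: "length ?X = ?s" by simp
    have sX: "sorted_wrt (<) ?X" using strict_sorted_list_of_set by simp
    have "set us \<subseteq> (!) ?X ` {..<?s}"
    proof
      fix x assume "x \<in> set us"
      then have "x \<in> set ?X" by simp
      then show "x \<in> (!) ?X ` {..<?s}" unfolding in_set_conv_nth lX by blast
    qed
    then have "us \<in> map ((!) ?X) ` lists {..<?s}" unfolding lists_image[symmetric] by blast
    then obtain f where f: "set f \<subseteq> {..<?s}" "us = map ((!) ?X) f" by blast
    have "strict_sorted (map h ?X)"
      unfolding sorted_wrt_map
      using sX by (rule sorted_wrt_mono_rel[rotated]) (use h(2) in \<open>auto simp: strict_mono_on_def\<close>)
    then have Y: "sorted_list_of_set (set vs) = map h ?X"
      using h(1) by (metis list.set_map set_sorted_list_of_set List.finite_set sorted_list_of_set.idem_if_sorted_distinct strict_sorted_iff)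
    have "map h us = map h (map ((!) ?X) f)" by (rule arg_cong[OF f(2)])
    also have "\<dots> = map ((!) (map h ?X)) f" using f(1) lX by auto
    finally have vs: "vs = map ((!) (sorted_list_of_set (set vs))) f" unfolding Y by (rule trans[OF h(1)])
    have inj: "inj_on h (set us)" using h(2) by (rule strict_mono_on_imp_inj_on)
    have cvs: "card (set vs) = ?s" using h(1) inj by (simp add: card_image)
    have "length f = r" using arg_cong[OF f(2), of length] rQ(2) by simp
    then have "(?s, ?Q Q f) \<in> \<Q>"
      unfolding \<Q>_def using rQ(1,2) f(1) card_length[of us]
      by (intro UN_I[of "(r, Q)"]) (auto intro!: bexI[of _ ?s])
    then have "homogeneous H (?s, ?Q Q f)" using H(2) by blast
    then have "?Q Q f (set us) = ?Q Q f (set vs)" using rQ(3,4) cvs unfolding homogeneous_def by simp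
    then show ?thesis using f(2) vs by simp
  qed
  with H(1) show ?thesis by blast
qed

section \<open>Compactness in a saturated model\<close>

lemma fold_Con:
  "set \<phi>s \<subseteq> fmlas L n \<Longrightarrow> foldr Con \<phi>s (Neg Bot) \<in> fmlas L n"
  "sat M v (foldr Con \<phi>s (Neg Bot)) \<longleftrightarrow> (\<forall>\<phi>\<in>set \<phi>s. sat M v \<phi>)"
  by (induction \<phi>s) (auto simp: fmlas_def)

text \<open>Saturation handles finitely many variables at a time. Infinitely many are assigned one
  by one, under the invariant \<open>FS\<close> that every finite part of \<open>\<Gamma>\<close>
  has a satisfying assignment extending the values fixed so far.\<close>

lemma saturated_compactness:
  fixes M :: "('f, 'r, 'u) fo_struct"
  assumes sat: "aleph1_saturated L M" and ne: "dom M \<noteq> {}" and wf: "\<And>\<phi>. \<phi> \<in> \<Gamma> \<Longrightarrow> wf_fm L \<phi>"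
    and fin: "\<And>\<Gamma>'. \<Gamma>' \<subseteq> \<Gamma> \<Longrightarrow> finite \<Gamma>' \<Longrightarrow> \<exists>v. range v \<subseteq> dom M \<and> (\<forall>\<phi>\<in>\<Gamma>'. sat M v \<phi>)"
  shows "\<exists>v. range v \<subseteq> dom M \<and> (\<forall>\<phi>\<in>\<Gamma>. sat M v \<phi>)"
proof -
  define E where "E s \<Gamma>' v \<longleftrightarrow> range v \<subseteq> dom M \<and> (\<forall>i<length s. v i = s ! i) \<and> (\<forall>\<phi>\<in>\<Gamma>'. sat M v \<phi>)"
    for s :: "'u list" and \<Gamma>' v
  define FS where "FS s \<longleftrightarrow> (\<forall>\<Gamma>'\<subseteq>\<Gamma>. finite \<Gamma>' \<longrightarrow> (\<exists>v. E s \<Gamma>' v))" for s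
  \<comment> \<open>The new value comes last among the fixed ones but is the first argument of the
    formula, since a realization precedes the parameters; hence
    \<open>tl as @ [hd as]\<close>.\<close>
  have E_definable: "definable L {M} (Suc n) (\<lambda>M' as. \<exists>v. E (tl as @ [hd as]) \<Gamma>' v)"
    if \<Gamma>': "\<Gamma>' \<subseteq> \<Gamma>" "finite \<Gamma>'" for n \<Gamma>'
  proof -
    obtain \<phi>s where \<phi>s: "set \<phi>s = \<Gamma>'" using finite_list[OF \<Gamma>'(2)] by blast
    obtain l where l: "(\<Union>\<phi>\<in>\<Gamma>'. fv \<phi>) \<subseteq> {..<Suc n + l}"
    proof -
      have "finite (\<Union>\<phi>\<in>\<Gamma>'. fv \<phi>)" using \<Gamma>'(2) by auto
      then obtain k where "(\<Union>\<phi>\<in>\<Gamma>'. fv \<phi>) \<subseteq> {..<k}" using finite_nat_iff_bounded by blast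
      then show ?thesis by (intro that[of k]) auto
    qed
    let ?\<psi> = "foldr Con \<phi>s (Neg Bot)"
    have "set \<phi>s \<subseteq> fmlas L (Suc n + l)" using wf \<phi>s \<Gamma>'(1) l by (auto simp: fmlas_def)
    then have \<psi>: "?\<psi> \<in> fmlas L (Suc n + l)" by (rule fold_Con)
    let ?P = "\<lambda>M as. holds M ?\<psi> (drop (Suc l) as @ as ! l # take l as)"
    have "definable L {M} (l + Suc n) ?P"
      by (rule definable_map[OF definable_holds[OF \<psi>], of "block (Suc l) n @ l # block 0 l"]) auto
    from definable_ex_tuple[OF this]
    show ?thesis
    proof (rule iffD1[OF definable_cong, rotated])
      fix M' as assume "M' \<in> {M}" and as: "as \<in> tuples M' (Suc n)"
      then have M': "M' = M" by simp
      obtain a s where s: "as = a # s" "length s = n" "a \<in> dom M" "set s \<subseteq> dom M"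
        using as M' by (cases as) (auto simp: tuples_def)
      have P: "?P M (xs @ as) \<longleftrightarrow> holds M ?\<psi> (s @ a # xs)" if "length xs = l" for xs
        using that s by (simp add: nth_append)
      show "(\<exists>xs\<in>tuples M' l. ?P M' (xs @ as)) \<longleftrightarrow> (\<exists>v. E (tl as @ [hd as]) \<Gamma>' v)"
      proof
        assume "\<exists>xs\<in>tuples M' l. ?P M' (xs @ as)"
        then obtain xs where xs: "length xs = l" "set xs \<subseteq> dom M" "holds M ?\<psi> (s @ a # xs)"
          using P M' by (auto simp: tuples_def)
        define v where "v i = (if i < Suc n + l then (s @ a # xs) ! i else a)" for i
        have "sat M v ?\<psi>"
        proof -
          have "sat M v ?\<psi> = sat M (nth (s @ a # xs)) ?\<psi>"
            by (rule sat_cong) (use \<psi> in \<open>auto simp: fmlas_def v_def\<close>)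
          then show ?thesis using xs(3) by (simp add: holds_def)
        qed
        moreover have "v i \<in> dom M" for i
        proof (cases "i < Suc n + l")
          case True
          then have "v i \<in> set (s @ a # xs)" unfolding v_def using s xs by (simp del: set_append)
          then show ?thesis using s xs by auto
        qed (use s in \<open>simp add: v_def\<close>)
        moreover have "v i = (s @ [a]) ! i" if "i < Suc n" for i
          using that s by (auto simp: v_def nth_append)
        ultimately have "E (tl as @ [hd as]) \<Gamma>' v"
          unfolding E_def using s \<phi>s by (auto simp: fold_Con)
        then show "\<exists>v. E (tl as @ [hd as]) \<Gamma>' v" by (rule exI[of _ v])
      next
        assume "\<exists>v. E (tl as @ [hd as]) \<Gamma>' v"
        then obtain v where v: "E (s @ [a]) \<Gamma>' v" using s by auto
        let ?xs = "map (\<lambda>i. v (Suc n + i)) [0..<l]"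
        have vi: "(s @ a # ?xs) ! i = v i" if "i < Suc n + l" for i
        proof (cases "i < Suc n")
          case True
          then have "(s @ a # ?xs) ! i = (s @ [a]) ! i" using s by (auto simp: nth_append)
          then show ?thesis using v True s by (simp add: E_def)
        next
          case False
          then show ?thesis using that s by (auto simp: nth_append nth_Cons' not_less)
        qed
        have "sat M v ?\<psi>" using v \<phi>s by (auto simp: E_def fold_Con)
        moreover have "sat M v ?\<psi> = sat M (nth (s @ a # ?xs)) ?\<psi>"
          by (rule sat_cong) (use \<psi> vi in \<open>auto simp: fmlas_def\<close>)
        ultimately have "?P M (?xs @ as)" using P[of ?xs] by (simp add: holds_def)
        moreover have "?xs \<in> tuples M l" using v by (auto simp: E_def tuples_def)
        ultimately show "\<exists>xs\<in>tuples M' l. ?P M' (xs @ as)" using M' by blast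
      qed
    qed
  qed
  have step: "\<exists>a\<in>dom M. FS (s @ [a])" if s: "FS s" "set s \<subseteq> dom M" for s
  proof -
    let ?n = "length s" and ?G = "{\<Gamma>'. \<Gamma>' \<subseteq> \<Gamma> \<and> finite \<Gamma>'}"
    have "\<forall>\<Gamma>'\<in>?G. \<exists>\<theta>\<in>fmlas L (Suc ?n). \<forall>as\<in>tuples M (Suc ?n). holds M \<theta> as \<longleftrightarrow> (\<exists>v. E (tl as @ [hd as]) \<Gamma>' v)"
    proof
      fix \<Gamma>' assume "\<Gamma>' \<in> ?G"
      then have "definable L {M} (Suc ?n) (\<lambda>M' as. \<exists>v. E (tl as @ [hd as]) \<Gamma>' v)" using E_definable by simp
      then show "\<exists>\<theta>\<in>fmlas L (Suc ?n). \<forall>as\<in>tuples M (Suc ?n).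
          holds M \<theta> as \<longleftrightarrow> (\<exists>v. E (tl as @ [hd as]) \<Gamma>' v)"
        unfolding definable_def by simp
    qed
    then have "\<forall>\<Gamma>'\<in>?G. \<exists>\<theta>. \<theta> \<in> fmlas L (Suc ?n) \<and> (\<forall>as\<in>tuples M (Suc ?n).
        holds M \<theta> as \<longleftrightarrow> (\<exists>v. E (tl as @ [hd as]) \<Gamma>' v))" by (simp only: Bex_def)
    from bchoice[OF this] obtain \<theta> where \<theta>: "\<forall>\<Gamma>'\<in>?G. \<theta> \<Gamma>' \<in> fmlas L (Suc ?n) \<and>
      (\<forall>as\<in>tuples M (Suc ?n). holds M (\<theta> \<Gamma>') as \<longleftrightarrow> (\<exists>v. E (tl as @ [hd as]) \<Gamma>' v))" ..
    have \<theta>1: "holds M (\<theta> \<Gamma>') (a # s) \<longleftrightarrow> (\<exists>v. E (s @ [a]) \<Gamma>' v)" if "\<Gamma>' \<in> ?G" "a \<in> dom M" for \<Gamma>' a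
      using \<theta>[THEN bspec, OF that(1), THEN conjunct2, THEN bspec, of "a # s"] s(2) that(2)
      by (simp add: tuples_def)
    let ?\<Sigma> = "(\<lambda>\<Gamma>'. (\<theta> \<Gamma>', s)) ` ?G"
    have "\<exists>xs\<in>tuples M 1. realizes M ?\<Sigma> xs"
    proof (rule sat[unfolded aleph1_saturated_def, rule_format, of "set s"], intro conjI allI impI)
      show "set s \<subseteq> dom M" "countable (set s)" using s by (auto simp: countable_finite)
      show "?\<Sigma> \<subseteq> formulas_over L (set s) 1" using \<theta> by (auto simp: formulas_over_def)
      fix \<Sigma>' assume "\<Sigma>' \<subseteq> ?\<Sigma> \<and> finite \<Sigma>'"
      then obtain \<G> where \<G>: "\<G> \<subseteq> ?G" "finite \<G>" "\<Sigma>' = (\<lambda>\<Gamma>'. (\<theta> \<Gamma>', s)) ` \<G>"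
        by (meson finite_subset_image)
      then have "\<Union>\<G> \<subseteq> \<Gamma>" "finite (\<Union>\<G>)" by auto
      \<comment> \<open>One assignment for the union of the finitely many finite sets serves them
        all at once; its value at \<open>?n\<close> realizes the finite part of the type.\<close>
      from s(1)[unfolded FS_def, rule_format, OF this] obtain v where v: "E s (\<Union>\<G>) v" ..
      have a: "v ?n \<in> dom M" using v by (auto simp: E_def)
      have "holds M (\<theta> \<Gamma>') (v ?n # s)" if "\<Gamma>' \<in> \<G>" for \<Gamma>'
      proof -
        have "E (s @ [v ?n]) \<Gamma>' v" using v that by (auto simp: E_def nth_append less_Suc_eq)
        then show ?thesis using \<theta>1[OF subsetD[OF \<G>(1) that] a] by blast
      qed
      then have "realizes M \<Sigma>' [v ?n]"
        unfolding realizes_def \<G>(3) by auto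
      then show "\<exists>xs\<in>tuples M 1. realizes M \<Sigma>' xs" using a by (intro bexI[of _ "[v ?n]"]) (auto simp: tuples_def)
    qed
    then obtain a where a: "a \<in> dom M" "realizes M ?\<Sigma> [a]" by (auto simp: tuples_def length_Suc_conv)
    then have "FS (s @ [a])" unfolding FS_def realizes_def using \<theta>1 by auto
    with a show ?thesis by blast
  qed
  have FS0: "FS []" unfolding FS_def E_def using fin by auto
  have "\<exists>v. \<forall>n. v n \<in> dom M \<and> FS (map v [0..<n] @ [v n])"
  proof (rule dependent_wellorder_choice)
    fix r and f g :: "nat \<Rightarrow> 'u" and n :: nat
    assume fg: "\<And>m. m < n \<Longrightarrow> f m = g m"
    have "map f [0..<n] = map g [0..<n]" using fg by simp
    then show "(r \<in> dom M \<and> FS (map f [0..<n] @ [r])) = (r \<in> dom M \<and> FS (map g [0..<n] @ [r]))" by (simp only:)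
  next
    fix n :: nat and f :: "nat \<Rightarrow> 'u"
    assume f: "\<And>m. m < n \<Longrightarrow> f m \<in> dom M \<and> FS (map f [0..<m] @ [f m])"
    have "FS (map f [0..<n])" using f[of "n - 1"] FS0 by (cases n) auto
    moreover have "set (map f [0..<n]) \<subseteq> dom M" using f by auto
    ultimately show "\<exists>r. r \<in> dom M \<and> FS (map f [0..<n] @ [r])" using step[of "map f [0..<n]"] by blast
  qed
  then obtain v where v: "\<And>n. v n \<in> dom M" "\<And>n. FS (map v [0..<n] @ [v n])" by blast
  have "sat M v \<phi>" if \<phi>: "\<phi> \<in> \<Gamma>" for \<phi>
  proof -
    obtain n where n: "fv \<phi> \<subseteq> {..<n}" using finite_nat_iff_bounded[of "fv \<phi>"] by auto
    obtain w where w: "E (map v [0..<n] @ [v n]) {\<phi>} w"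
      using v(2)[of n, unfolded FS_def, rule_format, of "{\<phi>}"] \<phi> by auto
    have "w i = v i" if "i < n" for i
      using w that unfolding E_def by (auto simp: nth_append dest: spec[of _ i])
    then have "sat M w \<phi> = sat M v \<phi>" using n by (intro sat_cong) auto
    then show ?thesis using w by (simp add: E_def)
  qed
  then show ?thesis using v(1) by blast
qed

section \<open>Indiscernible arrays of order type omega squared\<close>

definition lex_less :: "nat \<times> nat \<Rightarrow> nat \<times> nat \<Rightarrow> bool" where
  "lex_less p q \<longleftrightarrow> fst p < fst q \<or> fst p = fst q \<and> snd p < snd q"

text \<open>Row \<open>t\<close> takes the block of \<open>B\<close> numbers starting at
  \<open>t * B\<close>, so any part of the array with bounded second coordinates embeds into the
  natural numbers with its order.\<close>

lemma lex_less_iff: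
  assumes "snd p < B" "snd q < B"
  shows "lex_less p q \<longleftrightarrow> fst p * B + snd p < fst q * B + snd q"
proof -
  have less: "t * B + i < s * B + j" if "t < s" "i < B" for t s i j :: nat
  proof -
    have "t * B + i < Suc t * B" using that by simp
    also have "\<dots> \<le> s * B" using that by (intro mult_le_mono1) simp
    finally show ?thesis by simp
  qed
  show ?thesis
    using less[of "fst p" "fst q" "snd p" "snd q"] less[of "fst q" "fst p" "snd q" "snd p"] assms
    by (cases "fst p" "fst q" rule: linorder_cases) (auto simp: lex_less_def)
qed

definition iff_fm :: "('f, 'r) fm \<Rightarrow> ('f, 'r) fm \<Rightarrow> ('f, 'r) fm" where
  "iff_fm \<phi> \<psi> = Con (Neg (Con \<phi> (Neg \<psi>))) (Neg (Con \<psi> (Neg \<phi>)))"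

lemma holds_map:
  assumes "\<phi> \<in> fmlas L (length xs)"
  shows "sat M v (ren (\<lambda>i. f (xs ! i)) \<phi>) = holds M \<phi> (map (\<lambda>x. v (f x)) xs)"
  unfolding sat_ren holds_def by (rule sat_cong) (use assms in \<open>auto simp: fmlas_def\<close>)

text \<open>The array is an assignment to variables coded by \<open>prod_encode\<close>. Finitely
  many requirements mention finitely many pairs; these are placed by the block coding into a
  homogeneous set of indices for an arbitrary injective sequence. \<open>D\<close> keeps two entries
  apart, and indiscernibility spreads this to all pairs, which gives injectivity.\<close>

lemma indiscernible_array:
  fixes M :: "('f, 'r, 'u) fo_struct"
  assumes sat: "aleph1_saturated L M" and inf: "infinite (dom M)"
  shows "\<exists>c :: nat \<times> nat \<Rightarrow> 'u. range c \<subseteq> dom M \<and> inj c \<and> (\<forall>xs ys \<phi>. order_equivalent lex_less xs ys \<longrightarrow>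
    \<phi> \<in> fmlas L (length xs) \<longrightarrow> holds M \<phi> (map c xs) = holds M \<phi> (map c ys))"
proof -
  define \<T> where "\<T> = {(xs, ys, \<phi>). order_equivalent lex_less xs ys \<and> \<phi> \<in> fmlas L (length xs)}"
  define G :: "(nat \<times> nat) list \<times> (nat \<times> nat) list \<times> ('f, 'r) fm \<Rightarrow> ('f, 'r) fm" where
    "G = (\<lambda>(xs, ys, \<phi>). iff_fm (ren (\<lambda>i. prod_encode (xs ! i)) \<phi>) (ren (\<lambda>i. prod_encode (ys ! i)) \<phi>))"
  define D :: "('f, 'r) fm" where "D = Neg (Eql (Var (prod_encode (0, 0))) (Var (prod_encode (0, 1))))"
  have G: "sat M v (G (xs, ys, \<phi>)) \<longleftrightarrow> holds M \<phi> (map (\<lambda>x. v (prod_encode x)) xs) = holds M \<phi> (map (\<lambda>x. v (prod_encode x)) ys)"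
    if "(xs, ys, \<phi>) \<in> \<T>" for v xs ys \<phi>
  proof -
    have \<phi>: "\<phi> \<in> fmlas L (length xs)" "\<phi> \<in> fmlas L (length ys)"
      using that by (auto simp: \<T>_def order_equivalent_def)
    show ?thesis
      unfolding G_def iff_fm_def using holds_map[OF \<phi>(1), of M v prod_encode] holds_map[OF \<phi>(2), of M v prod_encode]
      by auto
  qed
  have "\<exists>v. range v \<subseteq> dom M \<and> (\<forall>\<phi>\<in>insert D (G ` \<T>). sat M v \<phi>)"
  proof (rule saturated_compactness[OF sat])
    show "dom M \<noteq> {}" using inf by auto
    show "wf_fm L \<phi>" if "\<phi> \<in> insert D (G ` \<T>)" for \<phi>
      using that by (auto simp: D_def G_def \<T>_def iff_fm_def wf_ren fmlas_def)
    fix \<Gamma>' assume \<Gamma>': "\<Gamma>' \<subseteq> insert D (G ` \<T>)" "finite \<Gamma>'"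
    then have "\<Gamma>' - {D} \<subseteq> G ` \<T>" "finite (\<Gamma>' - {D})" by auto
    then obtain \<T>' where \<T>': "\<T>' \<subseteq> \<T>" "finite \<T>'" "\<Gamma>' - {D} = G ` \<T>'"
      by (meson finite_subset_image)
    obtain d :: "nat \<Rightarrow> 'u" where d: "inj d" "range d \<subseteq> dom M"
      using infinite_countable_subset[OF inf] by blast
    define \<F> where "\<F> = (\<lambda>(xs, ys, \<phi>). (length xs, \<lambda>us. holds M \<phi> (map d us))) ` \<T>'"
    have "finite \<F>" using \<T>'(2) by (simp add: \<F>_def)
    from ramsey_lists[OF this] obtain H where H: "infinite H"
      "\<forall>(r, Q)\<in>\<F>. \<forall>us vs. length us = r \<and> set us \<subseteq> H \<and> set vs \<subseteq> H \<and>
        order_equivalent (<) us vs \<longrightarrow> Q us = Q vs" by (elim exE conjE) (rule that)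
    define P where "P = (\<Union>(xs, ys, \<phi>)\<in>\<T>'. set xs \<union> set ys)"
    have "finite (snd ` P)" using \<T>'(2) by (auto simp: P_def)
    then obtain B0 where B0: "snd ` P \<subseteq> {..<B0}" using finite_nat_iff_bounded by blast
    define B where "B = B0 + 2"
    have B: "snd p < B" if "p \<in> P" for p using B0 that by (auto simp: B_def)
    define g where "g q = enumerate H (fst q * B + snd q)" for q
    have gH: "g q \<in> H" for q unfolding g_def using H(1) by (rule enumerate_in_set)
    have mono: "strict_mono (enumerate H)" using H(1) by (rule strict_mono_enumerate)
    have g: "lex_less p q \<longleftrightarrow> g p < g q" if "p \<in> P" "q \<in> P" for p q
      unfolding g_def strict_mono_less[OF mono] using lex_less_iff B that by blast
    define v where "v x = d (g (prod_decode x))" for x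
    have "sat M v D"
    proof -
      have "g (0, 0) \<noteq> g (0, 1)" unfolding g_def using strict_mono_eq[OF mono] by simp
      then show ?thesis using d(1) by (simp add: D_def v_def inj_eq)
    qed
    moreover have "sat M v (G \<tau>)" if \<tau>: "\<tau> \<in> \<T>'" for \<tau>
    proof -
      obtain xs ys \<phi> where eq: "\<tau> = (xs, ys, \<phi>)" by (cases \<tau>)
      have oe: "order_equivalent lex_less xs ys" using \<tau> \<T>'(1) by (auto simp: eq \<T>_def)
      have sub: "set xs \<subseteq> P" "set ys \<subseteq> P" using \<tau> by (auto simp: P_def eq)
      have "order_equivalent (<) (map g xs) (map g ys)"
        unfolding order_equivalent_def length_map
      proof (intro conjI allI impI)
        show len: "length xs = length ys" using oe by (simp add: order_equivalent_def)
        fix i j assume ij: "i < length xs" "j < length xs"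
        have inP: "xs ! i \<in> P" "xs ! j \<in> P" "ys ! i \<in> P" "ys ! j \<in> P"
          using ij sub nth_mem len by (metis subsetD)+
        have "lex_less (xs ! i) (xs ! j) \<longleftrightarrow> lex_less (ys ! i) (ys ! j)"
          using oe ij by (simp add: order_equivalent_def)
        then show "map g xs ! i < map g xs ! j \<longleftrightarrow> map g ys ! i < map g ys ! j"
          using ij len g[OF inP(1,2)] g[OF inP(3,4)] by simp
      qed
      moreover have "(length xs, \<lambda>us. holds M \<phi> (map d us)) \<in> \<F>"
        unfolding \<F>_def using \<tau> eq by (auto intro!: image_eqI[of _ _ "(xs, ys, \<phi>)"])
      moreover have "set (map g xs) \<subseteq> H" "set (map g ys) \<subseteq> H" using gH by auto
      moreover have "(length xs, \<lambda>us. holds M \<phi> (map d us)) \<in> \<F> \<Longrightarrow> \<forall>us vs. length us = length xs \<and> set us \<subseteq> H \<and>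
          set vs \<subseteq> H \<and> order_equivalent (<) us vs \<longrightarrow> holds M \<phi> (map d us) = holds M \<phi> (map d vs)"
        using H(2) by fast
      ultimately have "holds M \<phi> (map d (map g xs)) = holds M \<phi> (map d (map g ys))"
        by (metis length_map)
      then show ?thesis
        using G[of xs ys \<phi> v] \<tau> \<T>'(1) by (auto simp: eq v_def comp_def)
    qed
    ultimately have "\<forall>\<phi>\<in>insert D (G ` \<T>'). sat M v \<phi>" by simp
    moreover have "\<Gamma>' \<subseteq> insert D (G ` \<T>')" unfolding \<T>'(3)[symmetric] by auto
    ultimately have "\<forall>\<phi>\<in>\<Gamma>'. sat M v \<phi>" by (meson subsetD)
    moreover have "range v \<subseteq> dom M" using d(2) by (auto simp: v_def)
    ultimately show "\<exists>v. range v \<subseteq> dom M \<and> (\<forall>\<phi>\<in>\<Gamma>'. sat M v \<phi>)" by blast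
  qed
  then obtain v where v: "range v \<subseteq> dom M" "sat M v D" "\<forall>\<tau>\<in>\<T>. sat M v (G \<tau>)" by auto
  define c where "c = (\<lambda>x. v (prod_encode x))"
  have ind: "holds M \<phi> (map c xs) = holds M \<phi> (map c ys)"
    if "order_equivalent lex_less xs ys" "\<phi> \<in> fmlas L (length xs)" for xs ys \<phi>
  proof -
    have "(xs, ys, \<phi>) \<in> \<T>" using that by (simp add: \<T>_def)
    with v(3) have "sat M v (G (xs, ys, \<phi>))" by blast
    with G[OF \<open>(xs, ys, \<phi>) \<in> \<T>\<close>] show ?thesis by (simp add: c_def)
  qed
  have "c p \<noteq> c q" if "lex_less p q" for p q
  proof -
    have oe: "order_equivalent lex_less [p, q] [(0, 0), (0, 1)]"
      using that by (auto simp: order_equivalent_def lex_less_def less_Suc_eq nth_Cons')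
    have "holds M (Eql (Var 0) (Var 1)) (map c [p, q]) = holds M (Eql (Var 0) (Var 1)) (map c [(0, 0), (0, 1)])"
      by (rule ind[OF oe]) (auto simp: fmlas_def)
    then show ?thesis using v(2) by (simp add: holds_def D_def c_def)
  qed
  then have "inj c" by (intro injI) (metis lex_less_def linorder_neqE_nat prod_eq_iff)
  moreover have "range c \<subseteq> dom M" using v(1) by (auto simp: c_def)
  ultimately show ?thesis using ind by blast
qed

text \<open>The parameters come from other rows, where lexicographic comparison with an entry of row
  \<open>t\<close> depends on the row numbers alone. Replacing entries of row \<open>t\<close> by
  others in the same order thus preserves the pattern of the whole list.\<close>

lemma rows_mutually_indiscernible:
  fixes c :: "nat \<times> nat \<Rightarrow> 'u"
  assumes c: "range c \<subseteq> dom M" "\<And>xs ys \<phi>. order_equivalent lex_less xs ys \<Longrightarrow>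
    \<phi> \<in> fmlas L (length xs) \<Longrightarrow> holds M \<phi> (map c xs) = holds M \<phi> (map c ys)"
  shows "mutually_indiscernible L M {} K (\<lambda>t i. [c (t, i)])"
  unfolding mutually_indiscernible_def indiscernible_def
proof (intro ballI conjI allI impI)
  fix t assume "t \<in> K"
  show "\<exists>l. \<forall>i. [c (t, i)] \<in> tuples M l" using c(1) by (intro exI[of _ 1]) (auto simp: tuples_def)
  fix ks js :: "nat list" and q
  assume ij: "sorted_wrt (<) ks \<and> sorted_wrt (<) js \<and> length ks = length js"
    and q: "q \<in> formulas_over L ({} \<union> (\<Union>s\<in>K - {t}. \<Union>i. set [c (s, i)])) (length (concat (map (\<lambda>i. [c (t, i)]) ks)))"
  obtain \<phi> e where qe: "q = (\<phi>, e)" by (cases q)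
  have cm: "concat (map (\<lambda>i. [c (t, i)]) ns) = map c (map (Pair t) ns)" for ns by (induction ns) auto
  have e: "set e \<subseteq> c ` {p. fst p \<noteq> t}" "\<phi> \<in> fmlas L (length ks + length e)"
    using q unfolding qe formulas_over_def cm by (auto, force)
  then have "e \<in> map c ` lists {p. fst p \<noteq> t}" unfolding lists_image[symmetric] by blast
  then obtain ps where ps: "\<forall>p\<in>set ps. fst p \<noteq> t" "e = map c ps" by blast
  have "order_equivalent lex_less (map (Pair t) ks @ ps) (map (Pair t) js @ ps)"
    unfolding order_equivalent_def
  proof (intro conjI allI impI)
    show "length (map (Pair t) ks @ ps) = length (map (Pair t) js @ ps)" using ij by simp
    fix i j assume i: "i < length (map (Pair t) ks @ ps)" and j: "j < length (map (Pair t) ks @ ps)"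
    have lt: "ks ! i < ks ! j \<longleftrightarrow> i < j" "js ! i < js ! j \<longleftrightarrow> i < j" if "i < length ks" "j < length ks"
      using that ij sorted_wrt_nth_less[of "(<)" ks] sorted_wrt_nth_less[of "(<)" js]
      by (metis linorder_neqE_nat order_less_asym)+
    have nt: "fst (ps ! (k - length js)) \<noteq> t" if "\<not> k < length js" "k < length js + length ps" for k
      using ps(1) that by (simp add: less_diff_conv2)
    show "lex_less ((map (Pair t) ks @ ps) ! i) ((map (Pair t) ks @ ps) ! j) \<longleftrightarrow>
      lex_less ((map (Pair t) js @ ps) ! i) ((map (Pair t) js @ ps) ! j)"
      using i j ij lt nt[of i] nt[of j]
      by (cases "i < length js"; cases "j < length js") (auto simp: nth_append lex_less_def)
  qed
  from c(2)[OF this, of \<phi>] e(2) ps(2)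
  have "holds M \<phi> (map c (map (Pair t) ks) @ e) = holds M \<phi> (map c (map (Pair t) js) @ e)" by simp
  then show "case q of (\<phi>, e) \<Rightarrow> holds M \<phi> (concat (map (\<lambda>i. [c (t, i)]) ks) @ e) \<longleftrightarrow>
      holds M \<phi> (concat (map (\<lambda>i. [c (t, i)]) js) @ e)"
    unfolding qe cm by simp
qed

section \<open>Bounding the number of colored solutions\<close>

text \<open>\<open>acl_dim\<close> counts spanning sets inside \<open>W\<close>, whereas
  \<open>B\<close> may lie outside; Steinitz for a basis of \<open>W\<close> bridges the
  difference.\<close>

lemma (in pregeometry) dim_le_span:
  assumes "finite W" "W \<subseteq> D" "finite B" "B \<subseteq> D" "W \<subseteq> cl B"
  shows "acl_dim cl W {} \<le> card B"
proof -
  obtain I where I: "I \<subseteq> W" "indep {} I" "W \<subseteq> cl ({} \<union> I)"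
    using basis_exists[OF assms(1,2), of "{}"] by blast
  have finI: "finite I" using I(1) assms(1) finite_subset by blast
  then have "acl_dim cl W {} = card I" using I by (intro dim_eq_card) auto
  also have "\<dots> \<le> card B"
    using assms I finI by (intro steinitz[of B "{}"]) auto
  finally show ?thesis .
qed

text \<open>As the sets may overlap, rank over \<open>b\<close> is compared with the number of
  points of the union. A new \<open>z\<close> meeting the old union in \<open>j \<ge> k\<close>
  points adds no rank. For \<open>j < k\<close> it adds at most \<open>k - j\<close> for
  \<open>n - j\<close> new points, and \<open>n * (k - j) \<le> k * (n - j)\<close> because
  \<open>k \<le> n\<close>.\<close>

lemma (in pregeometry) uniform_union_span:
  assumes \<Z>: "finite \<Z>" and b: "b \<in> D" and k: "k \<le> n"
    and z: "\<And>z. z \<in> \<Z> \<Longrightarrow> z \<subseteq> D \<and> card z = n \<and> finite z \<and> (\<forall>J\<subseteq>z. card J = k \<longrightarrow> z \<subseteq> cl (insert b J))"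
  shows "\<exists>B. finite B \<and> B \<subseteq> D \<and> \<Union>\<Z> \<subseteq> cl (insert b B) \<and> n * card B \<le> k * card (\<Union>\<Z>)"
  using \<Z> z
proof (induction \<Z>)
  case empty
  then show ?case by (intro exI[of _ "{}"]) auto
next
  case (insert z \<Z>)
  have zD: "z \<subseteq> D" "card z = n" "finite z" and
    zJ: "\<And>J. J \<subseteq> z \<Longrightarrow> card J = k \<Longrightarrow> z \<subseteq> cl (insert b J)" using insert.prems by blast+
  from insert obtain B where B: "finite B" "B \<subseteq> D" "\<Union>\<Z> \<subseteq> cl (insert b B)" "n * card B \<le> k * card (\<Union>\<Z>)"
    by (metis insertI2)
  let ?W = "\<Union>\<Z>"
  have finW: "finite ?W" using insert.hyps(1) insert.prems by auto
  have bB: "insert b B \<subseteq> cl (insert b B)" using b B(2) by (intro cl_ext) auto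
  have un: "card (z \<union> ?W) = card ?W + card (z - ?W)"
    using card_Un_disjoint[of ?W "z - ?W"] finW zD(3) by (simp add: Un_commute Int_Diff)
  show ?case
  proof (cases "k \<le> card (z \<inter> ?W)")
    case True
    then obtain J where J: "J \<subseteq> z \<inter> ?W" "card J = k" by (rule obtain_subset_with_card_n)
    have "J \<subseteq> cl (insert b B)" using J(1) B(3) by (meson Int_lower2 order_trans)
    then have "insert b J \<subseteq> cl (insert b B)" using bB by simp
    then have "cl (insert b J) \<subseteq> cl (insert b B)" by (rule cl_least)
    moreover have "z \<subseteq> cl (insert b J)" using J by (intro zJ) auto
    ultimately have "z \<subseteq> cl (insert b B)" by (rule order_trans[rotated])
    moreover have "k * card ?W \<le> k * card (z \<union> ?W)" using un by (intro mult_le_mono2) linarith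
    then have "n * card B \<le> k * card (z \<union> ?W)" using B(4) by (rule order_trans[rotated])
    ultimately show ?thesis using B by (intro exI[of _ B]) auto
  next
    case False
    let ?j = "card (z \<inter> ?W)"
    have ej: "card (z - ?W) = n - ?j" using zD by (simp add: card_Diff_subset_Int)
    have jn: "?j \<le> n" using zD card_mono[of z "z \<inter> ?W"] by auto
    have "k - ?j \<le> card (z - ?W)" using ej k by simp
    then obtain J where J: "J \<subseteq> z - ?W" "card J = k - ?j" "finite J" by (rule obtain_subset_with_card_n)
    have "card ((z \<inter> ?W) \<union> J) = ?j + (k - ?j)"
      using J finW by (subst card_Un_disjoint) auto
    then have cJ: "card ((z \<inter> ?W) \<union> J) = k" using False by simp
    let ?B = "B \<union> J"
    have BD: "insert b ?B \<subseteq> D" using b B(2) J(1) zD(1) by blast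
    have ext: "insert b ?B \<subseteq> cl (insert b ?B)" using BD by (rule cl_ext)
    have mono: "cl (insert b B) \<subseteq> cl (insert b ?B)" by (rule cl_mono) blast
    have "?W \<subseteq> cl (insert b ?B)" using B(3) mono by (rule order_trans)
    then have "insert b ((z \<inter> ?W) \<union> J) \<subseteq> cl (insert b ?B)" using ext by auto
    then have "cl (insert b ((z \<inter> ?W) \<union> J)) \<subseteq> cl (insert b ?B)" by (rule cl_least)
    moreover have "z \<subseteq> cl (insert b ((z \<inter> ?W) \<union> J))" using J(1) cJ by (intro zJ) auto
    ultimately have "\<Union>(insert z \<Z>) \<subseteq> cl (insert b ?B)" using B(3) mono by auto
    moreover have "n * card ?B \<le> k * card (\<Union>(insert z \<Z>))"
    proof -
      have "card ?B \<le> card B + (k - ?j)" using card_Un_le[of B J] J(2) by simp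
      then have "n * card ?B \<le> n * card B + n * (k - ?j)"
        by (metis add_mult_distrib2 mult_le_mono2)
      also have "n * (k - ?j) \<le> k * (n - ?j)"
      proof -
        have "k * ?j \<le> n * ?j" using k by simp
        then show ?thesis by (simp add: diff_mult_distrib2 mult.commute diff_le_mono2)
      qed
      finally show ?thesis using B(4) un ej by (simp add: distrib_left)
    qed
    ultimately show ?thesis using B(1) J(3) BD by (intro exI[of _ ?B]) auto
  qed
qed

lemma definable_const: "definable L C n (\<lambda>M as. b)"
  by (cases b) (simp_all add: definable_True definable_False)

lemma definable_colored: "i < n \<Longrightarrow> definable (add_pred L p) C n (\<lambda>M as. rint M p [as ! i])"
  by (rule definableI[of "Rel p [Var i]"]) (auto simp: fmlas_def holds_def add_pred_def)

lemma definable_add_pred: "definable L C n P \<Longrightarrow> definable (add_pred L p) C n P"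
  by (erule definable_lang_mono) (auto simp: add_pred_def)

context geometric_theory
begin

text \<open>That any \<open>k\<close> entries generate the tuple together with \<open>b\<close> is a
  list of dependences, and these persist under \<open>alg_transfer\<close>. Distinctness matches
  sets of entries with sets of positions of the same size. The outcome is an upper bound on
  dimension, as the later count of colored solutions uses.\<close>

lemma uniform_formula:
  assumes M: "M \<in> C" and z: "distinct z" "set z \<subseteq> dom M" "b \<in> dom M" "b \<notin> set z"
    and J: "\<And>J. J \<subseteq> set z \<Longrightarrow> card J = k \<Longrightarrow> set z \<subseteq> acl L M (insert b J)"
  shows "\<exists>F. definable L C (length z + 1) F \<and> F M (z @ [b]) \<and>
    (\<forall>N\<in>C. \<forall>z'\<in>tuples N (length z). \<forall>b'\<in>dom N. F N (z' @ [b']) \<longrightarrow>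
      distinct z' \<and> (\<forall>J\<subseteq>set z'. card J = k \<longrightarrow> set z' \<subseteq> acl L N (insert b' J)))"
proof -
  have d: "distinct (z @ [b])" "set [b] \<subseteq> dom M" using z by auto
  have "definable L C (length z + length [b]) (\<lambda>M as. True)" by (rule definable_True)
  from alg_transfer_definable[OF M z(2) d(2,1) this TrueI]
  obtain F where F: "definable L C (length z + length [b]) F" "F M (z @ [b])"
    "\<forall>N\<in>C. \<forall>d'\<in>tuples N (length z). \<forall>a'\<in>tuples N (length [b]). F N (d' @ a') \<longrightarrow>
      True \<and> distinct (d' @ a') \<and> alg_transfer M z [b] N d' a'"
    by (elim exE conjE) (rule that)
  have "distinct z' \<and> (\<forall>J\<subseteq>set z'. card J = k \<longrightarrow> set z' \<subseteq> acl L N (insert b' J))"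
    if N: "N \<in> C" "z' \<in> tuples N (length z)" "b' \<in> dom N" "F N (z' @ [b'])" for N z' b'
  proof -
    have "[b'] \<in> tuples N (length [b])" using N(3) by (simp add: tuples_def)
    with F(3) N have t: "distinct (z' @ [b'])" "alg_transfer M z [b] N z' [b']" by blast+
    have len: "length z' = length z" using N(2) by (simp add: tuples_def)
    have "x \<in> acl L N (insert b' J)" if J': "J \<subseteq> set z'" "card J = k" "x \<in> set z'" for J x
    proof -
      define I where "I = {i. i < length z \<and> z' ! i \<in> J}"
      have JI: "J = (!) z' ` I"
      proof
        show "J \<subseteq> (!) z' ` I"
        proof
          fix y assume y: "y \<in> J"
          then obtain i where "i < length z" "y = z' ! i" using J'(1) len by (metis in_set_conv_nth subsetD)
          with y show "y \<in> (!) z' ` I" by (auto simp: I_def)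
        qed
      qed (auto simp: I_def)
      have "card J = card I"
        unfolding JI using t(1) len by (intro card_image) (auto simp: inj_on_def I_def nth_eq_iff_index_eq)
      moreover have "card ((!) z ` I) = card I"
        using z(1) by (intro card_image) (auto simp: inj_on_def I_def nth_eq_iff_index_eq)
      ultimately have "set z \<subseteq> acl L M (insert b ((!) z ` I))"
        using J'(2) by (intro J) (auto simp: I_def)
      moreover have "(!) z ` I = set (nths z I)" "(!) z' ` I = set (nths z' I)"
        using len by (auto simp: set_nths' I_def)
      moreover obtain i where i: "x = z' ! i" "i < length z" using J'(3) len by (metis in_set_conv_nth)
      ultimately have "z ! i \<in> acl L M (set (nths z I) \<union> set [b])" by auto
      then have "z' ! i \<in> acl L N (set (nths z' I) \<union> set [b'])"
        using t(2) i(2) unfolding alg_transfer_def by blast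
      then show ?thesis using i(1) JI \<open>(!) z' ` I = set (nths z' I)\<close> by simp
    qed
    then show ?thesis using t(1) by auto
  qed
  with F(1,2) show ?thesis by (intro exI[of _ F]) simp
qed

text \<open>For the union \<open>?W\<close> of the tuples, \<open>\<delta> \<ge> 0\<close> gives
  \<open>\<alpha> * card ?W \<le> 1 + card B\<close>, while uniformity gives
  \<open>n * card B \<le> k * card ?W\<close>. Eliminating \<open>card B\<close> bounds
  \<open>card ?W\<close>, and the first entries are among the points of \<open>?W\<close>.\<close>

lemma rich_solution_bound:
  fixes R :: "('f, 'r, 'u) fo_struct"
  assumes R: "rich_model L T p \<alpha> R" and b: "b \<in> dom R" and k: "k \<le> n" "1 \<le> n" "real k < \<alpha> * n"
    and X: "finite X" "\<And>x. x \<in> X \<Longrightarrow> \<exists>z\<in>tuples R n. z ! 0 = x \<and> (\<forall>i<n. rint R p [z ! i]) \<and> distinct z \<and>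
      (\<forall>J\<subseteq>set z. card J = k \<longrightarrow> set z \<subseteq> acl L R (insert b J))"
  shows "real (card X) * (\<alpha> * n - k) \<le> n"
proof -
  have RC: "R \<in> C" using R by (simp add: rich_model_def C_eq)
  interpret pregeometry "dom R" "acl L R" by (rule acl_pregeometry[OF RC])
  have "\<forall>x\<in>X. \<exists>z. z \<in> tuples R n \<and> z ! 0 = x \<and> (\<forall>i<n. rint R p [z ! i]) \<and> distinct z \<and>
      (\<forall>J\<subseteq>set z. card J = k \<longrightarrow> set z \<subseteq> acl L R (insert b J))" using X(2) by blast
  from bchoice[OF this] obtain f where f: "\<forall>x\<in>X. f x \<in> tuples R n \<and> f x ! 0 = x \<and> (\<forall>i<n. rint R p [f x ! i]) \<and>
      distinct (f x) \<and> (\<forall>J\<subseteq>set (f x). card J = k \<longrightarrow> set (f x) \<subseteq> acl L R (insert b J))" ..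
  let ?Z = "(\<lambda>x. set (f x)) ` X" and ?W = "\<Union>x\<in>X. set (f x)"
  have len: "length (f x) = n" "set (f x) \<subseteq> dom R" if "x \<in> X" for x using f that by (auto simp: tuples_def)
  have XW: "X \<subseteq> ?W"
  proof
    fix x assume x: "x \<in> X"
    then have "f x ! 0 \<in> set (f x)" using len[OF x] k(2) by simp
    then show "x \<in> ?W" using f x by auto
  qed
  have finW: "finite ?W" using X(1) by simp
  have WD: "?W \<subseteq> dom R" using len by blast
  have colored: "rint R p [y]" if "y \<in> ?W" for y
    using that f len by (metis (no_types, lifting) UN_iff in_set_conv_nth)
  have "\<exists>B. finite B \<and> B \<subseteq> dom R \<and> \<Union>?Z \<subseteq> acl L R (insert b B) \<and> n * card B \<le> k * card (\<Union>?Z)"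
  proof (rule uniform_union_span[OF _ b k(1)])
    fix z assume "z \<in> ?Z"
    then obtain x where x: "x \<in> X" "z = set (f x)" by blast
    then have "card z = n" using f len distinct_card[of "f x"] by simp
    then show "z \<subseteq> dom R \<and> card z = n \<and> finite z \<and> (\<forall>J\<subseteq>z. card J = k \<longrightarrow> z \<subseteq> acl L R (insert b J))"
      using x f len by simp
  qed (use X(1) in simp)
  then obtain B where B: "finite B" "B \<subseteq> dom R" "?W \<subseteq> acl L R (insert b B)" "n * card B \<le> k * card ?W" by auto
  have "acl_dim (acl L R) ?W {} \<le> card (insert b B)"
    using finW WD B b by (intro dim_le_span) auto
  also have "\<dots> \<le> Suc (card B)" by (simp add: card_insert_if B(1))
  finally have dim: "acl_dim (acl L R) ?W {} \<le> Suc (card B)" .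
  have "delta L T p \<alpha> R ?W {} \<ge> 0"
    using R finW WD unfolding rich_model_def class_K_alpha_def by blast
  moreover have "{a \<in> ?W - {}. rint R p [a]} = ?W" using colored by auto
  ultimately have "\<alpha> * real (card ?W) \<le> real (acl_dim (acl L R) ?W {})"
    unfolding delta_def acl_forall_eq[OF RC] by simp
  then have "\<alpha> * real (card ?W) \<le> 1 + real (card B)" using dim by linarith
  then have "real n * (\<alpha> * real (card ?W)) \<le> real n * (1 + real (card B))" by (rule mult_left_mono) simp
  also have "\<dots> = n + real (n * card B)" by (simp add: distrib_left)
  also have "\<dots> \<le> n + real (k * card ?W)" using B(4) by (simp del: of_nat_mult)
  finally have "real (card ?W) * (\<alpha> * n - k) \<le> n" by (simp add: algebra_simps)
  moreover have "card X \<le> card ?W" using finW XW by (rule card_mono)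
  then have "real (card X) * (\<alpha> * n - k) \<le> real (card ?W) * (\<alpha> * n - k)"
    using k(3) by (intro mult_right_mono) auto
  ultimately show ?thesis by linarith
qed

text \<open>A single sentence that expresses \<open>P\<close> in all models of \<open>T\<close> and
  holds in all rich models is a member of \<open>T_alpha\<close>, hence true in
  \<open>M\<close>.\<close>

lemma T_alpha_transfer:
  assumes M: "models (add_pred L p) (T_alpha TYPE('u) L T p \<alpha>) M" "M \<in> C"
    and P: "definable (add_pred L p) C 0 P" "\<And>R. rich_model L T p \<alpha> R \<Longrightarrow> P R []"
  shows "P M []"
proof -
  obtain \<sigma> where \<sigma>: "\<sigma> \<in> sentences (add_pred L p)" "\<And>N. N \<in> C \<Longrightarrow> holds N \<sigma> [] \<longleftrightarrow> P N []"
    using P(1) by (rule definable_sentence) (rule that)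
  have "holds R \<sigma> []" if "rich_model L T p \<alpha> R" for R :: "('f, 'r, 'u) fo_struct"
    using \<sigma>(2) P(2)[OF that] that by (simp add: rich_model_def C_eq)
  then have "\<sigma> \<in> T_alpha TYPE('u) L T p \<alpha>" using \<sigma>(1) by (simp add: T_alpha_def)
  then have "holds M \<sigma> []" using M(1) by (simp add: models_def)
  then show ?thesis using \<sigma>(2)[OF M(2)] by simp
qed

text \<open>The configuration lives in the reduct, where \<open>M\<close> may color its points in
  any way. A recolored copy of \<open>M\<close>, with exactly the entries of the first
  \<open>m\<close> tuples colored, serves as the pattern; the extension axiom then returns some
  \<open>x\<close> in the role of \<open>b\<close> with tuples that really are colored in
  \<open>M\<close>.\<close>

lemma common_solution:
  assumes M: "M \<in> C" "T \<subseteq> sentences L" "(p, 1) \<notin> rels L" "aleph1_saturated L M"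
    and Ta: "models (add_pred L p) (T_alpha TYPE('u) L T p \<alpha>) M"
    and \<alpha>: "\<alpha> \<le> 1" "\<And>t. \<alpha> * real (length (z t)) \<le> k t + \<epsilon> t" "(\<Sum>t<m. \<epsilon> t) \<le> 1" "\<And>t. 0 \<le> \<epsilon> t" "0 < \<alpha>"
    and conf: "pregeometry.configuration (dom M) (acl L M) X b k z" and k: "\<And>t. 1 \<le> k t"
    and a: "distinct a" "set a \<subseteq> X"
    and P: "\<And>t. t < m \<Longrightarrow> definable L C (length (z t) + (1 + length a)) (P t)"
      "\<And>t. t < m \<Longrightarrow> P t M (z t @ b # a)"
  shows "\<exists>x\<in>dom M. \<forall>t<m. \<exists>z'\<in>tuples M (length (z t)). P t M (z' @ x # a) \<and>
    (\<forall>i<length (z t). rint M p [z' ! i])"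
proof -
  interpret pregeometry "dom M" "acl L M" by (rule acl_pregeometry[OF M(1)])
  note c = configurationD[OF conf]
  let ?Z = "\<Union>t<m. set (z t)"
  let ?S = "insert b ?Z"
  have aD: "set a \<subseteq> dom M" using a(2) c(1) by blast
  have SD: "?S \<subseteq> dom M" using c(2,5) by blast
  have trans: "x \<notin> acl L M (set a)" if xS: "x \<in> ?S" for x
  proof (cases "x = b")
    case True
    then show ?thesis using c(3) cl_mono[OF a(2)] by blast
  next
    case False
    then obtain t where "x \<in> set (z t)" using xS by blast
    then have "x \<notin> acl L M (insert b X)" by (rule configuration_notin_base[OF conf k])
    moreover have "acl L M (set a) \<subseteq> acl L M (insert b X)" using a(2) by (intro cl_mono) blast
    ultimately show ?thesis by blast
  qed
  have "finite ?S" by simp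
  then obtain U where U: "U \<subseteq> ?S" "indep (set a) U" "?S \<subseteq> acl L M (set a \<union> U)"
    using basis_exists[OF _ SD aD] by blast
  have "finite U" using U(1) by (rule finite_subset) simp
  then obtain us where us: "set us = U" "distinct us" using finite_distinct_list by blast
  have "finite (?S - U)" by simp
  then obtain ws where ws: "set ws = ?S - U" "distinct ws" using finite_distinct_list by blast
  define d where "d = us @ ws"
  have sd: "set (us @ ws) = ?S" using us ws U(1) by auto
  then have sd': "set d = ?S" by (simp add: d_def)
  have dis: "distinct ((us @ ws) @ a)"
  proof -
    have "set a \<subseteq> acl L M (set a)" using aD by (rule cl_ext)
    then have "?S \<inter> set a = {}" using trans by blast
    then have "set (us @ ws) \<inter> set a = {}" unfolding sd .
    moreover have "distinct (us @ ws)" using us ws by auto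
    ultimately show ?thesis using a(1) by (simp only: distinct_append)
  qed
  \<comment> \<open>Putting a basis in front scatters the entries of the tuples over
    \<open>d\<close>; \<open>pos\<close> finds them again, so that each \<open>P t\<close> can be
    read at the right arguments.\<close>
  define pos where "pos y = (SOME i. i < length d \<and> d ! i = y)" for y
  have pos: "pos y < length d \<and> d ! pos y = y" if "y \<in> ?S" for y
    unfolding pos_def by (rule someI_ex) (use that in \<open>simp only: sd'[symmetric] in_set_conv_nth\<close>)
  let ?ix = "\<lambda>t. map pos (z t) @ pos b # block (length d) (length a)"
  let ?P = "\<lambda>M as. \<forall>t\<in>{..<m}. P t M (map ((!) as) (?ix t))"
  have zS: "set (z t) \<subseteq> ?S" if "t < m" for t using that by blast
  have Pdef: "definable L C (length d + length a) ?P"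
  proof (rule definable_ball)
    fix t assume "t \<in> {..<m}"
    then have t: "t < m" by simp
    show "definable L C (length d + length a) (\<lambda>M as. P t M (map ((!) as) (?ix t)))"
    proof (rule definable_map[OF P(1)[OF t]])
      show "length (?ix t) = length (z t) + (1 + length a)" by simp
      have "pos y < length d + length a" if "y \<in> ?S" for y using pos[OF that] by simp
      then show "set (?ix t) \<subseteq> {..<length d + length a}" using zS[OF t] by auto
    qed (rule refl)
  qed simp
  have PM: "?P M (d @ a)"
  proof
    fix t assume "t \<in> {..<m}"
    then have t: "t < m" by simp
    have dp: "(d @ a) ! pos y = y" if "y \<in> ?S" for y using pos[OF that] by (simp add: nth_append)
    have "map (\<lambda>y. (d @ a) ! pos y) (z t) = z t"
      using dp zS[OF t] by (intro map_idI) blast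
    then have "map ((!) (d @ a)) (map pos (z t)) = z t" by (simp add: comp_def)
    moreover have "map ((!) (d @ a)) (block (length d) (length a)) = a" by simp
    ultimately have "map ((!) (d @ a)) (?ix t) = z t @ b # a" using dp[of b] by simp
    then show "P t M (map ((!) (d @ a)) (?ix t))" using P(2)[OF t] by simp
  qed
  have "\<exists>\<Theta>. definable L C (length a) \<Theta> \<and> \<Theta> M a \<and>
    (\<forall>R. rich_model L T p \<alpha> R \<longrightarrow> (\<forall>b\<in>tuples R (length a). \<Theta> R b \<longrightarrow>
      (\<exists>e\<in>tuples R (length (us @ ws)). ?P R (e @ b) \<and>
        (\<forall>i<length (us @ ws). rint R p [e ! i] \<longleftrightarrow> (us @ ws) ! i \<in> ?Z))))"
  proof (rule rich_extension_formula[OF M(1-3) \<alpha>(5) dis])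
    show "\<alpha> * real (card (A \<inter> ?Z)) \<le> real (acl_dim (acl L M) A Y)"
      if "finite A" "A \<subseteq> dom M" "Y \<subseteq> set a" for A Y
      using that a(2) by (intro configuration_dim[OF conf k \<alpha>(1-5)]) auto
    show "definable L C (length (us @ ws) + length a) ?P" using Pdef by (simp add: d_def)
    show "?P M ((us @ ws) @ a)" using PM by (simp add: d_def)
    show "set (us @ ws) \<subseteq> dom M" "set (us @ ws) \<subseteq> acl L M (set a \<union> set us)"
      unfolding sd us(1) using SD U(3) by blast+
    show "x \<notin> acl L M (set a)" if "x \<in> set (us @ ws)" for x using trans that unfolding sd by blast
    show "indep (set a) (set us)" using U(2) us(1) by simp
  qed (fact aD M(4))+
  then obtain \<Theta> where \<Theta>: "definable L C (length a) \<Theta>" "\<Theta> M a"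
    "\<forall>R. rich_model L T p \<alpha> R \<longrightarrow> (\<forall>b\<in>tuples R (length a). \<Theta> R b \<longrightarrow>
      (\<exists>e\<in>tuples R (length d). ?P R (e @ b) \<and> (\<forall>i<length d. rint R p [e ! i] \<longleftrightarrow> d ! i \<in> ?Z)))"
    unfolding d_def[symmetric] by (elim exE conjE) (rule that)
  let ?Lp = "add_pred L p"
  let ?E = "\<lambda>M as. ?P M as \<and> (\<forall>i\<in>{..<length d}. rint M p [as ! i] \<longleftrightarrow> d ! i \<in> ?Z)"
  \<comment> \<open>A sentence has no parameters, so \<open>a\<close> is replaced by all tuples
    satisfying \<open>\<Theta>\<close>, and \<open>\<Theta> M a\<close> is used only after the
    transfer.\<close>
  let ?B = "\<lambda>M as. \<Theta> M as \<longrightarrow> (\<exists>e\<in>tuples M (length d). ?E M (e @ as))"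
  have "definable ?Lp C (length d + length a) ?E"
    by (intro definable_conj definable_add_pred[OF Pdef] definable_ball definable_iff definable_colored definable_const)
      auto
  then have "definable ?Lp C (length a) (\<lambda>M as. \<exists>e\<in>tuples M (length d). ?E M (e @ as))"
    by (rule definable_ex_tuple[where P = ?E])
  then have "definable ?Lp C (length a + 0) ?B"
    using \<Theta>(1) by (simp only: add_0_right definable_imp definable_add_pred)
  then have def: "definable ?Lp C 0 (\<lambda>M as. \<forall>xs\<in>tuples M (length a). ?B M (xs @ as))"
    by (rule definable_all_tuple[where P = ?B])
  have "\<forall>xs\<in>tuples M (length a). ?B M (xs @ [])"
  proof (rule T_alpha_transfer[OF Ta M(1) def])
    fix R :: "('f, 'r, 'u) fo_struct" assume R: "rich_model L T p \<alpha> R"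
    show "\<forall>xs\<in>tuples R (length a). ?B R (xs @ [])"
    proof (intro ballI impI)
      fix xs assume xs: "xs \<in> tuples R (length a)" "\<Theta> R (xs @ [])"
      then obtain e where e: "e \<in> tuples R (length d)" "?P R (e @ xs)"
        "\<forall>i<length d. rint R p [e ! i] \<longleftrightarrow> d ! i \<in> ?Z"
        using \<Theta>(3)[rule_format, OF R, of xs] by auto
      have "(e @ xs) ! i = e ! i" if "i < length d" for i using that e(1) by (simp add: nth_append tuples_def)
      then show "\<exists>e\<in>tuples R (length d). ?E R (e @ xs @ [])" using e by (intro bexI[of _ e]) auto
    qed
  qed
  then have "?B M a" using aD by (auto simp: tuples_def)
  then obtain e where e: "e \<in> tuples M (length d)" "?E M (e @ a)" using \<Theta>(2) by blast
  have le: "length e = length d" "set e \<subseteq> dom M" using e(1) by (auto simp: tuples_def)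
  have epos: "(e @ a) ! pos y = e ! pos y" "e ! pos y \<in> dom M" if "y \<in> ?S" for y
    using pos[OF that] le by (auto simp: nth_append)
  show ?thesis
  proof (intro bexI[of _ "e ! pos b"] allI impI)
    show "e ! pos b \<in> dom M" using epos(2) by simp
    fix t assume t: "t < m"
    let ?z = "map (\<lambda>y. e ! pos y) (z t)"
    show "\<exists>z'\<in>tuples M (length (z t)). P t M (z' @ e ! pos b # a) \<and> (\<forall>i<length (z t). rint M p [z' ! i])"
    proof (intro bexI[of _ ?z] conjI allI impI)
      show "?z \<in> tuples M (length (z t))" using epos(2) zS[OF t] by (auto simp: tuples_def)
      have "map ((!) (e @ a)) (map pos (z t)) = ?z" using epos(1) zS[OF t] by auto
      moreover have "map ((!) (e @ a)) (block (length d) (length a)) = a" using le by simp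
      ultimately have eq: "map ((!) (e @ a)) (?ix t) = ?z @ e ! pos b # a" using epos(1)[of b] by simp
      have "P t M (map ((!) (e @ a)) (?ix t))" using e(2) t by blast
      then show "P t M (?z @ e ! pos b # a)" unfolding eq .
      fix i assume i: "i < length (z t)"
      let ?y = "z t ! i"
      have y: "?y \<in> ?S" "?y \<in> ?Z" using i t nth_mem by blast+
      have "rint M p [(e @ a) ! pos ?y] \<longleftrightarrow> d ! pos ?y \<in> ?Z" using e(2) pos[OF y(1)] by simp
      then show "rint M p [?z ! i]" using pos[OF y(1)] epos(1)[OF y(1)] y(2) i by simp
    qed
  qed
qed

end

section \<open>From rich models to the monster model\<close>

lemma fmlas_add_pred: "fmlas L n \<subseteq> fmlas (add_pred L p) n"
  by (rule fmlas_lang_mono) (auto simp: add_pred_def)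

lemma aleph1_saturated_reduct: "aleph1_saturated (add_pred L p) M \<Longrightarrow> aleph1_saturated L M"
  unfolding aleph1_saturated_def
proof (intro allI impI, elim conjE)
  fix A n \<Sigma>
  assume *: "\<forall>A n \<Sigma>. A \<subseteq> dom M \<and> countable A \<and> \<Sigma> \<subseteq> formulas_over (add_pred L p) A n \<and>
        (\<forall>\<Sigma>'. \<Sigma>' \<subseteq> \<Sigma> \<and> finite \<Sigma>' \<longrightarrow> (\<exists>b\<in>tuples M n. realizes M \<Sigma>' b)) \<longrightarrow> (\<exists>b\<in>tuples M n. realizes M \<Sigma> b)"
    and \<Sigma>: "A \<subseteq> dom M" "countable A" "\<Sigma> \<subseteq> formulas_over L A n"
      "\<forall>\<Sigma>'. \<Sigma>' \<subseteq> \<Sigma> \<and> finite \<Sigma>' \<longrightarrow> (\<exists>b\<in>tuples M n. realizes M \<Sigma>' b)"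
  have "formulas_over L A n \<subseteq> formulas_over (add_pred L p) A n"
    unfolding formulas_over_def using fmlas_add_pred[of L _ p] by auto
  with \<Sigma>(3) have "\<Sigma> \<subseteq> formulas_over (add_pred L p) A n" by (rule order_trans)
  then show "\<exists>b\<in>tuples M n. realizes M \<Sigma> b"
    using \<Sigma> by (intro *[THEN spec, THEN spec, THEN spec, THEN mp, of A \<Sigma> n] conjI)
qed

lemma order_equivalent_pair:
  "lex_less x y \<Longrightarrow> lex_less x' y' \<Longrightarrow> order_equivalent lex_less [x, y] [x', y']"
  by (auto simp: order_equivalent_def lex_less_def less_Suc_eq nth_Cons')

lemma sum_half_powers: "(\<Sum>t<m. (1 / 2 :: real) ^ Suc t) \<le> 1"
proof -
  have "(\<Sum>t<m. (1 / 2 :: real) ^ Suc t) = 1 - (1 / 2) ^ m" by (induction m) auto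
  then show ?thesis by simp
qed

context geometric_theory
begin

lemma T_alpha_models:
  assumes "models (add_pred L p) (T_alpha TYPE('u) L T p \<alpha>) M" "T \<subseteq> sentences L"
  shows "M \<in> C"
proof -
  have "\<sigma> \<in> T_alpha TYPE('u) L T p \<alpha>" if "\<sigma> \<in> T" for \<sigma>
  proof -
    have "\<sigma> \<in> fmlas L 0" using that assms(2) by (auto simp: sentences_def fmlas_def)
    then have "\<sigma> \<in> sentences (add_pred L p)"
      using fmlas_add_pred[of L 0 p] by (auto simp: sentences_def fmlas_def)
    then show ?thesis using that by (auto simp: T_alpha_def rich_model_def models_def)
  qed
  moreover have "is_struct L M" using assms(1) by (simp add: models_def is_struct_def add_pred_def)
  ultimately show ?thesis using assms(1) unfolding C_eq models_def by blast
qed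

text \<open>Of the colored tuple only the first entry is kept: it is what the order locates in an
  interval and what is counted in the end.\<close>

definition solution ::
  "'r \<Rightarrow> nat \<Rightarrow> (('f, 'r, 'u) fo_struct \<Rightarrow> 'u list \<Rightarrow> bool) \<Rightarrow> ('f, 'r, 'u) fo_struct \<Rightarrow> 'u \<Rightarrow> 'u \<Rightarrow> bool" where
  "solution p n F M b x \<longleftrightarrow> (\<exists>z\<in>tuples M n. z ! 0 = x \<and> F M (z @ [b]) \<and> (\<forall>i\<in>{..<n}. rint M p [z ! i]))"

lemma definable_solution:
  assumes F: "definable L C (n + 1) F" and n: "1 \<le> n"
  shows "definable (add_pred L p) C 2 (\<lambda>M as. solution p n F M (as ! 0) (as ! 1))"
proof -
  let ?B = "\<lambda>M as. as ! 0 = as ! (n + 1) \<and> F M (take (n + 1) as) \<and> (\<forall>i\<in>{..<n}. rint M p [as ! i])"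
  have "definable (add_pred L p) C (n + 2) ?B"
  proof (intro definable_conj definable_ball)
    show "definable (add_pred L p) C (n + 2) (\<lambda>M as. as ! 0 = as ! (n + 1))" by (rule definable_eq) auto
    show "definable (add_pred L p) C (n + 2) (\<lambda>M as. F M (take (n + 1) as))"
      using definable_take[OF definable_add_pred[OF F], of p 1] by simp
    show "definable (add_pred L p) C (n + 2) (\<lambda>M as. rint M p [as ! i])" if "i \<in> {..<n}" for i
      using that by (intro definable_colored) simp
  qed simp
  then have "definable (add_pred L p) C 2 (\<lambda>M as. \<exists>z\<in>tuples M n. ?B M (z @ as))"
    by (rule definable_ex_tuple[where P = ?B])
  then show ?thesis
  proof (rule iffD1[OF definable_cong, rotated])
    fix M :: "('f, 'r, 'u) fo_struct" and as assume "as \<in> tuples M 2"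
    then obtain b x where as: "as = [b, x]" by (auto simp: tuples_def length_Suc_conv numeral_2_eq_2)
    have "?B M (z @ as) \<longleftrightarrow> z ! 0 = x \<and> F M (z @ [b]) \<and> (\<forall>i\<in>{..<n}. rint M p [z ! i])" if "z \<in> tuples M n" for z
      using that n by (auto simp: as tuples_def nth_append)
    then show "(\<exists>z\<in>tuples M n. ?B M (z @ as)) \<longleftrightarrow> solution p n F M (as ! 0) (as ! 1)"
      unfolding solution_def as by auto
  qed
qed

text \<open>The bound for rich models is the same for all parameters \<open>b\<close>. That no
  parameter has \<open>m\<close> distinct solutions, for one \<open>m\<close> beyond this bound, is
  therefore a single sentence and passes to \<open>M\<close>.\<close>

lemma finitely_many_solutions:
  assumes M: "models (add_pred L p) (T_alpha TYPE('u) L T p \<alpha>) M" "M \<in> C"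
    and F: "definable L C (n + 1) F" "\<forall>N\<in>C. \<forall>z\<in>tuples N n. \<forall>b\<in>dom N. F N (z @ [b]) \<longrightarrow>
      distinct z \<and> (\<forall>J\<subseteq>set z. card J = k \<longrightarrow> set z \<subseteq> acl L N (insert b J))"
    and k: "k \<le> n" "1 \<le> n" "real k < \<alpha> * n" and b: "b \<in> dom M"
  shows "finite {x\<in>dom M. solution p n F M b x}"
proof (rule ccontr)
  assume inf: "infinite {x\<in>dom M. solution p n F M b x}"
  obtain m :: nat where m: "real n < real m * (\<alpha> * n - k)"
    using reals_Archimedean3[of "\<alpha> * n - k"] k(3) by auto
  let ?Q = "\<lambda>M as. \<not> (distinct (tl as) \<and> (\<forall>i\<in>{..<m}. solution p n F M (as ! 0) (as ! Suc i)))"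
  have "definable (add_pred L p) C (Suc m) ?Q"
  proof (intro definable_not definable_conj definable_ball)
    show "definable (add_pred L p) C (Suc m) (\<lambda>M as. distinct (tl as))"
      by (rule definable_map[OF definable_distinct, of "block 1 m"]) (auto simp: drop_Suc)
    show "definable (add_pred L p) C (Suc m) (\<lambda>M as. solution p n F M (as ! 0) (as ! Suc i))"
      if "i \<in> {..<m}" for i
    proof -
      have "definable (add_pred L p) C (Suc m)
          (\<lambda>M as. solution p n F M (map ((!) as) [0, Suc i] ! 0) (map ((!) as) [0, Suc i] ! 1))"
        by (rule definable_map[OF definable_solution[OF F(1) k(2)], of "[0, Suc i]"]) (use that in auto)
      then show ?thesis by simp
    qed
  qed simp
  then have "definable (add_pred L p) C (Suc m + 0) ?Q" by simp
  then have def: "definable (add_pred L p) C 0 (\<lambda>M as. \<forall>xs\<in>tuples M (Suc m). ?Q M (xs @ as))"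
    by (rule definable_all_tuple[where P = ?Q])
  have "\<forall>xs\<in>tuples M (Suc m). ?Q M (xs @ [])"
  proof (rule T_alpha_transfer[OF M def])
    fix R :: "('f, 'r, 'u) fo_struct" assume R: "rich_model L T p \<alpha> R"
    have RC: "R \<in> C" using R by (simp add: rich_model_def C_eq)
    show "\<forall>xs\<in>tuples R (Suc m). ?Q R (xs @ [])"
    proof (intro ballI notI, elim conjE)
      fix as assume as: "as \<in> tuples R (Suc m)" "distinct (tl (as @ []))"
        and s: "\<forall>i\<in>{..<m}. solution p n F R ((as @ []) ! 0) ((as @ []) ! Suc i)"
      obtain b xs where bx: "as = b # xs" "length xs = m" "b \<in> dom R" "set xs \<subseteq> dom R"
        using as(1) by (cases as) (auto simp: tuples_def)
      have "real (card (set xs)) * (\<alpha> * n - k) \<le> n"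
      proof (rule rich_solution_bound[OF R bx(3) k])
        fix x assume "x \<in> set xs"
        then obtain i where "i < m" "x = xs ! i" using bx(2) by (metis in_set_conv_nth)
        then have "solution p n F R b x" using s bx(1) by simp
        then obtain z where z: "z \<in> tuples R n" "z ! 0 = x" "F R (z @ [b])" "\<forall>i\<in>{..<n}. rint R p [z ! i]"
          unfolding solution_def by blast
        then show "\<exists>z\<in>tuples R n. z ! 0 = x \<and> (\<forall>i<n. rint R p [z ! i]) \<and> distinct z \<and>
            (\<forall>J\<subseteq>set z. card J = k \<longrightarrow> set z \<subseteq> acl L R (insert b J))"
          using F(2)[rule_format, OF RC z(1) bx(3) z(3)] by (intro bexI[of _ z]) auto
      qed simp
      moreover have "card (set xs) = m" using as(2) bx distinct_card[of xs] by simp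
      ultimately show False using m by simp
    qed
  qed
  moreover obtain X where X: "X \<subseteq> {x\<in>dom M. solution p n F M b x}" "finite X" "card X = m"
    using infinite_arbitrarily_large[OF inf] by blast
  then obtain xs where xs: "set xs = X" "distinct xs" "length xs = m"
    using finite_distinct_list distinct_card by metis
  have "b # xs \<in> tuples M (Suc m)" using xs X b by (auto simp: tuples_def)
  ultimately have "?Q M (b # xs)" by (metis append_Nil2)
  moreover have "solution p n F M b (xs ! i)" if "i < m" for i
    using xs X(1) that nth_mem by blast
  ultimately show False using xs(2) by simp
qed

end

theorem theorem4p0p25:
  fixes L :: "('f, 'r) lang" and T :: "('f, 'r) fm set" and p :: 'r and \<alpha> :: real
    and \<MM> :: "('f, 'r, 'u) fo_struct"
  assumes "countable_lang L"
    and "complete_theory TYPE('u) L T"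
    and "no_finite_models TYPE('u) L T"
    and "quantifier_elimination TYPE('u) L T"
    and "geometric TYPE('u) L T"
    and "indecomposable TYPE('u) L T"
    and "free_amalgamation TYPE('u) L T"
    and "(p, 1) \<notin> rels L"
    and "0 < \<alpha>" and "\<alpha> \<le> 1"
    and "monster_model (add_pred L p) (T_alpha TYPE('u) L T p \<alpha>) \<MM>"
    and "defines_linear_order TYPE('u) L T"
    and "\<alpha> \<notin> \<rat>"
  shows "\<not> strongly_dependent (add_pred L p) \<MM>"
proof
  assume sd: "strongly_dependent (add_pred L p) \<MM>"
  let ?Lp = "add_pred L p"
  define C :: "('f, 'r, 'u) fo_struct set" where "C = {M. models L T M}"
  interpret geometric_theory L T C
    by unfold_locales (use assms C_def in auto)
  have TS: "T \<subseteq> sentences L" using assms(2) by (simp add: complete_theory_def)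
  have Ta: "models ?Lp (T_alpha TYPE('u) L T p \<alpha>) \<MM>" and satp: "aleph1_saturated ?Lp \<MM>"
    using assms(11) by (simp_all add: monster_model_def)
  have MC: "\<MM> \<in> C" by (rule T_alpha_models[OF Ta TS])
  have sat: "aleph1_saturated L \<MM>" using satp by (rule aleph1_saturated_reduct)
  have inf: "infinite (dom \<MM>)" using assms(3) MC by (auto simp: no_finite_models_def C_def)
  interpret pregeometry "dom \<MM>" "acl L \<MM>" by (rule acl_pregeometry[OF MC])
  obtain c :: "nat \<times> nat \<Rightarrow> 'u" where c: "range c \<subseteq> dom \<MM>" "inj c"
    and ind: "\<forall>xs ys \<phi>. order_equivalent lex_less xs ys \<longrightarrow> \<phi> \<in> fmlas ?Lp (length xs) \<longrightarrow>
      holds \<MM> \<phi> (map c xs) = holds \<MM> \<phi> (map c ys)"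
    using indiscernible_array[OF satp inf] by (elim exE conjE) (rule that)
  have cD: "c q \<in> dom \<MM>" for q using c(1) by blast
  have indP: "P \<MM> (map c xs) \<longleftrightarrow> P \<MM> (map c ys)"
    if dP: "definable ?Lp C (length xs) P" and oe: "order_equivalent lex_less xs ys" for P xs ys
  proof -
    obtain \<phi> where \<phi>: "\<phi> \<in> fmlas ?Lp (length xs)"
      "\<And>M as. M \<in> C \<Longrightarrow> as \<in> tuples M (length xs) \<Longrightarrow> holds M \<phi> as \<longleftrightarrow> P M as"
      using dP by (rule definableE) (rule that)
    have "map c xs \<in> tuples \<MM> (length xs)" "map c ys \<in> tuples \<MM> (length xs)"
      using cD oe by (auto simp: tuples_def order_equivalent_def)
    then have "holds \<MM> \<phi> (map c xs) \<longleftrightarrow> P \<MM> (map c xs)" "holds \<MM> \<phi> (map c ys) \<longleftrightarrow> P \<MM> (map c ys)"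
      using \<phi>(2)[OF MC] by blast+
    then show ?thesis using ind[rule_format, OF oe \<phi>(1)] by simp
  qed

  obtain lo where lo: "lo \<in> fmlas L 2" "\<forall>M :: ('f, 'r, 'u) fo_struct. models L T M \<longrightarrow>
      linear_order_on (dom M) {(a, b). a \<in> dom M \<and> b \<in> dom M \<and> holds M lo [a, b]}"
    using assms(12) unfolding defines_linear_order_def by (elim bexE) (rule that)
  define le where "le M x y \<longleftrightarrow> holds M lo [x, y]" for M :: "('f, 'r, 'u) fo_struct" and x y
  \<comment> \<open>Symmetric in the endpoints, so that it is a formula whether the array increases
    or decreases.\<close>
  define btw where "btw M x y1 y2 \<longleftrightarrow> x \<noteq> y1 \<and> x \<noteq> y2 \<and> (le M y1 x \<and> le M x y2 \<or> le M y2 x \<and> le M x y1)"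
    for M :: "('f, 'r, 'u) fo_struct" and x y1 y2
  have def_le: "definable L C n (\<lambda>M as. le M (as ! i) (as ! j))" if "i < n" "j < n" for i j n
    unfolding le_def by (rule definable_map[OF definable_holds[OF lo(1)], of "[i, j]"]) (use that in auto)
  have def_btw: "definable L C n (\<lambda>M as. btw M (as ! h) (as ! i) (as ! j))" if "h < n" "i < n" "j < n" for h i j n
    unfolding btw_def
    by (intro definable_conj definable_disj definable_not definable_eq def_le that)
  have lin: "linear_order_on (dom \<MM>) {(a, b). a \<in> dom \<MM> \<and> b \<in> dom \<MM> \<and> le \<MM> a b}"
    using lo(2) MC by (simp add: C_def le_def)
  \<comment> \<open>By indiscernibility the array is increasing or decreasing as a whole;
    \<open>le'\<close> reverses the order in the second case.\<close>
  define u where "u = le \<MM> (c (0, 0)) (c (0, 1))"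
  define le' where "le' x y = (if u then le \<MM> x y else le \<MM> y x)" for x y
  have le'_trans: "le' x w" if "le' x y" "le' y w" "x \<in> dom \<MM>" "y \<in> dom \<MM>" "w \<in> dom \<MM>" for x y w
    using lin that unfolding order_on_defs trans_def le'_def by (auto split: if_splits)
  have le'_antisym: "x = y" if "le' x y" "le' y x" "x \<in> dom \<MM>" "y \<in> dom \<MM>" for x y
    using lin that unfolding order_on_defs antisym_def le'_def by (auto split: if_splits)
  have le'_c: "le' (c x) (c y)" if xy: "lex_less x y" for x y
  proof -
    have "order_equivalent lex_less [x, y] [(0, 0), (0, 1)]"
      using xy by (rule order_equivalent_pair) (simp add: lex_less_def)
    from indP[OF _ this, of "\<lambda>M as. le M (as ! 0) (as ! 1)"]
    have "le \<MM> (c x) (c y) \<longleftrightarrow> u" by (simp add: u_def definable_add_pred[OF def_le])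
    moreover have "c x \<noteq> c y" using xy c(2) by (auto simp: inj_eq lex_less_def)
    then have "le \<MM> (c x) (c y) \<or> le \<MM> (c y) (c x)"
      using lin cD unfolding order_on_defs total_on_def by auto
    ultimately show ?thesis by (auto simp: le'_def)
  qed
  have c_neq: "c x \<noteq> c y" if "lex_less x y" for x y using that c(2) by (auto simp: inj_eq lex_less_def)
  have btw_iff: "btw \<MM> w (c x) (c y) \<longleftrightarrow> w \<noteq> c x \<and> w \<noteq> c y \<and> le' (c x) w \<and> le' w (c y)"
    if xy: "lex_less x y" and w: "w \<in> dom \<MM>" for w x y
  proof -
    have "\<not> (le' (c y) w \<and> le' w (c x))"
      using le'_trans[of "c y" w "c x"] le'_antisym[OF le'_c[OF xy]] c_neq[OF xy] cD w by blast
    then show ?thesis unfolding btw_def le'_def by (auto split: if_splits)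
  qed

  \<comment> \<open>The interval from \<open>c (t, 0)\<close> to \<open>c (t, Suc (Suc m))\<close>
    contains \<open>Suc m\<close> entries of the row. Indiscernibility transfers the existence of
    that many points to the interval ending at \<open>c (t, 1)\<close>, which supposedly has only
    \<open>m\<close>.\<close>
  have inf_btw: "infinite {x\<in>dom \<MM>. btw \<MM> x (c (t, 0)) (c (t, 1))}" for t
  proof
    let ?S = "{x\<in>dom \<MM>. btw \<MM> x (c (t, 0)) (c (t, 1))}"
    assume fin: "finite ?S"
    define m where "m = card ?S"
    let ?B = "\<lambda>M as. distinct (take (Suc m) as) \<and> (\<forall>i\<in>{..<Suc m}. btw M (as ! i) (as ! Suc m) (as ! Suc (Suc m)))"
    let ?G = "\<lambda>M as. \<exists>xs\<in>tuples M (Suc m). ?B M (xs @ as)"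
    have "definable L C (Suc m + 2) ?B"
      by (intro definable_conj definable_ball def_btw definable_take definable_distinct) auto
    then have "definable L C 2 ?G" by (rule definable_ex_tuple[where P = ?B])
    then have defG: "definable ?Lp C 2 ?G" by (rule definable_add_pred)
    have B: "?B \<MM> (xs @ [y1, y2]) \<longleftrightarrow> distinct xs \<and> (\<forall>i<Suc m. btw \<MM> (xs ! i) y1 y2)"
      if "xs \<in> tuples \<MM> (Suc m)" for xs y1 y2
      using that by (auto simp: tuples_def nth_append)
    have l: "lex_less (t, 0) (t, 1)" "lex_less (t, 0) (t, Suc (Suc m))" by (simp_all add: lex_less_def)
    have "?G \<MM> [c (t, 0), c (t, Suc (Suc m))]"
    proof (intro bexI)
      let ?xs = "map (\<lambda>i. c (t, Suc i)) [0..<Suc m]"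
      show xs: "?xs \<in> tuples \<MM> (Suc m)" using cD by (auto simp: tuples_def)
      have "distinct ?xs" using c(2) by (auto simp: distinct_map inj_on_def simp del: upt_Suc)
      moreover have "btw \<MM> (?xs ! i) (c (t, 0)) (c (t, Suc (Suc m)))" if i: "i < Suc m" for i
      proof -
        have "lex_less (t, 0) (t, Suc i)" "lex_less (t, Suc i) (t, Suc (Suc m))" using i by (simp_all add: lex_less_def)
        then have "btw \<MM> (c (t, Suc i)) (c (t, 0)) (c (t, Suc (Suc m)))"
          unfolding btw_iff[OF l(2) cD] using le'_c c_neq by metis
        then show ?thesis using i by (simp del: upt_Suc)
      qed
      ultimately show "?B \<MM> (?xs @ [c (t, 0), c (t, Suc (Suc m))])" unfolding B[OF xs] by blast
    qed
    then have "?G \<MM> (map c [(t, 0), (t, Suc (Suc m))])" by (simp only: list.map)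
    moreover have "definable ?Lp C (length [(t, 0), (t, 1)]) ?G"
      using defG by (simp only: list.size add_0 One_nat_def numeral_2_eq_2 add_Suc_right add_0_right)
    ultimately have "?G \<MM> (map c [(t, 0), (t, 1)])" using indP[OF _ order_equivalent_pair[OF l]] by blast
    then have "?G \<MM> [c (t, 0), c (t, 1)]" by (simp only: list.map)
    then obtain xs where xs: "xs \<in> tuples \<MM> (Suc m)" "?B \<MM> (xs @ [c (t, 0), c (t, 1)])" by blast
    then have "distinct xs" "\<forall>i<Suc m. btw \<MM> (xs ! i) (c (t, 0)) (c (t, 1))" unfolding B[OF xs(1)] by blast+
    moreover have len: "length xs = Suc m" "set xs \<subseteq> dom \<MM>" using xs(1) by (auto simp: tuples_def)
    ultimately have "set xs \<subseteq> ?S" by (auto simp: in_set_conv_nth)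
    from card_mono[OF fin this] show False
      using \<open>distinct xs\<close> len by (simp add: distinct_card m_def)
  qed

  have "\<forall>t. \<exists>kn :: nat \<times> nat. 1 \<le> fst kn \<and> real (fst kn) < \<alpha> * snd kn \<and> \<alpha> * snd kn < fst kn + (1 / 2) ^ Suc t"
    using irrational_approximation[OF assms(13,9)] by (simp add: split_paired_Ex)
  from choice[OF this] obtain kn :: "nat \<Rightarrow> nat \<times> nat" where
    "\<forall>t. 1 \<le> fst (kn t) \<and> real (fst (kn t)) < \<alpha> * snd (kn t) \<and> \<alpha> * snd (kn t) < fst (kn t) + (1 / 2) ^ Suc t" ..
  then obtain k n where k: "\<And>t. 1 \<le> k t" and kn: "\<And>t. real (k t) < \<alpha> * real (n t)"
    "\<And>t. \<alpha> * real (n t) < k t + (1 / 2) ^ Suc t"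
    by (metis that[of "\<lambda>t. fst (kn t)" "\<lambda>t. snd (kn t)"])
  have kn_le: "k t \<le> n t" for t
  proof -
    have "\<alpha> * real (n t) \<le> 1 * real (n t)" using assms(10) by (intro mult_right_mono) auto
    then show ?thesis using kn(1)[of t] by linarith
  qed
  have n1: "1 \<le> n t" for t using k[of t] kn_le[of t] by linarith
  \<comment> \<open>The whole array is the base, so one configuration for all rows at once serves
    every finite number \<open>m\<close> of rows below.\<close>
  have "\<exists>b z. configuration (range c) b k z \<and>
    (\<forall>t. length (z t) = n t \<and> btw \<MM> ((z t ! 0 # [c (t, 0), c (t, 1)]) ! 0)
      ((z t ! 0 # [c (t, 0), c (t, 1)]) ! 1) ((z t ! 0 # [c (t, 0), c (t, 1)]) ! 2))"
    by (rule configuration_exists[OF MC sat inf assms(6) c(1), where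
          P = "\<lambda>t M as. btw M (as ! 0) (as ! 1) (as ! 2)" and c = "\<lambda>t. [c (t, 0), c (t, 1)]"])
      (use k kn_le cD inf_btw def_btw in auto)
  then obtain b0 z where conf: "configuration (range c) b0 k z"
    and z: "\<And>t. length (z t) = n t" "\<And>t. btw \<MM> (z t ! 0) (c (t, 0)) (c (t, 1))" by auto
  note cf = configurationD[OF conf]
  have b0z: "b0 \<notin> set (z t)" for t
  proof
    assume "b0 \<in> set (z t)"
    then have "b0 \<notin> acl L \<MM> (insert b0 (range c))" by (rule configuration_notin_base[OF conf k])
    then show False using cl_ext[of "insert b0 (range c)"] cf(1,2) by blast
  qed
  let ?F = "\<lambda>t F. definable L C (n t + 1) F \<and> F \<MM> (z t @ [b0]) \<and>
    (\<forall>N\<in>C. \<forall>z'\<in>tuples N (n t). \<forall>b'\<in>dom N. F N (z' @ [b']) \<longrightarrow>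
      distinct z' \<and> (\<forall>J\<subseteq>set z'. card J = k t \<longrightarrow> set z' \<subseteq> acl L N (insert b' J)))"
  have "\<forall>t. \<exists>F. ?F t F"
    using uniform_formula[OF MC cf(4,5,2) b0z cf(6)] unfolding z(1) by (rule allI)
  from choice[OF this] obtain F where F0: "\<forall>t. ?F t (F t)" ..
  note F = F0[rule_format, THEN conjunct1] F0[rule_format, THEN conjunct2, THEN conjunct1]
    F0[THEN spec, THEN conjunct2, THEN conjunct2]

  define \<psi> where "\<psi> t M as \<longleftrightarrow> (\<exists>x\<in>dom M. solution p (n t) (F t) M (as ! 0) x \<and> btw M x (as ! 1) (as ! 2))"
    for t and M :: "('f, 'r, 'u) fo_struct" and as
  have def_\<psi>: "definable ?Lp C 3 (\<psi> t)" for t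
  proof -
    let ?B = "\<lambda>M as. solution p (n t) (F t) M (as ! 1) (as ! 0) \<and> btw M (as ! 0) (as ! 2) (as ! 3)"
    have "definable ?Lp C 4 ?B"
    proof (intro definable_conj definable_add_pred[OF def_btw])
      have "definable ?Lp C 4 (\<lambda>M as. solution p (n t) (F t) M (map ((!) as) [1, 0] ! 0) (map ((!) as) [1, 0] ! 1))"
        by (rule definable_map[OF definable_solution[OF F(1) n1], of "[1, 0]"]) auto
      then show "definable ?Lp C 4 (\<lambda>M as. solution p (n t) (F t) M (as ! 1) (as ! 0))" by simp
    qed auto
    then have "definable ?Lp C (Suc 3) ?B" by simp
    from definable_ex[OF this] show ?thesis by (simp add: \<psi>_def[abs_def] eval_nat_numeral)
  qed
  have fin_\<psi>: "\<exists>x\<in>dom \<MM>. \<forall>t<m. \<psi> t \<MM> [x, c (t, 0), c (t, 1)]" for m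
  proof -
    \<comment> \<open>Entries \<open>2 * t\<close> and \<open>Suc (2 * t)\<close> are the endpoints
      for row \<open>t\<close>. In \<open>z' @ x # a\<close> they are shifted by
      \<open>n t + 1\<close>, for the tuple \<open>z'\<close> and the element
      \<open>x\<close>.\<close>
    define a where "a = map (\<lambda>j. c (j div 2, j mod 2)) [0..<2 * m]"
    have la: "length a = 2 * m" by (simp add: a_def)
    have an: "a ! (2 * t) = c (t, 0)" "a ! Suc (2 * t) = c (t, 1)" if "t < m" for t
      using that by (simp_all add: a_def)
    have "inj_on (\<lambda>j. c (j div 2, j mod 2)) X" for X :: "nat set"
      by (rule inj_onI) (metis c(2) div_mult_mod_eq injD prod.inject)
    then have da: "distinct a" by (simp add: a_def distinct_map)
    let ?P = "\<lambda>t M as. F t M (take (n t + 1) as) \<and> btw M (as ! 0) (as ! (n t + 1 + 2 * t)) (as ! (n t + 1 + Suc (2 * t)))"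
    have P: "?P t M (z' @ x # a) \<longleftrightarrow> F t M (z' @ [x]) \<and> btw M (z' ! 0) (c (t, 0)) (c (t, 1))"
      if "t < m" "length z' = n t" for t M z' x
      using that n1[of t] an[OF that(1)] by (simp add: nth_append)
    have "\<exists>x\<in>dom \<MM>. \<forall>t<m. \<exists>z'\<in>tuples \<MM> (length (z t)). ?P t \<MM> (z' @ x # a) \<and>
      (\<forall>i<length (z t). rint \<MM> p [z' ! i])"
    proof (rule common_solution[OF MC TS assms(8) sat Ta assms(10) _ sum_half_powers _ assms(9) conf k da])
      show "\<alpha> * real (length (z t)) \<le> real (k t) + (1 / 2) ^ Suc t" for t using kn(2)[of t] z(1) by simp
      show "(0 :: real) \<le> (1 / 2) ^ Suc t" for t by simp
      show "set a \<subseteq> range c" by (auto simp: a_def)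
      fix t assume t: "t < m"
      show "?P t \<MM> (z t @ b0 # a)" unfolding P[OF t z(1)] using F(2) z(2) by blast
      have "definable L C (n t + 1 + length a) (\<lambda>M as. F t M (take (n t + 1) as))" by (rule definable_take[OF F(1)])
      moreover have "definable L C (n t + 1 + length a)
          (\<lambda>M as. btw M (as ! 0) (as ! (n t + 1 + 2 * t)) (as ! (n t + 1 + Suc (2 * t))))"
        using t la by (intro def_btw) auto
      ultimately have "definable L C (n t + 1 + length a) (?P t)" by (rule definable_conj)
      then show "definable L C (length (z t) + (1 + length a)) (?P t)" by (simp only: z(1) add.assoc)
    qed
    then obtain x where x: "x \<in> dom \<MM>" "\<And>t. t < m \<Longrightarrow> \<exists>z'\<in>tuples \<MM> (length (z t)). ?P t \<MM> (z' @ x # a) \<and>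
      (\<forall>i<length (z t). rint \<MM> p [z' ! i])" by blast
    have "\<psi> t \<MM> [x, c (t, 0), c (t, 1)]" if t: "t < m" for t
    proof -
      obtain z' where z': "z' \<in> tuples \<MM> (n t)" "?P t \<MM> (z' @ x # a)" "\<forall>i<n t. rint \<MM> p [z' ! i]"
        using x(2)[OF t] unfolding z(1) by blast
      have len: "length z' = n t" "set z' \<subseteq> dom \<MM>" using z'(1) by (auto simp: tuples_def)
      then have "z' ! 0 \<in> dom \<MM>" using n1[of t] by (metis nth_mem subsetD less_le_trans zero_less_one)
      then show ?thesis
        unfolding \<psi>_def solution_def using P[OF t len(1)] z' by (intro bexI[of _ "z' ! 0"]) auto
    qed
    then show ?thesis using x(1) by blast
  qed
  have "\<forall>t. \<exists>\<phi>. \<phi> \<in> fmlas ?Lp 3 \<and> (\<forall>as\<in>tuples \<MM> 3. holds \<MM> \<phi> as \<longleftrightarrow> \<psi> t \<MM> as)"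
    using def_\<psi> MC unfolding definable_def by blast
  from choice[OF this] obtain \<phi> where \<phi>: "\<forall>t. \<phi> t \<in> fmlas ?Lp 3 \<and> (\<forall>as\<in>tuples \<MM> 3. holds \<MM> (\<phi> t) as \<longleftrightarrow> \<psi> t \<MM> as)" ..
  have \<phi>\<psi>: "holds \<MM> (\<phi> t) [x, c (t, 0), c (t, 1)] \<longleftrightarrow> \<psi> t \<MM> [x, c (t, 0), c (t, 1)]" if "x \<in> dom \<MM>" for t x
    using \<phi> that cD by (simp add: tuples_def)
  let ?\<Sigma> = "range (\<lambda>t. (\<phi> t, [c (t, 0), c (t, 1)]))"
  have "\<exists>xs\<in>tuples \<MM> 1. realizes \<MM> ?\<Sigma> xs"
  proof (rule satp[unfolded aleph1_saturated_def, rule_format, of "range c"], intro conjI allI impI)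
    show "range c \<subseteq> dom \<MM>" "countable (range c)" using c(1) by auto
    show "?\<Sigma> \<subseteq> formulas_over ?Lp (range c) 1" using \<phi> by (auto simp: formulas_over_def eval_nat_numeral)
    fix \<Sigma>' assume "\<Sigma>' \<subseteq> ?\<Sigma> \<and> finite \<Sigma>'"
    then obtain I where I: "finite I" "\<Sigma>' = (\<lambda>t. (\<phi> t, [c (t, 0), c (t, 1)])) ` I"
      by (meson finite_subset_image)
    obtain m where m: "I \<subseteq> {..<m}" using finite_nat_iff_bounded I(1) by blast
    obtain x where x: "x \<in> dom \<MM>" "\<forall>t<m. \<psi> t \<MM> [x, c (t, 0), c (t, 1)]" using fin_\<psi> by blast
    have "realizes \<MM> \<Sigma>' [x]" unfolding realizes_def I(2) using \<phi>\<psi>[OF x(1)] x(2) m by auto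
    then show "\<exists>xs\<in>tuples \<MM> 1. realizes \<MM> \<Sigma>' xs" using x(1) by (intro bexI[of _ "[x]"]) (auto simp: tuples_def)
  qed
  then obtain b where b: "b \<in> dom \<MM>" "realizes \<MM> ?\<Sigma> [b]" by (auto simp: tuples_def length_Suc_conv)
  have b\<psi>: "\<psi> t \<MM> [b, c (t, 0), c (t, 1)]" for t
  proof -
    have "holds \<MM> (\<phi> t) ([b] @ [c (t, 0), c (t, 1)])" using b(2) unfolding realizes_def by blast
    then show ?thesis using \<phi>\<psi>[OF b(1)] by simp
  qed

  have "mutually_indiscernible ?Lp \<MM> {} UNIV (\<lambda>t i. [c (t, i)])"
    by (rule rows_mutually_indiscernible[OF c(1)]) (use ind in blast)
  moreover have "realizes \<MM> (trivial_type 1) [b]"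
    by (auto simp: realizes_def trivial_type_def holds_def)
  moreover have "[b] \<in> tuples \<MM> 1" using b(1) by (simp add: tuples_def)
  moreover have "dp_rk_less ?Lp \<MM> 1 (trivial_type 1) {} (UNIV :: nat set)"
    using sd unfolding strongly_dependent_def by blast
  ultimately obtain t where t: "indiscernible ?Lp \<MM> ({} \<union> set [b]) (\<lambda>i. [c (t, i)])"
    unfolding dp_rk_less_def by blast
  \<comment> \<open>The statement about the first two entries moves to the pairs at
    \<open>2 * i\<close> and \<open>Suc (2 * i)\<close>, whose intervals are pairwise disjoint.
    \<open>\<theta>\<close> permutes the arguments, as \<open>indiscernible\<close> reads entries of
    the sequence before parameters.\<close>
  have row: "\<psi> t \<MM> [b, c (t, 2 * i), c (t, Suc (2 * i))]" for i
  proof -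
    have "definable ?Lp C 3 (\<lambda>M as. \<psi> t M [as ! 2, as ! 0, as ! 1])"
      by (rule definable_map[OF def_\<psi>, of "[2, 0, 1]"]) auto
    then obtain \<theta> where \<theta>: "\<theta> \<in> fmlas ?Lp 3"
      "\<And>M as. M \<in> C \<Longrightarrow> as \<in> tuples M 3 \<Longrightarrow> holds M \<theta> as \<longleftrightarrow> \<psi> t M [as ! 2, as ! 0, as ! 1]"
      by (rule definableE) (rule that)
    have h: "holds \<MM> \<theta> [c x, c y, b] \<longleftrightarrow> \<psi> t \<MM> [b, c x, c y]" for x y
      using \<theta>(2)[OF MC, of "[c x, c y, b]"] cD b(1) by (simp add: tuples_def)
    let ?S = "\<lambda>i. [c (t, i)]"
    have "(\<theta>, [b]) \<in> formulas_over ?Lp ({} \<union> set [b]) (length (concat (map ?S [0, 1])))"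
      using \<theta>(1) by (simp add: formulas_over_def eval_nat_numeral)
    moreover have "\<forall>(\<phi>, e)\<in>formulas_over ?Lp ({} \<union> set [b]) (length (concat (map ?S [0, 1]))).
        holds \<MM> \<phi> (concat (map ?S [0, 1]) @ e) \<longleftrightarrow> holds \<MM> \<phi> (concat (map ?S [2 * i, Suc (2 * i)]) @ e)"
      using t[unfolded indiscernible_def, THEN conjunct2, rule_format, of "[0, 1]" "[2 * i, Suc (2 * i)]"] by simp
    ultimately have "holds \<MM> \<theta> (concat (map ?S [0, 1]) @ [b]) \<longleftrightarrow>
        holds \<MM> \<theta> (concat (map ?S [2 * i, Suc (2 * i)]) @ [b])" by blast
    then show ?thesis using h b\<psi>[of t] by simp
  qed
  then have "\<forall>i. \<exists>x. x \<in> dom \<MM> \<and> solution p (n t) (F t) \<MM> b x \<and> btw \<MM> x (c (t, 2 * i)) (c (t, Suc (2 * i)))"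
    unfolding \<psi>_def by auto
  from choice[OF this] obtain x where x: "\<forall>i. x i \<in> dom \<MM> \<and> solution p (n t) (F t) \<MM> b (x i) \<and>
    btw \<MM> (x i) (c (t, 2 * i)) (c (t, Suc (2 * i)))" ..
  \<comment> \<open>A common point of both intervals would put \<open>c (t, 2 * j)\<close> below
    \<open>c (t, Suc (2 * i))\<close> in the sense of \<open>le'\<close>, against the order of the
    row.\<close>
  have "x i \<noteq> x j" if "i < j" for i j
  proof
    assume eq: "x i = x j"
    have l: "lex_less (t, 2 * i) (t, Suc (2 * i))" "lex_less (t, 2 * j) (t, Suc (2 * j))"
      "lex_less (t, Suc (2 * i)) (t, 2 * j)" using that by (auto simp: lex_less_def)
    have "le' (x i) (c (t, Suc (2 * i)))" "le' (c (t, 2 * j)) (x j)"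
      using x btw_iff[OF l(1)] btw_iff[OF l(2)] by blast+
    then have "le' (c (t, 2 * j)) (c (t, Suc (2 * i)))"
      using le'_trans[of "c (t, 2 * j)" "x j"] eq x cD by simp
    then show False using le'_antisym[OF le'_c[OF l(3)]] c_neq[OF l(3)] cD by blast
  qed
  then have "inj x" by (intro injI) (metis linorder_neqE_nat)
  then have "infinite (range x)" by (rule range_inj_infinite)
  moreover have "range x \<subseteq> {y\<in>dom \<MM>. solution p (n t) (F t) \<MM> b y}" using x by blast
  moreover have "finite {y\<in>dom \<MM>. solution p (n t) (F t) \<MM> b y}"
    by (rule finitely_many_solutions[OF Ta MC F(1,3) kn_le n1 kn(1) b(1)])
  ultimately show False using finite_subset by blast
qed

end
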